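(* Let $k\ge1$, let $a,b,p,q$ be positive integers with $q\le p$, and let $\lambda\in\mathcal P_k$. Let $$\mathcal H^\lambda=\mathrm{span}_{\mathbb C}\{v_T\ |\ T\in\mathcal T_\lambda\}$$ be the vector space with basis indexed by $\mathcal T_\lambda$. Define an action of (the generators $w_i$, $t_{s_i}$, $x_1$ of) $\mathcal H_k^{\mathrm{ext}}$ by $$w_i\cdot v_T=c_T(i)v_T\quad(0\le i\le k),$$ $$t_{s_i}\cdot v_T=[t_i]_{T,T}v_T+[t_i]_{T,s_iT}v_{s_iT}\quad(1\le i\le k-1),\qquad x_1\cdot v_T=[x_1]_{T,T}v_T+[x_1]_{T,s_0T}v_{s_0T},$$ with complex coefficients, where $[t_i]_{T,s_iT}=0$ if and only if $c_T(i)=c_T(i+1)\pm1$, and $[x_1]_{T,s_0T}=0$ if and only if $c_T(1)=\frac12(\pm(a+p)\pm(b+q))$ (for some choice of the signs). Then $\mathcal H^\lambda$ is a simple $\mathcal H_k^{\mathrm{ext}}$-module with respect to this action if and only if the following hold (for all $T\in\mathcal T_\lambda$ and all admissible $i,j$): (1) $[t_i]_{T,T}=1/(c_T(i+1)-c_T(i))$; (2) $\displaystyle[x_1]_{T,T}=\frac{(a-p)c_T(1)+c_T(1)^2+\left(\frac{(a+p)+(b+q)}2\right)\left(\frac{(a+p)-(b+q)}2\right)}{2c_T(1)}$; (3) (Commutation) $[t_i]_{s_jT,s_is_jT}[t_j]_{T,s_jT}=[t_i]_{T,s_iT}[t_j]_{s_iT,s_js_iT}$ for $j\ne i\pm1$,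 and $[t_i]_{s_0T,s_is_0T}[x_1]_{T,s_0T}=[t_i]_{T,s_iT}[x_1]_{s_iT,s_0s_iT}$ for $i>1$; (4) (Involutions) $[t_i]_{T,s_iT}[t_i]_{s_iT,T}=1-([t_i]_{T,T})^2$; (5) (Quadratic relation) $$[x_1]_{T,s_0T}[x_1]_{s_0T,T}=-\tfrac1{(2c_T(1))^2}\left(c_T(1)+\tfrac{(a+p)+(b+q)}2\right)\left(c_T(1)-\tfrac{(a+p)-(b+q)}2\right)\left(c_T(1)-\tfrac{(a+p)+(b+q)}2\right)\left(c_T(1)+\tfrac{(a+p)-(b+q)}2\right);$$ (6) (Braid relations) $$[t_i]_{T,s_iT}[t_{i+1}]_{s_iT,s_{i+1}s_iT}[t_i]_{s_{i+1}s_iT,s_is_{i+1}s_iT}=[t_{i+1}]_{T,s_{i+1}T}[t_i]_{s_{i+1}T,s_is_{i+1}T}[t_{i+1}]_{s_is_{i+1}T,s_is_{i+1}s_iT},$$ $$[x_1]_{s_1T,s_0s_1T}[x_1]_{s_1s_0s_1T,s_0s_1s_0s_1T}[t_1]_{T,s_1T}[t_1]_{s_0s_1T,s_1s_0s_1T}=[x_1]_{T,s_0T}[x_1]_{s_1s_0T,s_0s_1s_0T}[t_1]_{s_0T,s_1s_0T}[t_1]_{s_0s_1s_0T,s_1s_0s_1s_0T}.$$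
   Context: **Partitions and tableaux.** The box in column $c$ and row $r$ of a partition has content $c-r$, written $c(B)$. $\mathcal P_0=\mathcal P$ is the set of partitions $\lambda$ with at most $p+q$ rows such that $\lambda_{q+1}=\cdots=\lambda_p=a$, $\lambda_q\ge\max(a,b)$, and $\lambda_i+\lambda_{p+q-i+1}=a+b$ for $i=1,\dots,q$. For $i\ge1$, $\mathcal P_i$ is the set of partitions obtained by adding a box to an element of $\mathcal P_{i-1}$. For $\lambda\in\mathcal P_k$, $$\mathcal T_\lambda=\{T=(T^{(0)}\searrow\cdots\searrow T^{(k)}=\lambda)\ |\ T^{(i)}\in\mathcal P_i\},$$ where $T^{(i)}$ is obtained from $T^{(i-1)}$ by adding one box $T^{(i)}/T^{(i-1)}$. Shifted contents: with $\mathcal B_\mu$ the set of boxes of $\mu$ in rows $p+1$ and below and $\mu=T^{(0)}$, $$c_T(0)=abq-(|\mathcal B_\mu|+\tfrac12)(a-p+b-q)+2\sum_{B\in\mathcal B_\mu}c(B),\qquad c_T(i)=c(T^{(i)}/T^{(i-1)})-\tfrac12(a-p+b-q)\ (1\le i\le k).$$ For $1\le i\le k-1$, if $c_T(i)\ne c_T(i+1)\pm1$, $s_iT$ is the tableau obtained from $T$ by switching the order of adding the $i$-th and $(i+1)$-st boxes (only $T^{(i)}$ changes). If $c_T(1)\ne\frac12(\pm(a+p)\pm(b+q))$ for all signs, there are exactly two $\nu\in\mathcal P$ contained in $T^{(1)}$, and $s_0T$ is obtained from $T$ by replacing $T^{(0)}$ with the other one. When $s_iT$ (resp. $s_0T$)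 is not defined, the corresponding coefficient is $0$, the term with $v_{s_iT}$ (resp. $v_{s_0T}$) is absent, and any product containing that coefficient is read as $0$. **The algebra $\mathcal G_k$.** $S_k$ is the symmetric group, $s_i=(i\ i{+}1)$. $\mathcal G_k$ is the unital associative $\mathbb C$-algebra generated by $t_w$ ($w\in S_k$), $x_1,\dots,x_k$, $y_1,\dots,y_k$, $z_0,\dots,z_k$, subject to the relations below. Here $m_1=0$ and, for $j>1$, $m_j=\sum_{1\le i<j}m_{i,j}$, where $m_{j-1,j}=x_j-t_{s_{j-1}}x_{j-1}t_{s_{j-1}}$ and $m_{i,j}=t_{(i\ j-1)}m_{j-1,j}t_{(i\ j-1)}$ for $1\le i<j-1$. - $z_i=x_i+y_i-m_i$ for $1\le i\le k$; - $t_wt_{w'}=t_{ww'}$ (with $t_e=1$); - $x_ix_j=x_jx_i$, $y_iy_j=y_jy_i$, $z_iz_j=z_jz_i$ for all admissible $i,j$; - $t_{s_i}x_j=x_jt_{s_i}$, $t_{s_i}y_j=y_jt_{s_i}$, $t_{s_i}z_j=z_jt_{s_i}$ for $j\ne i,i+1$; - $(z_0+\cdots+z_i)x_j=x_j(z_0+\cdots+z_i)$ and $(z_0+\cdots+z_i)y_j=y_j(z_0+\cdots+z_i)$ for $i\ge j$; - $t_{s_i}(x_i+x_{i+1})=(x_i+x_{i+1})t_{s_i}$ and $t_{s_i}(y_i+y_{i+1})=(y_i+y_{i+1})t_{s_i}$ for $1\le i\le k-1$; - $t_{s_i}t_{s_{i+1}}(x_{i+1}-t_{s_i}x_it_{s_i})t_{s_{i+1}}t_{s_i}=x_{i+2}-t_{s_{i+1}}x_{i+1}t_{s_{i+1}}$,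 and the same with $y$ in place of $x$, for $1\le i\le k-2$; - $x_{i+1}-t_{s_i}x_it_{s_i}=y_{i+1}-t_{s_i}y_it_{s_i}$ for $1\le i\le k-1$. **The algebra $\mathcal H_k^{\mathrm{ext}}$** is the quotient of $\mathcal G_k$ by $t_{s_i}x_i=x_{i+1}t_{s_i}-1$, $t_{s_i}y_i=y_{i+1}t_{s_i}-1$ ($1\le i\le k-1$), $(x_1-a)(x_1+p)=0$, $(y_1-b)(y_1+q)=0$. Put $w_i=z_i-\frac12(a-p+b-q)$ for $0\le i\le k$; the algebra $\mathcal H_k^{\mathrm{ext}}$ is generated by $w_0,\dots,w_k,x_1,t_{s_1},\dots,t_{s_{k-1}}$.
   Formalization: The formal statement additionally assumes c_T(1) ≠ 0 for all T in T_λ, since (2) and (5) divide by 2c_T(1) and are undefined otherwise (e.g. a=1, p=2, b=2, q=1, λ=(2,2,1)). *)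

theory Defs
  imports
    Complex_Main
    "HOL-Library.Poly_Mapping"
    "HOL-Combinatorics.Permutations"
    "HOL-Algebra.QuotRing"
begin

text \<open>
  A partition is a function \<open>\<mu> :: nat \<Rightarrow> nat\<close> whose value at \<open>r \<ge> 1\<close> is the length of row \<open>r\<close>;
  the unused argument \<open>0\<close> is normalised to \<open>0\<close>, so that equal partitions are equal functions.
  A box is a pair (row, column), both counted from 1.
\<close>

type_synonym partn = "nat \<Rightarrow> nat"
type_synonym box = "nat \<times> nat"

definition is_partn :: "partn \<Rightarrow> bool" where
  "is_partn \<mu> \<longleftrightarrow> \<mu> 0 = 0 \<and> (\<forall>r\<ge>1. \<mu> (Suc r) \<le> \<mu> r) \<and> finite {r. \<mu> r \<noteq> 0}"

definition boxes :: "partn \<Rightarrow> box set" where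
  "boxes \<mu> = {(r, c). 1 \<le> r \<and> 1 \<le> c \<and> c \<le> \<mu> r}"

definition content :: "box \<Rightarrow> int" where
  "content B = int (snd B) - int (fst B)"

definition adds_box :: "partn \<Rightarrow> partn \<Rightarrow> bool" where
  "adds_box \<mu> \<nu> \<longleftrightarrow> is_partn \<mu> \<and> is_partn \<nu> \<and> (\<exists>B. B \<notin> boxes \<mu> \<and> boxes \<nu> = insert B (boxes \<mu>))"

text \<open>The box \<open>\<nu>/\<mu>\<close>; meaningful when \<open>adds_box \<mu> \<nu>\<close> holds.\<close>

definition added_box :: "partn \<Rightarrow> partn \<Rightarrow> box" where
  "added_box \<mu> \<nu> = the_elem (boxes \<nu> - boxes \<mu>)"

fun \<P> :: "nat \<Rightarrow> nat \<Rightarrow> nat \<Rightarrow> nat \<Rightarrow> nat \<Rightarrow> partn set" where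
  "\<P> a b p q 0 =
     {\<mu>. is_partn \<mu> \<and> (\<forall>r > p + q. \<mu> r = 0) \<and> (\<forall>r \<in> {q+1..p}. \<mu> r = a) \<and> \<mu> q \<ge> max a b \<and>
         (\<forall>r \<in> {1..q}. \<mu> r + \<mu> (p + q - r + 1) = a + b)}"
| "\<P> a b p q (Suc i) = {\<nu>. \<exists>\<mu> \<in> \<P> a b p q i. adds_box \<mu> \<nu>}"

text \<open>A tableau \<open>T = (T\<^sup>0, \<dots>, T\<^sup>k)\<close> is the list of its partitions, so that \<open>T ! i\<close> is its \<open>i\<close>-th partition.\<close>

type_synonym tableau = "partn list"

definition tableaux :: "nat \<Rightarrow> nat \<Rightarrow> nat \<Rightarrow> nat \<Rightarrow> nat \<Rightarrow> partn \<Rightarrow> tableau set" where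
  "tableaux a b p q k lam =
     {T. length T = k + 1 \<and> T ! k = lam \<and> (\<forall>i\<le>k. T ! i \<in> \<P> a b p q i) \<and>
         (\<forall>i<k. adds_box (T ! i) (T ! (i + 1)))}"

definition half_shift :: "nat \<Rightarrow> nat \<Rightarrow> nat \<Rightarrow> nat \<Rightarrow> complex" where
  "half_shift a b p q = (of_nat a - of_nat p + of_nat b - of_nat q) / 2"

definition shifted_content ::
  "nat \<Rightarrow> nat \<Rightarrow> nat \<Rightarrow> nat \<Rightarrow> tableau \<Rightarrow> nat \<Rightarrow> complex" where
  "shifted_content a b p q T i =
     (if i = 0
      then let \<B> = {B \<in> boxes (T ! 0). p + 1 \<le> fst B} in
             of_nat (a * b * q) - (of_nat (card \<B>) + 1/2) * (2 * half_shift a b p q)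
             + 2 * (\<Sum>B\<in>\<B>. of_int (content B))
      else of_int (content (added_box (T ! (i - 1)) (T ! i))) - half_shift a b p q)"

text \<open>\<open>c = (\<plusminus>(a + p) \<plusminus> (b + q)) / 2\<close> for some choice of the two signs\<close>

definition exceptional :: "nat \<Rightarrow> nat \<Rightarrow> nat \<Rightarrow> nat \<Rightarrow> complex \<Rightarrow> bool" where
  "exceptional a b p q c \<longleftrightarrow>
     (\<exists>\<epsilon>\<in>{1, -1}. \<exists>\<eta>\<in>{1, -1}. c = (\<epsilon> * of_nat (a + p) + \<eta> * of_nat (b + q)) / 2)"

text \<open>
  The partial operation \<open>T \<mapsto> s\<^sub>i T\<close>, with \<open>None\<close> for ``not defined''. For \<open>i \<ge> 1\<close> the new \<open>i\<close>-th
  partition is \<open>T ! (i - 1)\<close> together with the box that \<open>T\<close> adds in step \<open>i + 1\<close>.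
\<close>

definition switch1 :: "nat \<Rightarrow> nat \<Rightarrow> nat \<Rightarrow> nat \<Rightarrow> nat \<Rightarrow> tableau \<Rightarrow> tableau option" where
  "switch1 a b p q i T =
     (if i = 0
      then if exceptional a b p q (shifted_content a b p q T 1) then None
           else Some (T[0 := (THE \<nu>. \<nu> \<in> \<P> a b p q 0 \<and> boxes \<nu> \<subseteq> boxes (T ! 1) \<and> \<nu> \<noteq> T ! 0)])
      else if shifted_content a b p q T i = shifted_content a b p q T (i + 1) + 1 \<or>
              shifted_content a b p q T i = shifted_content a b p q T (i + 1) - 1 then None
           else let r = fst (added_box (T ! i) (T ! (i + 1)))
                in Some (T[i := (T ! (i - 1))(r := (T ! (i - 1)) r + 1)]))"

definition switch :: "nat \<Rightarrow> nat \<Rightarrow> nat \<Rightarrow> nat \<Rightarrow> nat \<Rightarrow> tableau option \<Rightarrow> tableau option" where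
  "switch a b p q i S = Option.bind S (switch1 a b p q i)"

text \<open>
  The coefficient \<open>[M]\<^bsub>S,S'\<^esub>\<close>, read as \<open>0\<close> if one of the two tableaux is not defined; as a
  consequence every product containing such a coefficient is \<open>0\<close>.
\<close>

definition entry :: "(tableau \<Rightarrow> tableau \<Rightarrow> complex) \<Rightarrow> tableau option \<Rightarrow> tableau option \<Rightarrow> complex" where
  "entry M S S' = (case (S, S') of (Some T, Some T') \<Rightarrow> M T T' | _ \<Rightarrow> 0)"


text \<open>
  Free associative algebras over \<open>\<complex>\<close>: finitely supported functions on words, with the convolution
  product that \<^theory>\<open>HOL-Library.Poly_Mapping\<close> provides for a monoid (written additively) of exponents.
\<close>

datatype 'g fword = Word (letters: "'g list")

instantiation fword :: (type) monoid_add
begin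
definition "0 = Word []"
definition "u + v = Word (letters u @ letters v)"
instance by standard (auto simp: zero_fword_def plus_fword_def)
end

datatype gen = Gt "nat \<Rightarrow> nat" | Gx nat | Gy nat | Gz nat

type_synonym falg = "gen fword \<Rightarrow>\<^sub>0 complex"

definition gen_elem :: "gen \<Rightarrow> falg" where
  "gen_elem g = Poly_Mapping.single (Word [g]) 1"

abbreviation tg :: "(nat \<Rightarrow> nat) \<Rightarrow> falg" where "tg w \<equiv> gen_elem (Gt w)"
abbreviation xg :: "nat \<Rightarrow> falg" where "xg i \<equiv> gen_elem (Gx i)"
abbreviation yg :: "nat \<Rightarrow> falg" where "yg i \<equiv> gen_elem (Gy i)"
abbreviation zg :: "nat \<Rightarrow> falg" where "zg i \<equiv> gen_elem (Gz i)"

definition fconst :: "complex \<Rightarrow> falg" where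
  "fconst c = Poly_Mapping.single 0 c"

definition gens :: "nat \<Rightarrow> gen set" where
  "gens k = Gt ` {w. w permutes {1..k}} \<union> Gx ` {1..k} \<union> Gy ` {1..k} \<union> Gz ` {0..k}"

definition free_algebra :: "nat \<Rightarrow> falg ring" where
  "free_algebra k =
     \<lparr>carrier = {f. \<forall>u \<in> Poly_Mapping.keys f. set (letters u) \<subseteq> gens k},
      mult = (*), one = 1, zero = 0, add = (+)\<rparr>"

abbreviation adj :: "nat \<Rightarrow> nat \<Rightarrow> nat" where "adj i \<equiv> transpose i (i + 1)"

definition m2 :: "nat \<Rightarrow> nat \<Rightarrow> falg" where
  "m2 i j =
     (let m = xg j - tg (adj (j - 1)) * xg (j - 1) * tg (adj (j - 1))
      in if i = j - 1 then m else tg (transpose i (j - 1)) * m * tg (transpose i (j - 1)))"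

definition m1 :: "nat \<Rightarrow> falg" where
  "m1 j = (\<Sum>i = 1..<j. m2 i j)"

text \<open>Defining relations, as pairs (left-hand side, right-hand side).\<close>

inductive_set G_rels :: "nat \<Rightarrow> (falg \<times> falg) set" for k :: nat where
  z_def: "1 \<le> i \<Longrightarrow> i \<le> k \<Longrightarrow> (zg i, xg i + yg i - m1 i) \<in> G_rels k"
| t_mult: "w permutes {1..k} \<Longrightarrow> w' permutes {1..k} \<Longrightarrow> (tg w * tg w', tg (w \<circ> w')) \<in> G_rels k"
| t_one: "(tg id, 1) \<in> G_rels k"
| xx: "1 \<le> i \<Longrightarrow> i \<le> k \<Longrightarrow> 1 \<le> j \<Longrightarrow> j \<le> k \<Longrightarrow> (xg i * xg j, xg j * xg i) \<in> G_rels k"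
| yy: "1 \<le> i \<Longrightarrow> i \<le> k \<Longrightarrow> 1 \<le> j \<Longrightarrow> j \<le> k \<Longrightarrow> (yg i * yg j, yg j * yg i) \<in> G_rels k"
| zz: "i \<le> k \<Longrightarrow> j \<le> k \<Longrightarrow> (zg i * zg j, zg j * zg i) \<in> G_rels k"
| tx: "1 \<le> i \<Longrightarrow> i < k \<Longrightarrow> 1 \<le> j \<Longrightarrow> j \<le> k \<Longrightarrow> j \<noteq> i \<Longrightarrow> j \<noteq> i + 1 \<Longrightarrow>
    (tg (adj i) * xg j, xg j * tg (adj i)) \<in> G_rels k"
| ty: "1 \<le> i \<Longrightarrow> i < k \<Longrightarrow> 1 \<le> j \<Longrightarrow> j \<le> k \<Longrightarrow> j \<noteq> i \<Longrightarrow> j \<noteq> i + 1 \<Longrightarrow>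
    (tg (adj i) * yg j, yg j * tg (adj i)) \<in> G_rels k"
| tz: "1 \<le> i \<Longrightarrow> i < k \<Longrightarrow> j \<le> k \<Longrightarrow> j \<noteq> i \<Longrightarrow> j \<noteq> i + 1 \<Longrightarrow>
    (tg (adj i) * zg j, zg j * tg (adj i)) \<in> G_rels k"
| zsum_x: "1 \<le> j \<Longrightarrow> j \<le> i \<Longrightarrow> i \<le> k \<Longrightarrow>
    ((\<Sum>l = 0..i. zg l) * xg j, xg j * (\<Sum>l = 0..i. zg l)) \<in> G_rels k"
| zsum_y: "1 \<le> j \<Longrightarrow> j \<le> i \<Longrightarrow> i \<le> k \<Longrightarrow>
    ((\<Sum>l = 0..i. zg l) * yg j, yg j * (\<Sum>l = 0..i. zg l)) \<in> G_rels k"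
| t_xsum: "1 \<le> i \<Longrightarrow> i < k \<Longrightarrow>
    (tg (adj i) * (xg i + xg (i+1)), (xg i + xg (i+1)) * tg (adj i)) \<in> G_rels k"
| t_ysum: "1 \<le> i \<Longrightarrow> i < k \<Longrightarrow>
    (tg (adj i) * (yg i + yg (i+1)), (yg i + yg (i+1)) * tg (adj i)) \<in> G_rels k"
| conj_x: "1 \<le> i \<Longrightarrow> i + 2 \<le> k \<Longrightarrow>
    (tg (adj i) * tg (adj (i+1)) * (xg (i+1) - tg (adj i) * xg i * tg (adj i))
       * tg (adj (i+1)) * tg (adj i),
     xg (i+2) - tg (adj (i+1)) * xg (i+1) * tg (adj (i+1))) \<in> G_rels k"
| conj_y: "1 \<le> i \<Longrightarrow> i + 2 \<le> k \<Longrightarrow>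
    (tg (adj i) * tg (adj (i+1)) * (yg (i+1) - tg (adj i) * yg i * tg (adj i))
       * tg (adj (i+1)) * tg (adj i),
     yg (i+2) - tg (adj (i+1)) * yg (i+1) * tg (adj (i+1))) \<in> G_rels k"
| xy: "1 \<le> i \<Longrightarrow> i < k \<Longrightarrow>
    (xg (i+1) - tg (adj i) * xg i * tg (adj i), yg (i+1) - tg (adj i) * yg i * tg (adj i)) \<in> G_rels k"

inductive_set H_rels :: "nat \<Rightarrow> nat \<Rightarrow> nat \<Rightarrow> nat \<Rightarrow> nat \<Rightarrow> (falg \<times> falg) set"
  for a b p q k :: nat where
  hecke_x: "1 \<le> i \<Longrightarrow> i < k \<Longrightarrow> (tg (adj i) * xg i, xg (i+1) * tg (adj i) - 1) \<in> H_rels a b p q k"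
| hecke_y: "1 \<le> i \<Longrightarrow> i < k \<Longrightarrow> (tg (adj i) * yg i, yg (i+1) * tg (adj i) - 1) \<in> H_rels a b p q k"
| quad_x: "((xg 1 - of_nat a) * (xg 1 + of_nat p), 0) \<in> H_rels a b p q k"
| quad_y: "((yg 1 - of_nat b) * (yg 1 + of_nat q), 0) \<in> H_rels a b p q k"

definition G_ideal :: "nat \<Rightarrow> falg set" where
  "G_ideal k = Idl\<^bsub>free_algebra k\<^esub> {l - r | l r. (l, r) \<in> G_rels k}"

definition \<G> :: "nat \<Rightarrow> falg set ring" where
  "\<G> k = free_algebra k Quot G_ideal k"

definition to_\<G> :: "nat \<Rightarrow> falg \<Rightarrow> falg set" where
  "to_\<G> k f = G_ideal k +>\<^bsub>free_algebra k\<^esub> f"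

definition H_ideal :: "nat \<Rightarrow> nat \<Rightarrow> nat \<Rightarrow> nat \<Rightarrow> nat \<Rightarrow> falg set set" where
  "H_ideal a b p q k = Idl\<^bsub>\<G> k\<^esub> {to_\<G> k (l - r) | l r. (l, r) \<in> H_rels a b p q k}"

definition H_ext :: "nat \<Rightarrow> nat \<Rightarrow> nat \<Rightarrow> nat \<Rightarrow> nat \<Rightarrow> falg set set ring" where
  "H_ext a b p q k = \<G> k Quot H_ideal a b p q k"

text \<open>The canonical projection from the free algebra to \<open>H_ext\<close>.\<close>

definition to_H :: "nat \<Rightarrow> nat \<Rightarrow> nat \<Rightarrow> nat \<Rightarrow> nat \<Rightarrow> falg \<Rightarrow> falg set set" where
  "to_H a b p q k f = H_ideal a b p q k +>\<^bsub>\<G> k\<^esub> to_\<G> k f"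

definition w_elem :: "nat \<Rightarrow> nat \<Rightarrow> nat \<Rightarrow> nat \<Rightarrow> nat \<Rightarrow> nat \<Rightarrow> falg set set" where
  "w_elem a b p q k i = to_H a b p q k (zg i - fconst (half_shift a b p q))"

definition t_elem :: "nat \<Rightarrow> nat \<Rightarrow> nat \<Rightarrow> nat \<Rightarrow> nat \<Rightarrow> nat \<Rightarrow> falg set set" where
  "t_elem a b p q k i = to_H a b p q k (tg (adj i))"

definition x_elem :: "nat \<Rightarrow> nat \<Rightarrow> nat \<Rightarrow> nat \<Rightarrow> nat \<Rightarrow> nat \<Rightarrow> falg set set" where
  "x_elem a b p q k i = to_H a b p q k (xg i)"


text \<open>Complex vector spaces of formal linear combinations, with scalar multiplication \<open>vscale\<close>.\<close>

definition vscale :: "complex \<Rightarrow> ('t \<Rightarrow>\<^sub>0 complex) \<Rightarrow> 't \<Rightarrow>\<^sub>0 complex" where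
  "vscale c v = Poly_Mapping.map ((*) c) v"

lemma lookup_vscale: "Poly_Mapping.lookup (vscale c v) t = c * Poly_Mapping.lookup v t"
  by (simp add: vscale_def map.rep_eq when_def)

global_interpretation vec: vector_space vscale
  by unfold_locales
     (auto intro!: poly_mapping_eqI simp: lookup_vscale lookup_add algebra_simps)

definition basis_vec :: "'t \<Rightarrow> ('t \<Rightarrow>\<^sub>0 complex)" where
  "basis_vec t = Poly_Mapping.single t 1"

definition opt_vec :: "'t option \<Rightarrow> ('t \<Rightarrow>\<^sub>0 complex)" where
  "opt_vec S = (case S of None \<Rightarrow> 0 | Some t \<Rightarrow> basis_vec t)"

definition Hspace :: "nat \<Rightarrow> nat \<Rightarrow> nat \<Rightarrow> nat \<Rightarrow> nat \<Rightarrow> partn \<Rightarrow> (tableau \<Rightarrow>\<^sub>0 complex) set" where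
  "Hspace a b p q k lam = vec.span (basis_vec ` tableaux a b p q k lam)"

text \<open>
  Left modules over a (not necessarily commutative) complex algebra \<open>A\<close> whose structure map is
  \<open>\<iota> :: complex \<Rightarrow> 'h\<close>. Linearity of each \<open>act h\<close> follows, since \<open>\<iota> c\<close> is central in the cases of
  interest and acts as the scalar \<open>c\<close>.
\<close>

definition algebra_module ::
  "('h, 'm) ring_scheme \<Rightarrow> (complex \<Rightarrow> 'h) \<Rightarrow> ('t \<Rightarrow>\<^sub>0 complex) set \<Rightarrow>
   ('h \<Rightarrow> ('t \<Rightarrow>\<^sub>0 complex) \<Rightarrow> ('t \<Rightarrow>\<^sub>0 complex)) \<Rightarrow> bool" where
  "algebra_module A \<iota> V act \<longleftrightarrow>
     vec.subspace V \<and>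
     (\<forall>h \<in> carrier A. \<forall>v \<in> V. act h v \<in> V) \<and>
     (\<forall>h \<in> carrier A. \<forall>u \<in> V. \<forall>v \<in> V. act h (u + v) = act h u + act h v) \<and>
     (\<forall>g \<in> carrier A. \<forall>h \<in> carrier A. \<forall>v \<in> V. act (g \<oplus>\<^bsub>A\<^esub> h) v = act g v + act h v) \<and>
     (\<forall>g \<in> carrier A. \<forall>h \<in> carrier A. \<forall>v \<in> V. act (g \<otimes>\<^bsub>A\<^esub> h) v = act g (act h v)) \<and>
     (\<forall>v \<in> V. act \<one>\<^bsub>A\<^esub> v = v) \<and>
     (\<forall>c. \<forall>v \<in> V. act (\<iota> c) v = vscale c v)"

definition simple_algebra_module ::
  "('h, 'm) ring_scheme \<Rightarrow> (complex \<Rightarrow> 'h) \<Rightarrow> ('t \<Rightarrow>\<^sub>0 complex) set \<Rightarrow>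
   ('h \<Rightarrow> ('t \<Rightarrow>\<^sub>0 complex) \<Rightarrow> ('t \<Rightarrow>\<^sub>0 complex)) \<Rightarrow> bool" where
  "simple_algebra_module A \<iota> V act \<longleftrightarrow>
     algebra_module A \<iota> V act \<and> V \<noteq> {0} \<and>
     (\<forall>W. vec.subspace W \<and> W \<subseteq> V \<and> (\<forall>h \<in> carrier A. \<forall>v \<in> W. act h v \<in> W) \<longrightarrow> W = {0} \<or> W = V)"

end

theory Submission
  imports Defs
begin

text \<open>
  All defining relations of \<open>\<H>\<^sub>k\<^sup>e\<^sup>x\<^sup>t\<close> follow from relations between \<open>t\<^sub>1, \<dots>, t\<^sub>k\<^sub>-\<^sub>1\<close>, \<open>z\<^sub>0, \<dots>, z\<^sub>k\<close> and \<open>x\<^sub>1\<close>: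
  the Coxeter relations, \<open>t\<^sub>i z\<^sub>i = z\<^sub>i\<^sub>+\<^sub>1 t\<^sub>i - 1\<close>, commutation relations, the quadratic relations for \<open>x\<^sub>1\<close>
  and \<open>y\<^sub>1 = z\<^sub>1 - x\<^sub>1\<close>, and \<open>x\<^sub>1 x\<^sub>2 = x\<^sub>2 x\<^sub>1\<close> with \<open>x\<^sub>2 = t\<^sub>1 x\<^sub>1 t\<^sub>1 + t\<^sub>1\<close>. Conversely these
  relations hold in \<open>\<H>\<^sub>k\<^sup>e\<^sup>x\<^sup>t\<close>. Applied to \<open>v\<^sub>T\<close>, the Hecke relation and the relation for \<open>y\<^sub>1\<close> give the
  diagonal entries (1) and (2). Once these are known, each other relation collapses, by rational identities
  in the contents, to a multiple of one vector \<open>v\<^sub>U\<close>, and the vanishing of that multiple is one of (3) to (6).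

  A tableau is determined by its contents \<open>c\<^sub>T(1), \<dots>, c\<^sub>T(k)\<close>, on which \<open>s\<^sub>i\<close> acts by a swap and \<open>s\<^sub>0\<close> by
  changing the sign of the first one; this gives all identities between words in the \<open>s\<^sub>i\<close>. Simplicity
  holds because the \<open>z\<^sub>i\<close> separate the basis vectors and the moves \<open>s\<^sub>i\<close> connect any two tableaux.
\<close>

text \<open>Two obstacles shape the proof. First, the algebra has a generator t_w for every
  permutation and is a quotient of a quotient of a free algebra, while the action is given on t_i,
  x_1 and z_i only. Building the action therefore needs the Coxeter presentation of S_k inside an
  arbitrary ring and a universal property of the iterated quotient. Secondly, the entries are
  fractions in the contents, and the moves produce new denominators, namely c_T(1) + c_T(2) after
  s_0 and c_T(2) after s_1. Their zeros have to be controlled by the geometry of the partitions: the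
  former forces adjacent contents, at which neither move is defined; the latter, at a tableau where
  s_0 is defined, forces p = q and a = b, and then the troublesome numerator \<sigma> \<delta> is 0
  as well. Formula (2) has this shape because subtracting the quadratic relation of x_1 from that of
  y_1 = z_1 - x_1 cancels the square of x_1. What is left is linear in x_1, and its off-diagonal
  part vanishes because s_0 changes the sign of c_T(1). So both diagonal entries are found before
  any product of off-diagonal coefficients appears.\<close>

section \<open>The Coxeter presentation of the symmetric group\<close>

unbundle no m_inv_syntax

text \<open>\<open>cyc n j\<close> is \<open>s\<^sub>n\<^sub>-\<^sub>1 \<cdots> s\<^sub>j\<close>; for \<open>1 \<le> j \<le> n\<close> these represent the cosets of \<open>S\<^sub>n\<^sub>-\<^sub>1\<close> in \<open>S\<^sub>n\<close>.\<close>

definition cyc :: "nat \<Rightarrow> nat \<Rightarrow> nat \<Rightarrow> nat" where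
  "cyc n j m = (if m = j then n else if j < m \<and> m \<le> n then m - 1 else m)"

lemma cyc_same: "cyc n n = id"
  by (auto simp: cyc_def fun_eq_iff)

lemma cyc_step: "j < n \<Longrightarrow> cyc n j = cyc n (Suc j) \<circ> adj j"
  by (rule ext) (auto simp: cyc_def transpose_def)

lemma cyc_cancel: "j < n \<Longrightarrow> cyc n j \<circ> adj j = cyc n (Suc j)"
  by (rule ext) (auto simp: cyc_def transpose_def)

lemma cyc_adj_below: "Suc i < j \<Longrightarrow> j \<le> n \<Longrightarrow> cyc n j \<circ> adj i = adj i \<circ> cyc n j"
  by (rule ext) (auto simp: cyc_def transpose_def)

lemma cyc_adj_above: "j < i \<Longrightarrow> i < n \<Longrightarrow> cyc n j \<circ> adj i = adj (i - 1) \<circ> cyc n j"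
  by (rule ext) (auto simp: cyc_def transpose_def)

lemma adj_permutes: "1 \<le> i \<Longrightarrow> i < n \<Longrightarrow> adj i permutes {1..n}"
  by (rule permutes_swap_id) auto

lemma cyc_permutes: "1 \<le> j \<Longrightarrow> j \<le> n \<Longrightarrow> cyc n j permutes {1..n}"
proof (induction "n - j" arbitrary: j)
  case 0
  then have "j = n" by simp
  then show ?case by (metis cyc_same permutes_id)
next
  case (Suc d)
  then have "cyc n (Suc j) permutes {1..n}" by simp
  moreover have "adj j permutes {1..n}" using Suc by (intro adj_permutes) auto
  ultimately show ?case using Suc cyc_step[of j n] permutes_compose by force
qed

text \<open>Take for j the point that w sends to n+1. Since \<open>cyc (Suc n) j\<close> sends j
  there too, the quotient u fixes n+1 and lies in S_n.\<close>

lemma permutes_decomp: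
  assumes "w permutes {1..Suc n}"
  obtains u j where "u permutes {1..n}" "1 \<le> j" "j \<le> Suc n" "w = u \<circ> cyc (Suc n) j"
proof -
  define j where "j = inv w (Suc n)"
  define u where "u = w \<circ> inv (cyc (Suc n) j)"
  have wj: "w j = Suc n" using assms by (simp add: j_def permutes_inverses)
  have j: "j \<in> {1..Suc n}" using assms wj permutes_in_image[OF assms, of j] by simp
  have cp: "cyc (Suc n) j permutes {1..Suc n}" using j by (intro cyc_permutes) auto
  have up: "u permutes {1..Suc n}"
    unfolding u_def by (rule permutes_compose[OF permutes_inv[OF cp] assms])
  have "u (Suc n) = Suc n"
  proof -
    have "cyc (Suc n) j j = Suc n" by (simp add: cyc_def)
    then have "inv (cyc (Suc n) j) (Suc n) = j" using cp by (metis permutes_inverses(2))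
    then show ?thesis by (simp add: u_def wj)
  qed
  then have "u permutes {1..n}"
    using up by (auto intro!: permutes_superset[OF up] simp: le_Suc_eq)
  moreover have "w = u \<circ> cyc (Suc n) j"
    using permutes_inv_o(2)[OF cp] by (simp add: u_def comp_assoc)
  ultimately show ?thesis using that j by auto
qed

locale coxeter_generators =
  fixes k :: nat and \<tau> :: "nat \<Rightarrow> 'r::monoid_mult"
  assumes square: "1 \<le> i \<Longrightarrow> i < k \<Longrightarrow> \<tau> i * \<tau> i = 1"
    and braid: "1 \<le> i \<Longrightarrow> Suc i < k \<Longrightarrow> \<tau> i * \<tau> (Suc i) * \<tau> i = \<tau> (Suc i) * \<tau> i * \<tau> (Suc i)"
    and far: "1 \<le> i \<Longrightarrow> Suc i < j \<Longrightarrow> j < k \<Longrightarrow> \<tau> i * \<tau> j = \<tau> j * \<tau> i"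
begin

text \<open>The word in the generators that \<open>cyc n j\<close> stands for. Its indices fall from
  n-1 to j, so that a factor on the right meets \<open>\<tau> j\<close> first.\<close>

definition cprod :: "nat \<Rightarrow> nat \<Rightarrow> 'r" where
  "cprod n j = prod_list (map \<tau> (rev [j..<n]))"

lemma cprod_same [simp]: "cprod n n = 1"
  by (simp add: cprod_def)

lemma cprod_right: "j < n \<Longrightarrow> cprod n j = cprod n (Suc j) * \<tau> j"
  by (simp add: cprod_def upt_conv_Cons)

lemma cprod_left: "j \<le> n \<Longrightarrow> cprod (Suc n) j = \<tau> n * cprod n j"
  by (simp add: cprod_def)

lemma cprod_far:
  assumes "\<And>l. j \<le> l \<Longrightarrow> l < n \<Longrightarrow> g * \<tau> l = \<tau> l * g"
  shows "cprod n j * g = g * cprod n j"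
  using assms
proof (induction n)
  case 0
  then show ?case by (simp add: cprod_def)
next
  case (Suc n)
  show ?case
  proof (cases "j \<le> n")
    case True
    then show ?thesis using Suc.IH Suc.prems
      by (simp add: cprod_left mult.assoc) (metis less_Suc_eq mult.assoc order_refl)
  next
    case False
    then show ?thesis by (simp add: cprod_def)
  qed
qed

text \<open>Moving left, \<open>\<tau> i\<close> passes the letters of index below i-1, meets the
  pair of indices i and i-1, where the braid relation turns it into \<open>\<tau> (i - 1)\<close>,
  and passes the remaining letters.\<close>

lemma cprod_above:
  assumes "1 \<le> j" "j < i" "i < n" "n \<le> k"
  shows "cprod n j * \<tau> i = \<tau> (i - 1) * cprod n j"
  using assms
proof (induction n)
  case 0
  then show ?case by simp
next
  case (Suc n)
  show ?case
  proof (cases "i = n")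
    case True
    then obtain m where m: "n = Suc m" "j \<le> m" using Suc.prems by (cases n) auto
    have c: "cprod m j * \<tau> n = \<tau> n * cprod m j"
      using Suc.prems m by (intro cprod_far far[symmetric]) auto
    have "cprod (Suc n) j * \<tau> i = \<tau> n * \<tau> m * (cprod m j * \<tau> n)"
      using m True by (simp add: cprod_left mult.assoc)
    also have "\<dots> = \<tau> n * \<tau> m * \<tau> n * cprod m j"
      by (simp add: c mult.assoc)
    also have "\<tau> n * \<tau> m * \<tau> n = \<tau> m * \<tau> n * \<tau> m"
      using braid[of m] m Suc.prems by simp
    finally show ?thesis using m True by (simp add: cprod_left mult.assoc)
  next
    case False
    have f: "\<tau> n * \<tau> (i - 1) = \<tau> (i - 1) * \<tau> n"
      using Suc.prems False by (intro far[symmetric]) auto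
    have "cprod (Suc n) j * \<tau> i = (\<tau> n * \<tau> (i - 1)) * cprod n j"
      using Suc False by (simp add: cprod_left mult.assoc)
    also have "\<dots> = \<tau> (i - 1) * cprod (Suc n) j"
      using Suc.prems unfolding f by (simp add: cprod_left mult.assoc)
    finally show ?thesis .
  qed
qed

text \<open>
  The Coxeter relations define a representation of \<open>S\<^sub>k\<close>: \<open>rho\<close> is built along the decompositions
  \<open>w = u \<circ> cyc n j\<close>, and multiplying a coset representative by \<open>s\<^sub>i\<close> either changes \<open>j\<close> or moves
  \<open>s\<^sub>i\<close> to its left.
\<close>

primrec rho :: "nat \<Rightarrow> (nat \<Rightarrow> nat) \<Rightarrow> 'r" where
  "rho 0 w = 1"
| "rho (Suc n) w =
     rho n (w \<circ> inv (cyc (Suc n) (inv w (Suc n)))) * cprod (Suc n) (inv w (Suc n))"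

declare rho.simps(2) [simp del]

text \<open>The recursion of \<open>rho\<close> looks for j through an inverse permutation. For a
  given decomposition j is that preimage of n+1, because u fixes n+1.\<close>

lemma rho_Suc:
  assumes u: "u permutes {1..n}" and j: "1 \<le> j" "j \<le> Suc n"
  shows "rho (Suc n) (u \<circ> cyc (Suc n) j) = rho n u * cprod (Suc n) j"
proof -
  have cp: "cyc (Suc n) j permutes {1..Suc n}" using j by (rule cyc_permutes)
  have up: "u permutes {1..Suc n}" by (rule permutes_subset[OF u]) auto
  have "(u \<circ> cyc (Suc n) j) j = Suc n"
    using permutes_not_in[OF u, of "Suc n"] by (simp add: cyc_def)
  moreover have "(u \<circ> cyc (Suc n) j) permutes {1..Suc n}" by (rule permutes_compose[OF cp up])
  ultimately have i: "inv (u \<circ> cyc (Suc n) j) (Suc n) = j" by (metis permutes_inverses(2))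
  show ?thesis unfolding rho.simps i using permutes_inv_o(1)[OF cp] by (simp add: comp_assoc)
qed

lemma rho_id [simp]: "rho n id = 1"
proof (induction n)
  case (Suc n)
  have "rho (Suc n) (id \<circ> cyc (Suc n) (Suc n)) = rho n id * cprod (Suc n) (Suc n)"
    by (intro rho_Suc permutes_id) auto
  then show ?case using Suc by (simp only: cyc_same cprod_same comp_id mult_1_right)
qed (simp only: rho.simps)

lemma rho_mult_adj:
  "n \<le> k \<Longrightarrow> w permutes {1..n} \<Longrightarrow> 1 \<le> i \<Longrightarrow> i < n \<Longrightarrow> rho n (w \<circ> adj i) = rho n w * \<tau> i"
proof (induction n arbitrary: w i)
  case 0
  then show ?case by simp
next
  case (Suc n)
  obtain u j where u: "u permutes {1..n}" "1 \<le> j" "j \<le> Suc n" "w = u \<circ> cyc (Suc n) j"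
    using permutes_decomp Suc.prems by blast
  have w: "rho (Suc n) w = rho n u * cprod (Suc n) j" using u rho_Suc by simp
  \<comment> \<open>The coset representative ends in \<open>\<tau> j\<close>. A factor of index j-1
    lengthens it and one of index j cancels its last letter. Any other factor passes to the left,
    lowered by one if its index exceeds j, and the induction hypothesis absorbs it into
    \<open>rho n u\<close>.\<close>
  consider "Suc i = j" | "i = j" | "Suc i < j" | "j < i" by linarith
  then show ?case
  proof cases
    case 1
    then have "w \<circ> adj i = u \<circ> cyc (Suc n) i"
      using u cyc_step[of i "Suc n"] by (simp add: comp_assoc)
    moreover have "rho (Suc n) (u \<circ> cyc (Suc n) i) = rho n u * cprod (Suc n) i"
      using u Suc.prems by (intro rho_Suc) auto
    moreover have "cprod (Suc n) i = cprod (Suc n) j * \<tau> i"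
      using 1 Suc.prems cprod_right[of i "Suc n"] by simp
    ultimately show ?thesis using w by (simp only: mult.assoc)
  next
    case 2
    then have "w \<circ> adj i = u \<circ> cyc (Suc n) (Suc i)"
      using u Suc.prems cyc_cancel[of i "Suc n"] by (simp add: comp_assoc)
    moreover have "rho (Suc n) (u \<circ> cyc (Suc n) (Suc i)) = rho n u * cprod (Suc n) (Suc i)"
      using u Suc.prems by (intro rho_Suc) auto
    moreover have "cprod (Suc n) (Suc i) = cprod (Suc n) j * \<tau> i"
      using 2 Suc.prems cprod_right[of i "Suc n"] square[of i] by (simp add: mult.assoc)
    ultimately show ?thesis using w by (simp only: mult.assoc)
  next
    case 3
    have e: "w \<circ> adj i = (u \<circ> adj i) \<circ> cyc (Suc n) j"
      using 3 u cyc_adj_below[of i j "Suc n"] by (simp add: comp_assoc)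
    have "u \<circ> adj i permutes {1..n}"
      using 3 u Suc.prems by (intro permutes_compose[OF adj_permutes]) auto
    then have "rho (Suc n) (w \<circ> adj i) = rho n (u \<circ> adj i) * cprod (Suc n) j"
      unfolding e using u by (intro rho_Suc) auto
    also have "rho n (u \<circ> adj i) = rho n u * \<tau> i"
      using 3 u Suc.prems by (intro Suc.IH) auto
    also have "rho n u * \<tau> i * cprod (Suc n) j = rho n u * (\<tau> i * cprod (Suc n) j)"
      by (simp only: mult.assoc)
    also have "\<tau> i * cprod (Suc n) j = cprod (Suc n) j * \<tau> i"
      using 3 Suc.prems by (intro cprod_far[symmetric] far) auto
    finally show ?thesis using w by (simp only: mult.assoc)
  next
    case 4
    have e: "w \<circ> adj i = (u \<circ> adj (i - 1)) \<circ> cyc (Suc n) j"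
      using 4 u Suc.prems cyc_adj_above[of j i "Suc n"] by (simp add: comp_assoc)
    have "u \<circ> adj (i - 1) permutes {1..n}"
      using 4 u Suc.prems by (intro permutes_compose[OF adj_permutes]) auto
    then have "rho (Suc n) (w \<circ> adj i) = rho n (u \<circ> adj (i - 1)) * cprod (Suc n) j"
      unfolding e using u by (intro rho_Suc) auto
    also have "rho n (u \<circ> adj (i - 1)) = rho n u * \<tau> (i - 1)"
      using 4 u Suc.prems by (intro Suc.IH) auto
    also have "rho n u * \<tau> (i - 1) * cprod (Suc n) j = rho n u * (\<tau> (i - 1) * cprod (Suc n) j)"
      by (simp only: mult.assoc)
    also have "\<tau> (i - 1) * cprod (Suc n) j = cprod (Suc n) j * \<tau> i"
      using 4 u Suc.prems by (intro cprod_above[symmetric]) auto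
    finally show ?thesis using w by (simp only: mult.assoc)
  qed
qed

lemma rho_mult_cyc:
  assumes "n \<le> k" "w permutes {1..n}" "m \<le> n" "1 \<le> j" "j \<le> m"
  shows "rho n (w \<circ> cyc m j) = rho n w * cprod m j"
  using assms(4,5)
proof (induction "m - j" arbitrary: j)
  case 0
  then show ?case by (simp add: cyc_same)
next
  case (Suc d)
  have "cyc m (Suc j) permutes {1..m}" using Suc by (intro cyc_permutes) auto
  then have "cyc m (Suc j) permutes {1..n}" by (rule permutes_subset) (use assms(3) in auto)
  then have p: "w \<circ> cyc m (Suc j) permutes {1..n}" by (rule permutes_compose[OF _ assms(2)])
  have "w \<circ> cyc m j = (w \<circ> cyc m (Suc j)) \<circ> adj j"
    using Suc cyc_step[of j m] by (simp add: comp_assoc)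
  then have "rho n (w \<circ> cyc m j) = rho n (w \<circ> cyc m (Suc j)) * \<tau> j"
    using rho_mult_adj[OF assms(1) p, of j] Suc assms(3) by simp
  also have "\<dots> = rho n w * cprod m j"
    using Suc cprod_right[of j m] by (simp add: mult.assoc)
  finally show ?case .
qed

text \<open>The two ranks are kept apart so that the induction can peel off the top coset
  representative of u while w stays in the larger group.\<close>

lemma rho_mult_le:
  assumes "n \<le> k" "w permutes {1..n}"
  shows "m \<le> n \<Longrightarrow> u permutes {1..m} \<Longrightarrow> rho n (w \<circ> u) = rho n w * rho m u"
proof (induction m arbitrary: u)
  case 0
  then show ?case by (simp add: id_def)
next
  case (Suc m)
  obtain v j where v: "v permutes {1..m}" "1 \<le> j" "j \<le> Suc m" "u = v \<circ> cyc (Suc m) j"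
    using permutes_decomp Suc.prems by blast
  have "v permutes {1..n}" using v(1) Suc.prems by (auto intro: permutes_subset)
  then have p: "w \<circ> v permutes {1..n}" by (rule permutes_compose[OF _ assms(2)])
  have "rho n (w \<circ> u) = rho n (w \<circ> v) * cprod (Suc m) j"
    using rho_mult_cyc[OF assms(1) p] Suc.prems v by (simp add: comp_assoc)
  also have "rho n (w \<circ> v) = rho n w * rho m v"
    using Suc.prems v by (intro Suc.IH) auto
  also have "rho n w * rho m v * cprod (Suc m) j = rho n w * rho (Suc m) u"
    unfolding v(4) by (subst rho_Suc[OF v(1-3)]) (simp only: mult.assoc)
  finally show ?case .
qed

abbreviation t :: "(nat \<Rightarrow> nat) \<Rightarrow> 'r" where "t \<equiv> rho k"

lemma t_compose:
  "w permutes {1..k} \<Longrightarrow> u permutes {1..k} \<Longrightarrow> t (w \<circ> u) = t w * t u"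
  by (rule rho_mult_le) auto

lemma t_adj: "1 \<le> i \<Longrightarrow> i < k \<Longrightarrow> t (adj i) = \<tau> i"
  using rho_mult_adj[of k id i] by (simp add: permutes_id)

text \<open>With the operators that preserve a given subspace as \<open>S\<close>, this carries
  invariance from the generators over to every t_w.\<close>

lemma rho_closed:
  assumes "1 \<in> S" and "\<And>u v. u \<in> S \<Longrightarrow> v \<in> S \<Longrightarrow> u * v \<in> S" and "\<And>i. 1 \<le> i \<Longrightarrow> i < k \<Longrightarrow> \<tau> i \<in> S"
  shows "n \<le> k \<Longrightarrow> w permutes {1..n} \<Longrightarrow> rho n w \<in> S"
proof (induction n arbitrary: w)
  case 0
  then show ?case by (simp add: assms(1))
next
  case (Suc n)
  obtain u j where u: "u permutes {1..n}" "1 \<le> j" "j \<le> Suc n" "w = u \<circ> cyc (Suc n) j"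
    using permutes_decomp Suc.prems by blast
  have prods: "prod_list (map \<tau> is) \<in> S" if "set is \<subseteq> {1..<k}" for "is"
    using that by (induction "is") (auto simp: assms)
  have "cprod (Suc n) j \<in> S"
  proof -
    have "set (rev [j..<Suc n]) \<subseteq> {1..<k}" using u Suc.prems by auto
    then show ?thesis unfolding cprod_def by (rule prods)
  qed
  moreover have "rho n u \<in> S" using Suc u by simp
  ultimately show ?case unfolding u(4) using u rho_Suc[of u n j] assms(2) by metis
qed

end

section \<open>Degenerate affine relations\<close>

definition comm :: "'r::ring_1 \<Rightarrow> 'r \<Rightarrow> bool" where
  "comm u v \<longleftrightarrow> u * v = v * u"

lemma comm_sym: "comm u v \<Longrightarrow> comm v u"
  by (simp add: comm_def)

lemma comm_add: "comm u v \<Longrightarrow> comm u w \<Longrightarrow> comm u (v + w)"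
  by (simp add: comm_def distrib_left distrib_right)

lemma comm_diff: "comm u v \<Longrightarrow> comm u w \<Longrightarrow> comm u (v - w)"
  by (simp add: comm_def left_diff_distrib right_diff_distrib)

lemma comm_mult: "comm u v \<Longrightarrow> comm u w \<Longrightarrow> comm u (v * w)"
  by (simp add: comm_def) (metis mult.assoc)

lemma comm_sum: "(\<And>i. i \<in> A \<Longrightarrow> comm u (f i)) \<Longrightarrow> comm u (sum f A)"
  by (simp add: comm_def sum_distrib_left sum_distrib_right)

lemma comm_refl: "comm u u"
  by (simp add: comm_def)

lemma comm_conj: "comm u v \<Longrightarrow> comm u w \<Longrightarrow> comm u (v * w * v + v)"
  by (simp add: comm_add comm_mult)

locale coxeter_ring = coxeter_generators k \<tau> for k and \<tau> :: "nat \<Rightarrow> 'r::ring_1"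
begin

text \<open>The relation \<open>t_i x_i = x_{i+1} t_i - 1\<close> solved for \<open>x_{i+1}\<close>;
  started at x_1 or y_1 it produces all x_i or y_i. The indices begin at 1, and the value at 0 is a
  filler.\<close>

fun aff :: "'r \<Rightarrow> nat \<Rightarrow> 'r" where
  "aff u 0 = 0"
| "aff u (Suc 0) = u"
| "aff u (Suc (Suc i)) = \<tau> (Suc i) * aff u (Suc i) * \<tau> (Suc i) + \<tau> (Suc i)"

lemma aff_step: "1 \<le> i \<Longrightarrow> aff u (Suc i) = \<tau> i * aff u i * \<tau> i + \<tau> i"
  by (cases i) auto

lemma sq_left: "1 \<le> i \<Longrightarrow> i < k \<Longrightarrow> \<tau> i * (\<tau> i * u) = u"
  by (simp add: square flip: mult.assoc)

lemma comm_far: "1 \<le> i \<Longrightarrow> Suc i < j \<Longrightarrow> j < k \<Longrightarrow> comm (\<tau> i) (\<tau> j)"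
  using far[of i j] by (simp add: comm_def)

lemma aff_hecke:
  assumes "1 \<le> i" "i < k"
  shows "\<tau> i * aff u i = aff u (Suc i) * \<tau> i - 1"
  using assms by (simp add: aff_step distrib_right mult.assoc square)

lemma aff_diff:
  "1 \<le> i \<Longrightarrow> aff u (Suc i) - \<tau> i * aff u i * \<tau> i = \<tau> i"
  by (simp add: aff_step)

lemma aff_comm_sum:
  assumes "1 \<le> i" "i < k"
  shows "comm (\<tau> i) (aff u i + aff u (Suc i))"
  using assms
  by (simp add: aff_step comm_def distrib_right distrib_left mult.assoc square sq_left)

lemma aff_comm_below:
  assumes "\<And>i. 2 \<le> i \<Longrightarrow> i < k \<Longrightarrow> comm (\<tau> i) u" "1 \<le> j" "j < i" "i < k"
  shows "comm (\<tau> i) (aff u j)"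
  using assms(2,3)
proof (induction j rule: nat_induct_at_least)
  case base
  then show ?case using assms by simp
next
  case (Suc j)
  then show ?case using assms(4) comm_sym[OF comm_far[of j i]]
    by (simp add: aff_step comm_conj)
qed

text \<open>The braid relation enters at j = i + 2. With s = \<open>\<tau> i\<close> and r =
  \<open>\<tau> (Suc i)\<close>, the element is r s v s r + r s r + r. The first summand commutes
  with s by itself, the other two only together: multiplied by s on either side they give r s + s
  r.\<close>

lemma aff_comm_above:
  assumes "\<And>i. 2 \<le> i \<Longrightarrow> i < k \<Longrightarrow> comm (\<tau> i) u" "1 \<le> i" "Suc (Suc i) \<le> j" "j \<le> k"
  shows "comm (\<tau> i) (aff u j)"
  using assms(3,4)
proof (induction j rule: dec_induct)
  case base
  let ?s = "\<tau> i" and ?r = "\<tau> (Suc i)" and ?v = "aff u i"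
  have b: "?s * ?r * ?s = ?r * ?s * ?r" using base assms by (intro braid) auto
  have c: "?r * ?v = ?v * ?r"
    using aff_comm_below[of u i "Suc i"] base assms by (simp add: comm_def)
  have sq: "?s * ?s = 1" "?r * ?r = 1" using base assms by (auto intro!: square)
  have e: "aff u (Suc (Suc i)) = ?r * ?s * ?v * ?s * ?r + ?r * ?s * ?r + ?r"
    using assms(2) by (simp add: aff_step distrib_left distrib_right mult.assoc)
  have "?s * (?r * ?s * ?v * ?s * ?r) = ?s * ?r * ?s * ?v * ?s * ?r"
    by (simp add: mult.assoc)
  also have "\<dots> = ?r * ?s * (?r * ?v) * ?s * ?r" by (simp only: b mult.assoc[symmetric])
  also have "\<dots> = ?r * ?s * ?v * (?r * ?s * ?r)" by (simp only: c mult.assoc)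
  also have "\<dots> = (?r * ?s * ?v * ?s * ?r) * ?s" unfolding b[symmetric] by (simp only: mult.assoc)
  finally have 1: "?s * (?r * ?s * ?v * ?s * ?r) = (?r * ?s * ?v * ?s * ?r) * ?s" .
  have "?s * (?r * ?s * ?r) = ?s * (?s * ?r * ?s)" by (simp only: b)
  also have "\<dots> = ?r * ?s" using sq(1) by (simp flip: mult.assoc)
  finally have 2: "?s * (?r * ?s * ?r) = ?r * ?s" .
  have "(?r * ?s * ?r) * ?s = (?s * ?r * ?s) * ?s" by (simp only: b)
  also have "\<dots> = ?s * ?r" using sq(1) by (simp add: mult.assoc)
  finally have 3: "(?r * ?s * ?r) * ?s = ?s * ?r" .
  show ?case unfolding e comm_def distrib_left distrib_right 1 2 3 by simp
next
  case (step j)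
  then show ?case using assms(2) comm_far[of i j] by (simp add: aff_step comm_conj)
qed

lemma aff_comm_other:
  assumes "\<And>i. 2 \<le> i \<Longrightarrow> i < k \<Longrightarrow> comm (\<tau> i) u"
    and "1 \<le> i" "i < k" "1 \<le> j" "j \<le> k" "j \<noteq> i" "j \<noteq> Suc i"
  shows "comm (\<tau> i) (aff u j)"
  using aff_comm_below[of u j i] aff_comm_above[of u i j] assms by (cases "j < i") auto

text \<open>One commutation relation generates all others. Neighbours commute by induction:
  \<open>aff u (i+2)\<close> commutes with \<open>aff u i\<close> and with \<open>\<tau> i\<close>,
  and \<open>aff u (i+1)\<close> is built from these two. Larger distances follow since
  \<open>\<tau> j\<close> commutes with \<open>aff u i\<close> for j > i.\<close>

lemma aff_comm:
  assumes u: "\<And>i. 2 \<le> i \<Longrightarrow> i < k \<Longrightarrow> comm (\<tau> i) u"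
    and 2: "2 \<le> k \<Longrightarrow> comm u (aff u 2)"
    and ij: "1 \<le> i" "i \<le> k" "1 \<le> j" "j \<le> k"
  shows "comm (aff u i) (aff u j)"
proof -
  have next_comm: "comm (aff u i) (aff u (Suc i))" if "1 \<le> i" "Suc i \<le> k" for i
    using that
  proof (induction i rule: nat_induct_at_least)
    case base
    then show ?case using 2 by (simp add: numeral_2_eq_2)
  next
    case (Suc i)
    have a: "comm (aff u (Suc (Suc i))) (\<tau> i)"
      using Suc by (intro comm_sym[OF aff_comm_above[OF u]]) auto
    have "comm (aff u i) (\<tau> (Suc i))"
      using Suc by (intro comm_sym[OF aff_comm_below[OF u]]) auto
    then have "comm (aff u i) (aff u (Suc (Suc i)))"
      using Suc aff_step[of "Suc i" u] by (simp del: aff.simps add: comm_conj)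
    then have "comm (aff u (Suc (Suc i))) (aff u (Suc i))"
      using Suc a aff_step[of i u] by (simp del: aff.simps add: comm_conj comm_sym)
    then show ?case by (rule comm_sym)
  qed
  have *: "comm (aff u i) (aff u j)" if "1 \<le> i" "Suc i \<le> j" "j \<le> k" for i j
    using that(2,3)
  proof (induction j rule: dec_induct)
    case base
    then show ?case using that next_comm by simp
  next
    case (step j)
    have "comm (aff u i) (\<tau> j)"
      using step that by (intro comm_sym[OF aff_comm_below[OF u]]) auto
    then show ?case using step that by (simp add: aff_step comm_conj)
  qed
  show ?thesis
    using *[of i j] *[of j i] ij comm_refl comm_sym by (metis Suc_leI nat_neq_iff)
qed

lemma t_id: "t id = 1"
  by (rule rho_id)

text \<open>The Jucys-Murphy element of index i, into which m_i collapses once the Hecke relations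
  make each m_{l,i} a transposition.\<close>

definition msum :: "nat \<Rightarrow> 'r" where
  "msum i = (\<Sum>l = 1..<i. t (transpose l i))"

lemma t_conj:
  assumes "1 \<le> l" "l < i" "i < k"
  shows "t (transpose l (Suc i)) = \<tau> i * t (transpose l i) * \<tau> i"
proof -
  have e: "transpose l (Suc i) = adj i \<circ> transpose l i \<circ> adj i"
    using assms by (auto simp: fun_eq_iff transpose_def)
  have p: "adj i permutes {1..k}" "transpose l i permutes {1..k}"
    using assms by (auto intro!: permutes_swap_id)
  show ?thesis
    unfolding e using p assms by (simp only: t_compose permutes_compose t_adj)
qed

lemma msum_step:
  assumes "1 \<le> i" "i < k"
  shows "msum (Suc i) = \<tau> i * msum i * \<tau> i + \<tau> i"
proof -
  have "(\<Sum>l = 1..<i. t (transpose l (Suc i))) = (\<Sum>l = 1..<i. \<tau> i * t (transpose l i) * \<tau> i)"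
    using assms t_conj by (intro sum.cong) auto
  moreover have "t (transpose i (Suc i)) = \<tau> i" using t_adj[of i] assms by simp
  ultimately show ?thesis
    using assms by (simp add: msum_def sum_distrib_left sum_distrib_right)
qed

end

section \<open>The reduced presentation and its consequences\<close>

locale boundary_generators = coxeter_ring k \<tau> for k and \<tau> :: "nat \<Rightarrow> 'r::ring_1" +
  fixes x :: 'r and z :: "nat \<Rightarrow> 'r"
  assumes x_comm: "2 \<le> i \<Longrightarrow> i < k \<Longrightarrow> comm (\<tau> i) x"
    and x_comm2: "2 \<le> k \<Longrightarrow> comm x (\<tau> 1 * x * \<tau> 1 + \<tau> 1)"
    and z_comm: "i \<le> k \<Longrightarrow> j \<le> k \<Longrightarrow> comm (z i) (z j)"
    and z_other: "1 \<le> i \<Longrightarrow> i < k \<Longrightarrow> j \<le> k \<Longrightarrow> j \<noteq> i \<Longrightarrow> j \<noteq> Suc i \<Longrightarrow> comm (\<tau> i) (z j)"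
    and z_hecke: "1 \<le> i \<Longrightarrow> i < k \<Longrightarrow> \<tau> i * z i = z (Suc i) * \<tau> i - 1"
    and zx_sum: "1 \<le> k \<Longrightarrow> comm (z 0 + z 1) x"
    and zx_comm: "2 \<le> j \<Longrightarrow> j \<le> k \<Longrightarrow> comm (z j) x"
begin

abbreviation y :: 'r where "y \<equiv> z 1 - x"

lemma z_step: "1 \<le> i \<Longrightarrow> i < k \<Longrightarrow> z (Suc i) = \<tau> i * z i * \<tau> i + \<tau> i"
  using z_hecke[of i] by (simp add: left_diff_distrib mult.assoc square)

lemma y_comm: "2 \<le> i \<Longrightarrow> i < k \<Longrightarrow> comm (\<tau> i) y"
  by (intro comm_diff x_comm z_other) auto

text \<open>The sequences z_i, x_i, y_i and m_i all obey the recursion that conjugates by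
  \<open>\<tau> i\<close> and adds \<open>\<tau> i\<close>; in x + y - m the increments combine to a
  single \<open>\<tau> i\<close>.\<close>

lemma z_decomp: "1 \<le> i \<Longrightarrow> i \<le> k \<Longrightarrow> z i = aff x i + aff y i - msum i"
proof (induction i rule: nat_induct_at_least)
  case base
  then show ?case by (simp add: msum_def)
next
  case (Suc i)
  then have "z (Suc i) = \<tau> i * (aff x i + aff y i - msum i) * \<tau> i + \<tau> i"
    using z_step[of i] by simp
  then show ?case using Suc
    by (simp add: aff_step msum_step algebra_simps)
qed

text \<open>In terms of the reduced generators, y_2 is z_2 - x_2 + s with s =
  \<open>\<tau> 1\<close>. Its commutation with y_1 = z_1 - x_1 then follows from the commutations
  of z_1 with z_2, of x_1 with x_2 and of z_2 with x_1.\<close>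

lemma y_comm2:
  assumes "2 \<le> k"
  shows "comm y (\<tau> 1 * y * \<tau> 1 + \<tau> 1)"
proof -
  let ?s = "\<tau> 1" let ?x2 = "?s * x * ?s + ?s"
  have sq: "?s * ?s = 1" using assms by (intro square) auto
  have h: "?s * z 1 = z 2 * ?s - 1"
    using z_hecke[of 1] assms by (simp add: numeral_2_eq_2)
  have z2: "z 2 = ?s * z 1 * ?s + ?s"
    using z_step[of 1] assms by (simp add: numeral_2_eq_2)
  have h': "z 1 * ?s = ?s * z 2 - 1"
    using sq by (simp add: z2 distrib_left flip: mult.assoc)
  have zx: "z 2 * x = x * z 2" using zx_comm[of 2] assms by (simp add: comm_def)
  have e: "?s * y * ?s + ?s = z 2 - ?x2 + ?s"
    by (simp add: z2 algebra_simps)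
  \<comment> \<open>The element z_1 does not commute with s x s. It is moved across by becoming z_2
    next to x, and the two Hecke relations used for this leave s x - x s behind.\<close>
  have "z 1 * (?s * x * ?s) = (?s * z 2 - 1) * x * ?s"
    by (simp only: h'[symmetric] mult.assoc)
  also have "\<dots> = ?s * (z 2 * x) * ?s - x * ?s"
    by (simp add: left_diff_distrib mult.assoc)
  also have "\<dots> = ?s * x * (z 2 * ?s) - x * ?s" by (simp add: zx mult.assoc)
  also have "z 2 * ?s = ?s * z 1 + 1" using h by simp
  finally have zxs: "z 1 * (?s * x * ?s) = ?s * x * ?s * z 1 + ?s * x - x * ?s"
    by (simp add: distrib_left mult.assoc)
  have zz: "z 1 * z 2 = z 2 * z 1" using z_comm[of 1 2] assms by (simp add: comm_def)
  have xx: "x * ?x2 = ?x2 * x" using x_comm2 assms by (simp add: comm_def)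
  have "y * (z 2 - ?x2 + ?s) =
      z 1 * z 2 - z 1 * (?s * x * ?s) - x * z 2 + x * ?x2 - x * ?s"
    by (simp add: algebra_simps)
  also have "\<dots> = z 2 * z 1 - (?s * x * ?s * z 1 + ?s * x - x * ?s) - z 2 * x + ?x2 * x - x * ?s"
    unfolding zz zxs zx xx ..
  also have "\<dots> = (z 2 - ?x2 + ?s) * y"
    by (simp add: algebra_simps)
  finally show ?thesis unfolding e comm_def .
qed

text \<open>As l < i, both \<open>z l\<close> and \<open>z (Suc l)\<close> occur in the sum. Neither
  need commute with \<open>\<tau> l\<close>, but their sum does.\<close>

lemma zsum_tau:
  assumes "1 \<le> l" "l < i" "i \<le> k"
  shows "comm (\<tau> l) (\<Sum>j = 0..i. z j)"
proof -
  have "{0..i} = insert l (insert (Suc l) ({0..i} - {l, Suc l}))" using assms by auto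
  then have e: "(\<Sum>j = 0..i. z j) = z l + z (Suc l) + (\<Sum>j \<in> {0..i} - {l, Suc l}. z j)"
    by (metis (no_types, lifting) Diff_iff Suc_n_not_n add.assoc finite_Diff finite_atLeastAtMost
        finite_insert insertCI insertE sum.insert)
  have "comm (\<tau> l) (z l + z (Suc l))"
    using assms
    by (simp add: z_step comm_def distrib_left distrib_right mult.assoc square sq_left)
  moreover have "comm (\<tau> l) (\<Sum>j \<in> {0..i} - {l, Suc l}. z j)"
    using assms by (intro comm_sum z_other) auto
  ultimately show ?thesis unfolding e by (rule comm_add)
qed

lemma comm_zsum_x:
  assumes "1 \<le> i" "i \<le> k"
  shows "comm (\<Sum>j = 0..i. z j) x"
proof -
  have "(\<Sum>j = 0..i. z j) = (z 0 + z 1) + (\<Sum>j = 2..i. z j)"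
    using assms by (simp add: sum.atLeast_Suc_atMost numeral_2_eq_2 add.assoc)
  moreover have "comm x (z 0 + z 1)" using zx_sum assms by (simp add: comm_sym)
  moreover have "comm x (\<Sum>j = 2..i. z j)"
    using assms zx_comm by (intro comm_sum comm_sym[OF zx_comm]) auto
  ultimately show ?thesis by (simp add: comm_add comm_sym)
qed

text \<open>For j \<le> i the element \<open>aff u j\<close> is a word in u and letters
  \<open>\<tau> l\<close> with l < i, exactly the letters that \<open>zsum_tau\<close>
  covers.\<close>

lemma zsum_aff:
  assumes "comm (\<Sum>j = 0..i. z j) u" "1 \<le> j" "j \<le> i" "i \<le> k"
  shows "comm (\<Sum>j = 0..i. z j) (aff u j)"
  using assms(2,3)
proof (induction j rule: nat_induct_at_least)
  case base
  then show ?case using assms(1) by simp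
next
  case (Suc j)
  then show ?case using assms(4) comm_sym[OF zsum_tau[of j i]]
    by (simp add: aff_step comm_conj)
qed

lemma comm_zsum_y:
  assumes "1 \<le> i" "i \<le> k"
  shows "comm (\<Sum>j = 0..i. z j) y"
proof -
  have "comm (z 1) (\<Sum>j = 0..i. z j)"
    using assms by (intro comm_sum z_comm) auto
  then show ?thesis using comm_zsum_x[OF assms] by (simp add: comm_diff comm_sym)
qed

lemma xs_comm: "1 \<le> i \<Longrightarrow> i \<le> k \<Longrightarrow> 1 \<le> j \<Longrightarrow> j \<le> k \<Longrightarrow> comm (aff x i) (aff x j)"
  using x_comm x_comm2 by (intro aff_comm) (auto simp: numeral_2_eq_2)

lemma ys_comm: "1 \<le> i \<Longrightarrow> i \<le> k \<Longrightarrow> 1 \<le> j \<Longrightarrow> j \<le> k \<Longrightarrow> comm (aff y i) (aff y j)"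
  using y_comm y_comm2 by (intro aff_comm) (auto simp: numeral_2_eq_2)

end

section \<open>The free algebra and its quotients\<close>

lemma update_eq_add_single:
  "u \<notin> Poly_Mapping.keys f \<Longrightarrow> Poly_Mapping.update u c f = f + Poly_Mapping.single u c"
  by (rule poly_mapping_eqI)
    (auto simp: lookup_update lookup_add lookup_single when_def in_keys_iff)

lemma poly_mapping_add_induct [case_names zero add]:
  assumes "P 0" and "\<And>f u c. P f \<Longrightarrow> P (f + Poly_Mapping.single u c)"
  shows "P f"
  by (induction f rule: update_induct) (auto simp: assms update_eq_add_single)

lemma letters_zero: "letters 0 = []"
  by (simp add: zero_fword_def)

locale scalar_map =
  fixes \<iota> :: "complex \<Rightarrow> 'r::ring_1"
  assumes scalar_add: "\<iota> (c + d) = \<iota> c + \<iota> d"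
    and scalar_mult: "\<iota> (c * d) = \<iota> c * \<iota> d"
    and scalar_one: "\<iota> 1 = 1"
    and scalar_central: "\<iota> c * r = r * \<iota> c"
begin

lemma scalar_zero: "\<iota> 0 = 0"
  using scalar_add[of 0 0] by simp

text \<open>The homomorphism out of the free algebra that sends each generator to its image under
  \<open>g\<close>. The target is a mere ring, so scalars enter through the central map
  \<open>\<iota>\<close>.\<close>

definition eval :: "('g \<Rightarrow> 'r) \<Rightarrow> ('g fword \<Rightarrow>\<^sub>0 complex) \<Rightarrow> 'r" where
  "eval g f = (\<Sum>u\<in>Poly_Mapping.keys f.
     \<iota> (Poly_Mapping.lookup f u) * prod_list (map g (letters u)))"

lemma eval_superset:
  assumes "finite S" "Poly_Mapping.keys f \<subseteq> S"
  shows "eval g f = (\<Sum>u\<in>S. \<iota> (Poly_Mapping.lookup f u) * prod_list (map g (letters u)))"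
  unfolding eval_def using assms
  by (intro sum.mono_neutral_left) (auto simp: in_keys_iff scalar_zero)

lemma eval_add: "eval g (f + h) = eval g f + eval g h"
proof -
  let ?S = "Poly_Mapping.keys f \<union> Poly_Mapping.keys h"
  have "eval g (f + h) = (\<Sum>u\<in>?S. \<iota> (Poly_Mapping.lookup (f + h) u) * prod_list (map g (letters u)))"
    using Poly_Mapping.keys_add[of f h] by (intro eval_superset) auto
  also have "\<dots> = eval g f + eval g h"
    by (simp add: eval_superset[of ?S] lookup_add scalar_add distrib_right sum.distrib)
  finally show ?thesis .
qed

lemma eval_zero: "eval g 0 = 0"
  by (simp add: eval_def)

lemma eval_uminus: "eval g (- f) = - eval g f"
  using eval_add[of g f "- f"] by (simp add: eval_zero eq_neg_iff_add_eq_0 add.commute)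

lemma eval_diff: "eval g (f - h) = eval g f - eval g h"
  using eval_add[of g f "- h"] by (simp add: eval_uminus)

lemma eval_single:
  "eval g (Poly_Mapping.single u c) = \<iota> c * prod_list (map g (letters u))"
  by (cases "c = 0") (simp_all add: eval_def scalar_zero)

lemma eval_single_mult:
  "eval g (Poly_Mapping.single u c * Poly_Mapping.single v d)
   = eval g (Poly_Mapping.single u c) * eval g (Poly_Mapping.single v d)"
  by (simp add: mult_single eval_single plus_fword_def scalar_mult)
    (metis (no_types) mult.assoc scalar_central)

lemma eval_mult: "eval g (f * h) = eval g f * eval g h"
proof (induction f rule: poly_mapping_add_induct)
  case (add f u c)
  have "eval g (Poly_Mapping.single u c * h) = eval g (Poly_Mapping.single u c) * eval g h"
    by (induction h rule: poly_mapping_add_induct)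
      (simp_all add: eval_zero eval_add eval_single_mult distrib_left)
  then show ?case using add by (simp add: distrib_right eval_add)
qed (simp add: eval_zero)

lemma eval_one: "eval g 1 = 1"
  using eval_single[of g 0 1] by (simp add: letters_zero scalar_one)

lemma eval_of_nat: "eval g (of_nat n) = of_nat n"
  by (induction n) (simp_all add: eval_zero eval_add eval_one)

lemma eval_sum: "eval g (sum f A) = (\<Sum>i\<in>A. eval g (f i))"
  by (induction A rule: infinite_finite_induct) (simp_all add: eval_zero eval_add)

lemma eval_gen: "eval g (Poly_Mapping.single (Word [x]) 1) = g x"
  by (simp add: eval_single scalar_one)

lemma eval_const: "eval g (Poly_Mapping.single 0 c) = \<iota> c"
  by (simp add: eval_single letters_zero)

end

definition fcarrier :: "nat \<Rightarrow> falg set" where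
  "fcarrier k = {f. \<forall>u \<in> Poly_Mapping.keys f. set (letters u) \<subseteq> gens k}"

lemma carrier_free [simp]: "carrier (free_algebra k) = fcarrier k"
  by (simp add: free_algebra_def fcarrier_def)

lemma free_ops [simp]:
  "x \<otimes>\<^bsub>free_algebra k\<^esub> y = x * y" "x \<oplus>\<^bsub>free_algebra k\<^esub> y = x + y"
  "\<one>\<^bsub>free_algebra k\<^esub> = 1" "\<zero>\<^bsub>free_algebra k\<^esub> = 0"
  by (simp_all add: free_algebra_def)

lemma fcarrier_zero: "0 \<in> fcarrier k"
  by (simp add: fcarrier_def)

lemma fcarrier_const: "fconst c \<in> fcarrier k"
  by (auto simp: fcarrier_def fconst_def zero_fword_def split: if_splits)

lemma fcarrier_one: "1 \<in> fcarrier k"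
  using fcarrier_const[of 1] by (simp add: fconst_def)

lemma fcarrier_add: "f \<in> fcarrier k \<Longrightarrow> h \<in> fcarrier k \<Longrightarrow> f + h \<in> fcarrier k"
  using Poly_Mapping.keys_add[of f h] by (auto simp: fcarrier_def)

lemma fcarrier_uminus: "f \<in> fcarrier k \<Longrightarrow> - f \<in> fcarrier k"
  by (simp add: fcarrier_def)

lemma fcarrier_diff: "f \<in> fcarrier k \<Longrightarrow> h \<in> fcarrier k \<Longrightarrow> f - h \<in> fcarrier k"
  using fcarrier_add[of f k "- h"] by (simp add: fcarrier_uminus)

lemma fcarrier_mult: "f \<in> fcarrier k \<Longrightarrow> h \<in> fcarrier k \<Longrightarrow> f * h \<in> fcarrier k"
  using Poly_Mapping.keys_mult[of f h]
  by (force simp: fcarrier_def plus_fword_def)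

lemma fcarrier_sum: "(\<And>i. i \<in> A \<Longrightarrow> f i \<in> fcarrier k) \<Longrightarrow> sum f A \<in> fcarrier k"
  by (induction A rule: infinite_finite_induct) (auto simp: fcarrier_zero fcarrier_add)

lemma fcarrier_of_nat: "of_nat n \<in> fcarrier k"
  by (induction n) (auto simp: fcarrier_zero fcarrier_add fcarrier_one)

lemma fcarrier_gen: "g \<in> gens k \<Longrightarrow> gen_elem g \<in> fcarrier k"
  by (auto simp: fcarrier_def gen_elem_def)

lemma fcarrier_t: "w permutes {1..k} \<Longrightarrow> tg w \<in> fcarrier k"
  by (intro fcarrier_gen) (auto simp: gens_def)

lemma fcarrier_x: "1 \<le> i \<Longrightarrow> i \<le> k \<Longrightarrow> xg i \<in> fcarrier k"
  by (intro fcarrier_gen) (auto simp: gens_def)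

lemma fcarrier_y: "1 \<le> i \<Longrightarrow> i \<le> k \<Longrightarrow> yg i \<in> fcarrier k"
  by (intro fcarrier_gen) (auto simp: gens_def)

lemma fcarrier_z: "i \<le> k \<Longrightarrow> zg i \<in> fcarrier k"
  by (intro fcarrier_gen) (auto simp: gens_def)

lemma fcarrier_adj: "1 \<le> i \<Longrightarrow> i < k \<Longrightarrow> tg (adj i) \<in> fcarrier k"
  by (intro fcarrier_t adj_permutes)

lemma fcarrier_transpose:
  "1 \<le> i \<Longrightarrow> i \<le> k \<Longrightarrow> 1 \<le> j \<Longrightarrow> j \<le> k \<Longrightarrow> tg (transpose i j) \<in> fcarrier k"
  by (intro fcarrier_t permutes_swap_id) auto

lemmas fcarrier_intros =
  fcarrier_zero fcarrier_one fcarrier_add fcarrier_uminus fcarrier_diff fcarrier_mult fcarrier_sum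
  fcarrier_of_nat fcarrier_x fcarrier_y fcarrier_z fcarrier_adj fcarrier_transpose fcarrier_const

lemma free_ring: "ring (free_algebra k)"
proof (rule ringI)
  show "abelian_group (free_algebra k)"
  proof (rule abelian_groupI)
    fix f assume "f \<in> carrier (free_algebra k)"
    then show "\<exists>h\<in>carrier (free_algebra k). h \<oplus>\<^bsub>free_algebra k\<^esub> f = \<zero>\<^bsub>free_algebra k\<^esub>"
      by (intro bexI[of _ "- f"]) (auto simp: fcarrier_uminus)
  qed (auto intro: fcarrier_intros)
  show "Group.monoid (free_algebra k)"
    by (rule monoidI) (auto intro: fcarrier_intros simp: mult.assoc)
qed (auto simp: distrib_left distrib_right)

lemma free_minus:
  assumes "g \<in> fcarrier k"
  shows "f \<ominus>\<^bsub>free_algebra k\<^esub> g = f - g"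
proof -
  interpret ring "free_algebra k" by (rule free_ring)
  have "\<ominus>\<^bsub>free_algebra k\<^esub> g = - g"
    using assms fcarrier_uminus[OF assms] by (intro minus_equality) auto
  then show ?thesis by (simp add: a_minus_def)
qed

lemma m1_carrier: "1 \<le> i \<Longrightarrow> i \<le> k \<Longrightarrow> m1 i \<in> fcarrier k"
  unfolding m1_def m2_def Let_def
  by (rule fcarrier_sum) (auto intro!: fcarrier_intros)

lemma G_rels_carrier: "(l, r) \<in> G_rels k \<Longrightarrow> l \<in> fcarrier k \<and> r \<in> fcarrier k"
proof (induction l r rule: G_rels.induct)
  case (t_mult w w')
  then show ?case by (auto intro!: fcarrier_mult fcarrier_t permutes_compose)
next
  case t_one
  then show ?case by (auto intro!: fcarrier_one fcarrier_t permutes_id)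
qed (auto intro!: fcarrier_intros m1_carrier)

lemma H_rels_carrier:
  assumes "1 \<le> k" "(l, r) \<in> H_rels a b p q k"
  shows "l \<in> fcarrier k \<and> r \<in> fcarrier k"
  using assms(2,1) by (induction l r rule: H_rels.induct) (auto intro!: fcarrier_intros)

lemma G_ideal_ideal: "ideal (G_ideal k) (free_algebra k)"
  unfolding G_ideal_def
  by (rule ring.genideal_ideal[OF free_ring]) (auto dest: G_rels_carrier intro!: fcarrier_diff)

lemma G_ring: "ring (\<G> k)"
  unfolding \<G>_def by (rule ideal.quotient_is_ring[OF G_ideal_ideal])

lemma to_G_hom: "to_\<G> k \<in> ring_hom (free_algebra k) (\<G> k)"
  using ideal.rcos_ring_hom[OF G_ideal_ideal] by (simp add: to_\<G>_def[abs_def] \<G>_def)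

lemma G_carrier: "carrier (\<G> k) = to_\<G> k ` fcarrier k"
  by (auto simp: \<G>_def FactRing_def A_RCOSETS_def' to_\<G>_def)

lemma to_G_eq_iff:
  "f \<in> fcarrier k \<Longrightarrow> g \<in> fcarrier k \<Longrightarrow> to_\<G> k f = to_\<G> k g \<longleftrightarrow> f - g \<in> G_ideal k"
  using ring.quotient_eq_iff_same_a_r_cos[OF free_ring G_ideal_ideal, of f k g]
  by (simp add: to_\<G>_def free_minus)

lemma H_ideal_ideal:
  assumes "1 \<le> k"
  shows "ideal (H_ideal a b p q k) (\<G> k)"
  unfolding H_ideal_def
  by (rule ring.genideal_ideal[OF G_ring])
    (use assms in \<open>auto simp: G_carrier dest!: H_rels_carrier[OF assms] intro!: imageI fcarrier_diff\<close>)

lemma to_H_hom: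
  assumes "1 \<le> k"
  shows "to_H a b p q k \<in> ring_hom (free_algebra k) (H_ext a b p q k)"
proof -
  have "(+>\<^bsub>\<G> k\<^esub>) (H_ideal a b p q k) \<in> ring_hom (\<G> k) (H_ext a b p q k)"
    using ideal.rcos_ring_hom[OF H_ideal_ideal[OF assms]] by (simp add: H_ext_def)
  then have "(+>\<^bsub>\<G> k\<^esub>) (H_ideal a b p q k) \<circ> to_\<G> k \<in> ring_hom (free_algebra k) (H_ext a b p q k)"
    using to_G_hom by (rule ring_hom_trans[rotated])
  then show ?thesis by (simp add: to_H_def[abs_def] comp_def)
qed

lemma H_carrier: "carrier (H_ext a b p q k) = to_H a b p q k ` fcarrier k"
  by (auto simp: H_ext_def FactRing_def A_RCOSETS_def' to_H_def G_carrier)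

lemma to_H_eq_iff:
  assumes "1 \<le> k" "f \<in> fcarrier k" "g \<in> fcarrier k"
  shows "to_H a b p q k f = to_H a b p q k g \<longleftrightarrow> to_\<G> k (f - g) \<in> H_ideal a b p q k"
proof -
  interpret G: ring "\<G> k" by (rule G_ring)
  have c: "to_\<G> k f \<in> carrier (\<G> k)" "to_\<G> k g \<in> carrier (\<G> k)"
    "to_\<G> k (f - g) \<in> carrier (\<G> k)"
    using assms by (auto simp: G_carrier intro!: imageI fcarrier_diff)
  have "to_\<G> k f = to_\<G> k (f - g) \<oplus>\<^bsub>\<G> k\<^esub> to_\<G> k g"
    using ring_hom_add[OF to_G_hom, of "f - g" k g] assms fcarrier_diff by simp
  then have "to_\<G> k f \<ominus>\<^bsub>\<G> k\<^esub> to_\<G> k g = to_\<G> k (f - g)"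
    using c by (simp add: a_minus_def G.a_assoc G.r_neg)
  then show ?thesis
    using ring.quotient_eq_iff_same_a_r_cos[OF G_ring H_ideal_ideal[OF assms(1)],
        of "to_\<G> k f" "to_\<G> k g" a b p q] assms
    by (simp add: to_H_def free_minus G_carrier)
qed

lemma to_H_G_rel:
  assumes "1 \<le> k" "(l, r) \<in> G_rels k"
  shows "to_H a b p q k l = to_H a b p q k r"
proof -
  have c: "l \<in> fcarrier k" "r \<in> fcarrier k" using assms G_rels_carrier by blast+
  have "l - r \<in> G_ideal k"
  proof -
    have "{l - r | l r. (l, r) \<in> G_rels k} \<subseteq> carrier (free_algebra k)"
      by (auto dest!: G_rels_carrier intro!: fcarrier_diff)
    then show ?thesis
      unfolding G_ideal_def using ring.genideal_self[OF free_ring] assms(2) by blast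
  qed
  then have "to_\<G> k l = to_\<G> k r" using c to_G_eq_iff by blast
  then show ?thesis by (simp add: to_H_def)
qed

lemma to_H_H_rel:
  assumes "1 \<le> k" "(l, r) \<in> H_rels a b p q k"
  shows "to_H a b p q k l = to_H a b p q k r"
proof -
  have c: "l \<in> fcarrier k" "r \<in> fcarrier k" using assms H_rels_carrier by blast+
  have "{to_\<G> k (l - r) | l r. (l, r) \<in> H_rels a b p q k} \<subseteq> carrier (\<G> k)"
    by (auto simp: G_carrier dest!: H_rels_carrier[OF assms(1)] intro!: imageI fcarrier_diff)
  then have "to_\<G> k (l - r) \<in> H_ideal a b p q k"
    unfolding H_ideal_def
    using ring.genideal_self[OF G_ring] assms(2) by blast
  then show ?thesis using to_H_eq_iff assms c by blast
qed

lemma kernel_ideal: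
  fixes \<phi> :: "falg \<Rightarrow> 'r::ring_1"
  assumes "\<And>f g. \<phi> (f + g) = \<phi> f + \<phi> g" "\<And>f g. \<phi> (f * g) = \<phi> f * \<phi> g"
  shows "ideal {f \<in> fcarrier k. \<phi> f = 0} (free_algebra k)"
proof -
  interpret F: ring "free_algebra k" by (rule free_ring)
  have 0: "\<phi> 0 = 0" using assms(1)[of 0 0] by simp
  have neg: "\<phi> (- f) = - \<phi> f" for f
    using assms(1)[of f "- f"] 0 by (simp add: eq_neg_iff_add_eq_0 add.commute)
  have uminus: "\<ominus>\<^bsub>free_algebra k\<^esub> g = - g" if "g \<in> fcarrier k" for g
    using that fcarrier_uminus[OF that] by (intro F.minus_equality) auto
  show ?thesis
    by (rule idealI[OF free_ring F.add.subgroupI])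
      (auto simp: assms 0 neg uminus simp flip: a_inv_def
        intro!: fcarrier_intros exI[of _ 0])
qed

text \<open>The universal property of the two-step quotient. The kernel of \<open>\<phi>\<close>
  contains the first ideal, and its image in \<open>\<G> k\<close> is an ideal that contains the
  second one. So f - g agrees with an element of the kernel up to \<open>G_ideal k\<close>, which
  lies in the kernel too.\<close>

lemma to_H_kernel:
  fixes \<phi> :: "falg \<Rightarrow> 'r::ring_1"
  assumes k: "1 \<le> k"
    and add: "\<And>f g. \<phi> (f + g) = \<phi> f + \<phi> g" and mult: "\<And>f g. \<phi> (f * g) = \<phi> f * \<phi> g"
    and G: "\<And>l r. (l, r) \<in> G_rels k \<Longrightarrow> \<phi> l = \<phi> r"
    and H: "\<And>l r. (l, r) \<in> H_rels a b p q k \<Longrightarrow> \<phi> l = \<phi> r"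
    and fg: "f \<in> fcarrier k" "g \<in> fcarrier k" "to_H a b p q k f = to_H a b p q k g"
  shows "\<phi> f = \<phi> g"
proof -
  let ?K = "{f \<in> fcarrier k. \<phi> f = 0}"
  interpret h: ring_hom_ring "free_algebra k" "\<G> k" "to_\<G> k"
    by (rule ring_hom_ringI2[OF free_ring G_ring to_G_hom])
  have diff: "\<phi> (f - g) = \<phi> f - \<phi> g" for f g
    using add[of "f - g" g] by simp
  have K: "ideal ?K (free_algebra k)" by (rule kernel_ideal[OF add mult])
  have GK: "G_ideal k \<subseteq> ?K"
    unfolding G_ideal_def
    by (rule ring.genideal_minimal[OF free_ring K])
      (auto simp: diff G dest: G_rels_carrier intro!: fcarrier_diff)
  have "ideal (to_\<G> k ` ?K) (\<G> k)"
  proof (rule idealI[OF G_ring])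
    show "subgroup (to_\<G> k ` ?K) (add_monoid (\<G> k))"
      using group_hom.subgroup_img_is_subgroup[OF h.a_group_hom]
        additive_subgroup.a_subgroup[OF ideal.axioms(1)[OF K]] by simp
  next
    fix u v assume "u \<in> to_\<G> k ` ?K" "v \<in> carrier (\<G> k)"
    then obtain f g where f: "f \<in> ?K" "u = to_\<G> k f" and g: "g \<in> fcarrier k" "v = to_\<G> k g"
      by (auto simp: G_carrier)
    have "v \<otimes>\<^bsub>\<G> k\<^esub> u = to_\<G> k (g * f)" "u \<otimes>\<^bsub>\<G> k\<^esub> v = to_\<G> k (f * g)"
      using f g h.hom_mult[of g f] h.hom_mult[of f g] by auto
    moreover have "g * f \<in> ?K" "f * g \<in> ?K"
      using f g by (auto simp: mult intro: fcarrier_mult)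
    ultimately show "v \<otimes>\<^bsub>\<G> k\<^esub> u \<in> to_\<G> k ` ?K" "u \<otimes>\<^bsub>\<G> k\<^esub> v \<in> to_\<G> k ` ?K"
      by auto
  qed
  moreover have "{to_\<G> k (l - r) | l r. (l, r) \<in> H_rels a b p q k} \<subseteq> to_\<G> k ` ?K"
  proof clarify
    fix l r assume lr: "(l, r) \<in> H_rels a b p q k"
    then have "\<phi> (l - r) = 0" by (simp add: diff H)
    then show "to_\<G> k (l - r) \<in> to_\<G> k ` ?K"
      using H_rels_carrier[OF k lr] by (auto intro!: imageI fcarrier_diff)
  qed
  ultimately have "H_ideal a b p q k \<subseteq> to_\<G> k ` ?K"
    unfolding H_ideal_def by (rule ring.genideal_minimal[OF G_ring])
  then have "to_\<G> k (f - g) \<in> to_\<G> k ` ?K"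
    using to_H_eq_iff[OF k fg(1,2)] fg(3) by auto
  then obtain e where e: "e \<in> ?K" "to_\<G> k (f - g) = to_\<G> k e" by blast
  then have "f - g - e \<in> G_ideal k"
    using to_G_eq_iff[of "f - g" k e] fg fcarrier_diff by auto
  then have "\<phi> (f - g - e) = 0" using GK by blast
  then show ?thesis using e by (simp add: diff)
qed

section \<open>Linear operators\<close>

text \<open>A type of its own for the linear operators, so that they form an instance of
  \<open>ring_1\<close> and the abstract ring locales can be interpreted in it.\<close>

typedef 't lop =
  "{f :: ('t \<Rightarrow>\<^sub>0 complex) \<Rightarrow> ('t \<Rightarrow>\<^sub>0 complex).
     (\<forall>u v. f (u + v) = f u + f v) \<and> (\<forall>c v. f (vscale c v) = vscale c (f v))}"
  morphisms app Lop
  by (rule exI[of _ id]) simp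

setup_lifting type_definition_lop

lemma app_add: "app f (u + v) = app f u + app f v"
  by transfer simp

lemma app_vscale: "app f (vscale c v) = vscale c (app f v)"
  by transfer simp

lemma lop_eq_iff: "f = g \<longleftrightarrow> (\<forall>v. app f v = app g v)"
  by (simp add: app_inject[symmetric] fun_eq_iff)

lemma app_0 [simp]: "app f 0 = 0"
  using app_add[of f 0 0] by simp

lemma app_diff: "app f (u - v) = app f u - app f v"
  using app_add[of f "u - v" v] by (simp add: eq_diff_eq)

lemma basis_vec_neq_0: "basis_vec t \<noteq> 0"
  by (metis basis_vec_def lookup_single_eq lookup_zero one_neq_zero)

instantiation lop :: (type) ring_1
begin

lift_definition zero_lop :: "'a lop" is "\<lambda>_. 0" by simp
lift_definition one_lop :: "'a lop" is id by simp
lift_definition plus_lop :: "'a lop \<Rightarrow> 'a lop \<Rightarrow> 'a lop" is "\<lambda>f g v. f v + g v"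
  by (simp add: vec.scale_right_distrib algebra_simps)
lift_definition minus_lop :: "'a lop \<Rightarrow> 'a lop \<Rightarrow> 'a lop" is "\<lambda>f g v. f v - g v"
  by (simp add: vec.scale_right_diff_distrib)
lift_definition uminus_lop :: "'a lop \<Rightarrow> 'a lop" is "\<lambda>f v. - f v"
  by (simp add: vec.scale_minus_right)
lift_definition times_lop :: "'a lop \<Rightarrow> 'a lop \<Rightarrow> 'a lop" is "\<lambda>f g v. f (g v)" by simp

instance
proof
  show "(0::'a lop) \<noteq> 1"
    using basis_vec_neq_0 by (metis id_apply one_lop.rep_eq zero_lop.rep_eq)
qed (simp_all add: lop_eq_iff zero_lop.rep_eq one_lop.rep_eq plus_lop.rep_eq minus_lop.rep_eq
    uminus_lop.rep_eq times_lop.rep_eq app_add algebra_simps)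

end

lemma app_ops [simp]:
  "app 0 v = 0" "app 1 v = v" "app (f + g) v = app f v + app g v"
  "app (f - g) v = app f v - app g v" "app (f * g) v = app f (app g v)"
  by (transfer; simp)+

lemma single_eq_vscale: "Poly_Mapping.single t c = vscale c (basis_vec t)"
  by (rule poly_mapping_eqI) (simp add: lookup_vscale basis_vec_def lookup_single when_def)

lemma lop_eqI:
  assumes "\<And>t. app f (basis_vec t) = app g (basis_vec t)"
  shows "f = g"
proof -
  have "app f v = app g v" for v
    by (induction v rule: poly_mapping_add_induct)
      (simp_all add: app_add single_eq_vscale app_vscale assms)
  then show ?thesis by (simp add: lop_eq_iff)
qed

definition lin_ext :: "('t \<Rightarrow> ('t \<Rightarrow>\<^sub>0 complex)) \<Rightarrow> ('t \<Rightarrow>\<^sub>0 complex) \<Rightarrow> ('t \<Rightarrow>\<^sub>0 complex)" where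
  "lin_ext A v = (\<Sum>t\<in>Poly_Mapping.keys v. vscale (Poly_Mapping.lookup v t) (A t))"

lemma lin_ext_superset:
  assumes "finite S" "Poly_Mapping.keys v \<subseteq> S"
  shows "lin_ext A v = (\<Sum>t\<in>S. vscale (Poly_Mapping.lookup v t) (A t))"
  unfolding lin_ext_def using assms
  by (intro sum.mono_neutral_left) (auto simp: in_keys_iff)

lemma lin_ext_add: "lin_ext A (u + v) = lin_ext A u + lin_ext A v"
proof -
  let ?S = "Poly_Mapping.keys u \<union> Poly_Mapping.keys v"
  have "lin_ext A (u + v) = (\<Sum>t\<in>?S. vscale (Poly_Mapping.lookup (u + v) t) (A t))"
    using Poly_Mapping.keys_add[of u v] by (intro lin_ext_superset) auto
  also have "\<dots> = lin_ext A u + lin_ext A v"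
    by (simp add: lin_ext_superset[of ?S] lookup_add vec.scale_left_distrib sum.distrib)
  finally show ?thesis .
qed

lemma lin_ext_vscale: "lin_ext A (vscale c v) = vscale c (lin_ext A v)"
proof -
  have "Poly_Mapping.keys (vscale c v) \<subseteq> Poly_Mapping.keys v"
    by (auto simp: in_keys_iff lookup_vscale)
  then show ?thesis
    by (simp add: lin_ext_superset[of "Poly_Mapping.keys v"] lookup_vscale vec.scale_sum_right)
qed

lift_definition matrix_op :: "('t \<Rightarrow> ('t \<Rightarrow>\<^sub>0 complex)) \<Rightarrow> 't lop" is lin_ext
  by (simp add: lin_ext_add lin_ext_vscale)

lemma app_matrix_op: "app (matrix_op A) (basis_vec t) = A t"
  by transfer (simp add: lin_ext_def basis_vec_def)

lift_definition scalar_op :: "complex \<Rightarrow> 't lop" is vscale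
  by (simp add: vec.scale_right_distrib mult.commute)

lemma app_scalar_op [simp]: "app (scalar_op c) v = vscale c v"
  by transfer simp

lemma app_of_nat [simp]: "app (of_nat n) v = vscale (of_nat n) v"
  by (induction n) (simp_all add: vec.scale_left_distrib)

interpretation scalar_op: scalar_map scalar_op
  by standard (rule lop_eqI, simp add: vec.scale_left_distrib app_vscale)+

lemma span_basis_vec:
  "v \<in> vec.span (basis_vec ` B) \<longleftrightarrow> Poly_Mapping.keys v \<subseteq> B"
proof
  assume "v \<in> vec.span (basis_vec ` B)"
  then show "Poly_Mapping.keys v \<subseteq> B"
  proof (induction rule: vec.span_induct_alt)
    case (step c x y)
    have "Poly_Mapping.keys (vscale c x) \<subseteq> Poly_Mapping.keys x"
      by (auto simp: in_keys_iff lookup_vscale)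
    then have "Poly_Mapping.keys (vscale c x + y) \<subseteq> Poly_Mapping.keys x \<union> Poly_Mapping.keys y"
      using Poly_Mapping.keys_add[of "vscale c x" y] by blast
    moreover have "Poly_Mapping.keys x \<subseteq> B" using step by (auto simp: basis_vec_def)
    ultimately show ?case using step by blast
  qed simp
next
  assume "Poly_Mapping.keys v \<subseteq> B"
  then have "(\<Sum>t\<in>Poly_Mapping.keys v. vscale (Poly_Mapping.lookup v t) (basis_vec t))
      \<in> vec.span (basis_vec ` B)"
    by (intro vec.span_sum vec.span_scale vec.span_base) auto
  moreover have "(\<Sum>t\<in>Poly_Mapping.keys v. vscale (Poly_Mapping.lookup v t) (basis_vec t)) = v"
    by (rule poly_mapping_eqI)
      (auto simp: lookup_sum lookup_vscale basis_vec_def lookup_single when_def in_keys_iff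
        sum.delta' if_distrib[of "(*) _"] cong: if_cong)
  ultimately show "v \<in> vec.span (basis_vec ` B)" by simp
qed

section \<open>Content systems\<close>

definition near :: "complex \<Rightarrow> complex \<Rightarrow> bool" where
  "near u v \<longleftrightarrow> u = v + 1 \<or> u = v - 1"

lemma near_sym: "near u v \<longleftrightarrow> near v u"
  by (auto simp: near_def)

lemma near_minus: "near (- u) (- v) \<longleftrightarrow> near u v"
  using neg_equal_iff_equal[of u "v - 1"] neg_equal_iff_equal[of u "v + 1"] by (auto simp: near_def)

text \<open>With \<sigma> and \<delta> half the sum and half the difference of a + p and b + q,
  these are the four values of \<open>exceptional\<close>.\<close>

definition exc :: "complex \<Rightarrow> complex \<Rightarrow> complex \<Rightarrow> bool" where
  "exc \<sigma> \<delta> u \<longleftrightarrow> u = \<sigma> \<or> u = - \<sigma> \<or> u = \<delta> \<or> u = - \<delta>"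

lemma exc_minus [simp]: "exc \<sigma> \<delta> (- u) \<longleftrightarrow> exc \<sigma> \<delta> u"
  by (auto simp: exc_def minus_equation_iff)

text \<open>
  \<open>content_opposite\<close> and \<open>content_zero\<close> cover the degenerate contents at which the diagonal entries
  \<open>1 / (c\<^sub>1 + c\<^sub>2)\<close> and \<open>\<sigma> \<delta> / c\<^sub>2\<close> occurring in the four-term braid relation would be divisions by \<open>0\<close>.
\<close>

locale content_system =
  fixes \<Lambda> :: "tableau set" and k :: nat and c :: "tableau \<Rightarrow> nat \<Rightarrow> complex"
    and s :: "nat \<Rightarrow> tableau option \<Rightarrow> tableau option" and \<sigma> \<delta> :: complex
  assumes s_None [simp]: "s i None = None"
    and s_near: "T \<in> \<Lambda> \<Longrightarrow> 1 \<le> i \<Longrightarrow> i < k \<Longrightarrow> near (c T i) (c T (Suc i)) \<Longrightarrow> s i (Some T) = None"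
    and s_adj: "T \<in> \<Lambda> \<Longrightarrow> 1 \<le> i \<Longrightarrow> i < k \<Longrightarrow> \<not> near (c T i) (c T (Suc i)) \<Longrightarrow>
      \<exists>U\<in>\<Lambda>. s i (Some T) = Some U \<and> (\<forall>j\<le>k. c U j = c T (transpose i (Suc i) j))"
    and s_exc: "T \<in> \<Lambda> \<Longrightarrow> exc \<sigma> \<delta> (c T 1) \<Longrightarrow> s 0 (Some T) = None"
    and s_zero: "T \<in> \<Lambda> \<Longrightarrow> \<not> exc \<sigma> \<delta> (c T 1) \<Longrightarrow>
      \<exists>U\<in>\<Lambda>. s 0 (Some T) = Some U \<and> c U 0 = c T 0 + 2 * c T 1 \<and> c U 1 = - c T 1 \<and>
        (\<forall>j. 2 \<le> j \<longrightarrow> j \<le> k \<longrightarrow> c U j = c T j)"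
    and content_inj: "T \<in> \<Lambda> \<Longrightarrow> U \<in> \<Lambda> \<Longrightarrow> (\<And>j. 1 \<le> j \<Longrightarrow> j \<le> k \<Longrightarrow> c T j = c U j) \<Longrightarrow> T = U"
    and content_neq: "T \<in> \<Lambda> \<Longrightarrow> 1 \<le> i \<Longrightarrow> i < k \<Longrightarrow> c T (Suc i) \<noteq> c T i"
    and content_neq2: "T \<in> \<Lambda> \<Longrightarrow> 1 \<le> i \<Longrightarrow> Suc i < k \<Longrightarrow> c T (Suc (Suc i)) \<noteq> c T i"
    and content_nonzero: "T \<in> \<Lambda> \<Longrightarrow> c T 1 \<noteq> 0"
    and content_opposite: "T \<in> \<Lambda> \<Longrightarrow> 2 \<le> k \<Longrightarrow> c T 1 + c T 2 = 0 \<Longrightarrow> near (c T 1) (c T 2)"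
    and content_zero: "T \<in> \<Lambda> \<Longrightarrow> 2 \<le> k \<Longrightarrow> c T 2 = 0 \<Longrightarrow> s 0 (Some T) \<noteq> None \<Longrightarrow> \<sigma> * \<delta> = 0"
    and k_pos: "1 \<le> k"
begin

text \<open>With \<open>None\<close> included the moves are total, and words in them need no
  conditions of definedness.\<close>

definition states :: "tableau option set" where
  "states = insert None (Some ` \<Lambda>)"

lemma None_state [simp]: "None \<in> states"
  by (simp add: states_def)

lemma Some_state [simp]: "Some T \<in> states \<longleftrightarrow> T \<in> \<Lambda>"
  by (auto simp: states_def)

lemma s_state: "S \<in> states \<Longrightarrow> i < k \<Longrightarrow> s i S \<in> states"
proof (cases S)
  case (Some T)
  assume a: "S \<in> states" "i < k"
  show ?thesis
  proof (cases "i = 0")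
    case True
    then show ?thesis using a Some s_exc[of T] s_zero[of T] by (cases "exc \<sigma> \<delta> (c T 1)") auto
  next
    case False
    then show ?thesis using a Some s_near[of T i] s_adj[of T i]
      by (cases "near (c T i) (c T (Suc i))") auto
  qed
qed simp

text \<open>Content 0 is left out: s_0 does not act on it by a sign or a permutation, and the
  contents 1 to k already determine the tableau.\<close>

definition code :: "tableau \<Rightarrow> nat \<Rightarrow> complex" where
  "code T j = (if 1 \<le> j \<and> j \<le> k then c T j else 0)"

text \<open>The partially defined action of the simple reflections of the Weyl group of type B_k on
  content vectors. Identities between words are checked here by computation and pulled back along
  \<open>code_inj\<close>.\<close>

definition move :: "nat \<Rightarrow> (nat \<Rightarrow> complex) \<Rightarrow> (nat \<Rightarrow> complex) option" where
  "move i f =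
     (if i = 0 then (if exc \<sigma> \<delta> (f 1) then None else Some (f(1 := - f 1)))
      else if near (f i) (f (Suc i)) then None else Some (f \<circ> transpose i (Suc i)))"

lemma code_s:
  assumes "S \<in> states" "i < k"
  shows "map_option code (s i S) = Option.bind (map_option code S) (move i)"
proof (cases S)
  case (Some T)
  then have T: "T \<in> \<Lambda>" using assms by simp
  show ?thesis
  proof (cases "i = 0")
    case True
    have c1: "code T 1 = c T 1" using k_pos by (simp add: code_def)
    show ?thesis
    proof (cases "exc \<sigma> \<delta> (c T 1)")
      case False
      then obtain U where U: "U \<in> \<Lambda>" "s 0 (Some T) = Some U" "c U 1 = - c T 1"
        "\<And>j. 2 \<le> j \<Longrightarrow> j \<le> k \<Longrightarrow> c U j = c T j" using s_zero[OF T] by blast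
      have "code U = (code T)(1 := - code T 1)"
        using U k_pos by (auto simp: code_def fun_eq_iff Suc_le_eq)
      then show ?thesis using True False Some U c1 by (simp add: move_def)
    qed (use True Some c1 s_exc[OF T] in \<open>simp add: move_def\<close>)
  next
    case False
    have c: "code T i = c T i" "code T (Suc i) = c T (Suc i)" using False assms by (auto simp: code_def)
    show ?thesis
    proof (cases "near (c T i) (c T (Suc i))")
      case nf: False
      then obtain U where U: "U \<in> \<Lambda>" "s i (Some T) = Some U"
        "\<And>j. j \<le> k \<Longrightarrow> c U j = c T (transpose i (Suc i) j)"
        using s_adj[OF T _ assms(2) nf] False by fastforce
      have "code U = code T \<circ> transpose i (Suc i)"
        using U False assms by (auto simp: code_def fun_eq_iff transpose_def)
      then show ?thesis using False nf Some U c by (simp add: move_def)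
    qed (use False Some c assms s_near[OF T, of i] in \<open>simp add: move_def\<close>)
  qed
qed simp

lemma code_inj:
  assumes "S \<in> states" "S' \<in> states" "map_option code S = map_option code S'"
  shows "S = S'"
proof (cases S)
  case None
  then show ?thesis using assms by simp
next
  case (Some T)
  then obtain U where U: "S' = Some U" "code T = code U" using assms by (cases S') auto
  have "c T j = c U j" if "1 \<le> j" "j \<le> k" for j
    using fun_cong[OF U(2), of j] that by (simp add: code_def)
  then show ?thesis using content_inj[of T U] Some U assms by auto
qed

lemma s_invol:
  assumes "S \<in> states" "i < k" "s i S \<noteq> None"
  shows "s i (s i S) = S"
proof (rule code_inj)
  obtain T where S: "S = Some T" using assms by (cases S) auto
  have n: "move i (code T) \<noteq> None" using code_s[OF assms(1,2)] assms(3) S by (cases "move i (code T)") auto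
  have e: "map_option code (s i (s i S)) = Option.bind (move i (code T)) (move i)"
    using assms S by (simp add: code_s s_state)
  show "map_option code (s i (s i S)) = map_option code S"
    unfolding e using n S
    by (cases "i = 0") (auto simp: move_def near_sym fun_eq_iff split: if_splits)
qed (use assms s_state in auto)

lemma s_far:
  assumes "S \<in> states" "1 \<le> i" "Suc i < j" "j < k"
  shows "s i (s j S) = s j (s i S)"
proof (rule code_inj)
  show "map_option code (s i (s j S)) = map_option code (s j (s i S))"
    using assms
    by (cases S) (auto simp: code_s s_state move_def fun_eq_iff transpose_def)
qed (use assms s_state in auto)

lemma s_far0:
  assumes "S \<in> states" "2 \<le> i" "i < k"
  shows "s i (s 0 S) = s 0 (s i S)"
proof (rule code_inj)
  show "map_option code (s i (s 0 S)) = map_option code (s 0 (s i S))"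
    using assms
    by (cases S) (auto simp: code_s s_state move_def fun_eq_iff transpose_def)
qed (use assms s_state in auto)

text \<open>Each of the two words swaps all three pairs among the contents i to i+2. Hence both are
  undefined in the same cases, and both reverse the three contents otherwise.\<close>

lemma s_braid:
  assumes "S \<in> states" "1 \<le> i" "Suc i < k"
  shows "s i (s (Suc i) (s i S)) = s (Suc i) (s i (s (Suc i) S))"
proof (rule code_inj)
  show "map_option code (s i (s (Suc i) (s i S))) = map_option code (s (Suc i) (s i (s (Suc i) S)))"
    using assms
    by (cases S) (auto simp: code_s s_state move_def fun_eq_iff transpose_def)
qed (use assms s_state in auto)

lemma s_braid0:
  assumes "S \<in> states" "2 \<le> k"
  shows "s 0 (s 1 (s 0 (s 1 S))) = s 1 (s 0 (s 1 (s 0 S)))"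
proof (rule code_inj)
  show "map_option code (s 0 (s 1 (s 0 (s 1 S)))) = map_option code (s 1 (s 0 (s 1 (s 0 S))))"
  proof (cases S)
    case (Some T)
    let ?u = "code T (Suc 0)" and ?v = "code T (Suc (Suc 0))"
    \<comment> \<open>Both words test the pairs (u, v) and (u, -v), but with their members exchanged
      or negated.\<close>
    have "near ?v ?u = near ?u ?v" "near (- ?u) (- ?v) = near ?u ?v" "near (- ?v) (- ?u) = near ?u ?v"
      "near (- ?u) ?v = near ?u (- ?v)" "near ?v (- ?u) = near ?u (- ?v)"
      "near (- ?v) ?u = near ?u (- ?v)"
      by (metis near_sym near_minus add.inverse_inverse)+
    then show ?thesis using assms Some
      by (auto simp: code_s s_state move_def fun_eq_iff transpose_def)
  qed (use assms in simp)
qed (use assms s_state in auto)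

text \<open>The value at \<open>None\<close> is a filler, since it will only multiply
  \<open>opt_vec None\<close>, which is 0.\<close>

definition co :: "tableau option \<Rightarrow> nat \<Rightarrow> complex" where
  "co S j = (case S of None \<Rightarrow> 0 | Some T \<Rightarrow> c T j)"

lemma co_Some [simp]: "co (Some T) j = c T j"
  by (simp add: co_def)

lemma co_s:
  assumes "S \<in> states" "1 \<le> i" "i < k" "s i S \<noteq> None" "j \<le> k"
  shows "co (s i S) j = co S (transpose i (Suc i) j)"
proof -
  obtain T where "S = Some T" using assms by (cases S) auto
  then show ?thesis using assms s_near[of T i] s_adj[of T i]
    by (cases "near (c T i) (c T (Suc i))") auto
qed

lemma co_s0:
  assumes "S \<in> states" "s 0 S \<noteq> None"
  shows "co (s 0 S) 0 = co S 0 + 2 * co S 1" "co (s 0 S) 1 = - co S 1"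
    "2 \<le> j \<Longrightarrow> j \<le> k \<Longrightarrow> co (s 0 S) j = co S j"
proof -
  obtain T where T: "S = Some T" "T \<in> \<Lambda>" using assms by (cases S) auto
  then have "\<not> exc \<sigma> \<delta> (c T 1)" using assms s_exc by auto
  from s_zero[OF T(2) this] T show "co (s 0 S) 0 = co S 0 + 2 * co S 1" "co (s 0 S) 1 = - co S 1"
    "2 \<le> j \<Longrightarrow> j \<le> k \<Longrightarrow> co (s 0 S) j = co S j" by auto
qed

lemma co_neq: "S \<in> states \<Longrightarrow> S \<noteq> None \<Longrightarrow> 1 \<le> i \<Longrightarrow> i < k \<Longrightarrow> co S (Suc i) \<noteq> co S i"
  using content_neq by (cases S) auto

lemma co_nonzero: "S \<in> states \<Longrightarrow> S \<noteq> None \<Longrightarrow> co S 1 \<noteq> 0"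
  using content_nonzero by (cases S) auto

text \<open>Opposite contents are adjacent by \<open>content_opposite\<close>, so s_1 is undefined.
  If s_0 were defined, its result would have equal first and second contents, against
  \<open>content_neq\<close>.\<close>

lemma opposite_fixed:
  assumes "S \<in> states" "S \<noteq> None" "2 \<le> k" "co S 1 + co S 2 = 0"
  shows "s 0 S = None" "s 1 S = None"
proof -
  obtain T where T: "S = Some T" "T \<in> \<Lambda>" using assms by (cases S) auto
  show "s 1 S = None"
    using T assms content_opposite[of T] s_near[of T 1] by (simp add: numeral_2_eq_2)
  show "s 0 S = None"
  proof (rule ccontr)
    assume n: "s 0 S \<noteq> None"
    moreover have "co S 2 = - co S 1" using assms(4) by (simp add: eq_neg_iff_add_eq_0 add.commute)
    ultimately have "co (s 0 S) 2 = co (s 0 S) 1"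
      using co_s0(2,3)[OF assms(1)] assms(3) by simp
    then show False using co_neq[of "s 0 S" 1] s_state[OF assms(1), of 0] n assms
      by (simp add: numeral_2_eq_2)
  qed
qed

end

section \<open>Operators in seminormal form\<close>

locale seminormal = content_system \<Lambda> k c s \<sigma> \<delta>
  for \<Lambda> :: "tableau set" and k :: nat and c :: "tableau \<Rightarrow> nat \<Rightarrow> complex"
    and s :: "nat \<Rightarrow> tableau option \<Rightarrow> tableau option" and \<sigma> \<delta> :: complex +
  fixes a b p q :: nat
    and t :: "nat \<Rightarrow> tableau \<Rightarrow> tableau \<Rightarrow> complex"
    and x :: "tableau \<Rightarrow> tableau \<Rightarrow> complex"
  assumes sigma: "\<sigma> = (of_nat (a + p) + of_nat (b + q)) / 2"
    and delta: "\<delta> = (of_nat (a + p) - of_nat (b + q)) / 2"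
begin

abbreviation shift :: complex where "shift \<equiv> half_shift a b p q"

text \<open>
  Outside \<open>\<Lambda>\<close> the operators act by the one-dimensional representation \<open>t = 1\<close>, \<open>x\<^sub>1 = a\<close>,
  \<open>z\<^sub>i = a + b + i - 1\<close>, so that relations valid on \<open>\<Lambda>\<close> hold in the ring of all linear operators.
\<close>

definition tau :: "nat \<Rightarrow> tableau lop" where
  "tau i = matrix_op (\<lambda>T. if T \<in> \<Lambda>
     then vscale (t i T T) (basis_vec T)
       + vscale (entry (t i) (Some T) (s i (Some T))) (opt_vec (s i (Some T)))
     else basis_vec T)"

definition X :: "tableau lop" where
  "X = matrix_op (\<lambda>T. if T \<in> \<Lambda>
     then vscale (x T T) (basis_vec T)
       + vscale (entry x (Some T) (s 0 (Some T))) (opt_vec (s 0 (Some T)))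
     else vscale (of_nat a) (basis_vec T))"

definition Z :: "nat \<Rightarrow> tableau lop" where
  "Z i = matrix_op (\<lambda>T. if T \<in> \<Lambda> then vscale (c T i + shift) (basis_vec T)
     else vscale (of_nat a + of_nat b + of_nat i - 1) (basis_vec T))"

definition dT :: "nat \<Rightarrow> tableau option \<Rightarrow> complex" where "dT i S = entry (t i) S S"
definition eT :: "nat \<Rightarrow> tableau option \<Rightarrow> complex" where "eT i S = entry (t i) S (s i S)"
definition dX :: "tableau option \<Rightarrow> complex" where "dX S = entry x S S"
definition eX :: "tableau option \<Rightarrow> complex" where "eX S = entry x S (s 0 S)"

lemma opt_vec_simps [simp]: "opt_vec None = 0" "opt_vec (Some T) = basis_vec T"
  by (simp_all add: opt_vec_def)

lemma entry_None [simp]: "entry M None S = 0" "entry M S None = 0"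
  by (auto simp: entry_def split: option.splits)

lemma entry_Some [simp]: "entry M (Some T) (Some U) = M T U"
  by (simp add: entry_def)

lemma tau_act:
  "S \<in> states \<Longrightarrow> app (tau i) (opt_vec S) = vscale (dT i S) (opt_vec S) + vscale (eT i S) (opt_vec (s i S))"
  by (cases S) (auto simp: tau_def app_matrix_op dT_def eT_def)

lemma X_act:
  "S \<in> states \<Longrightarrow> app X (opt_vec S) = vscale (dX S) (opt_vec S) + vscale (eX S) (opt_vec (s 0 S))"
  by (cases S) (auto simp: X_def app_matrix_op dX_def eX_def)

lemma Z_act: "S \<in> states \<Longrightarrow> app (Z i) (opt_vec S) = vscale (co S i + shift) (opt_vec S)"
  by (cases S) (auto simp: Z_def app_matrix_op)

lemma eT_None [simp]: "s i S = None \<Longrightarrow> eT i S = 0" "eT i None = 0"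
  by (simp_all add: eT_def)

lemma eX_None [simp]: "s 0 S = None \<Longrightarrow> eX S = 0" "eX None = 0"
  by (simp_all add: eX_def)

lemma eT_back: "S \<in> states \<Longrightarrow> i < k \<Longrightarrow> entry (t i) (s i S) S = eT i (s i S)"
  using s_invol[of S i] by (cases "s i S") (auto simp: eT_def)

lemma eX_back: "S \<in> states \<Longrightarrow> entry x (s 0 S) S = eX (s 0 S)"
  using s_invol[of S 0] k_pos by (cases "s 0 S") (auto simp: eX_def)

lemma tau_act_back:
  assumes "S \<in> states" "i < k"
  shows "app (tau i) (opt_vec (s i S))
    = vscale (dT i (s i S)) (opt_vec (s i S)) + vscale (eT i (s i S)) (opt_vec S)"
  using tau_act[OF s_state[OF assms], of i] s_invol[OF assms] by (cases "s i S") auto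

lemma X_act_back:
  assumes "S \<in> states"
  shows "app X (opt_vec (s 0 S))
    = vscale (dX (s 0 S)) (opt_vec (s 0 S)) + vscale (eX (s 0 S)) (opt_vec S)"
  using X_act[OF s_state[OF assms, of 0]] s_invol[OF assms, of 0] k_pos by (cases "s 0 S") auto

lemmas expand = app_add app_diff app_vscale vec.scale_right_distrib vec.scale_right_diff_distrib

text \<open>The off-diagonal terms cancel whatever the coefficients are, because z_{i+1} acts on the
  vector of s_i T by c_T(i). What remains contains the diagonal entry alone, linearly, and so
  determines it.\<close>

lemma tau_Z_hecke:
  assumes "T \<in> \<Lambda>" "1 \<le> i" "i < k"
  shows "app (tau i * Z i - (Z (Suc i) * tau i - 1)) (basis_vec T)
    = vscale (t i T T * (c T i - c T (Suc i)) + 1) (basis_vec T)"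
proof -
  have S: "Some T \<in> states" using assms by simp
  note S' = s_state[OF S assms(3)]
  have e: "eT i (Some T) * co (s i (Some T)) (Suc i) = eT i (Some T) * c T i"
    using co_s[OF S assms(2,3), of "Suc i"] assms by (cases "s i (Some T) = None") auto
  have "app (tau i * Z i - (Z (Suc i) * tau i - 1)) (opt_vec (Some T))
    = vscale (t i T T * (c T i - c T (Suc i)) + 1) (opt_vec (Some T))
      + vscale (eT i (Some T) * c T i - eT i (Some T) * co (s i (Some T)) (Suc i))
         (opt_vec (s i (Some T)))"
    unfolding app_ops Z_act[OF S] app_vscale tau_act[OF S] app_add Z_act[OF S']
    by (rule poly_mapping_eqI)
      (simp add: lookup_add lookup_minus lookup_vscale dT_def algebra_simps del: opt_vec_simps)
  then show ?thesis by (simp add: e)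
qed

lemma tau_Z_comm:
  assumes "T \<in> \<Lambda>" "1 \<le> i" "i < k" "j \<le> k" "j \<noteq> i" "j \<noteq> Suc i"
  shows "app (tau i * Z j) (basis_vec T) = app (Z j * tau i) (basis_vec T)"
proof -
  have S: "Some T \<in> states" using assms by simp
  note S' = s_state[OF S assms(3)]
  have e: "eT i (Some T) * co (s i (Some T)) j = eT i (Some T) * c T j"
    using co_s[OF S assms(2,3), of j] assms by (cases "s i (Some T) = None") auto
  have "app (tau i * Z j) (opt_vec (Some T)) = app (Z j * tau i) (opt_vec (Some T))"
    unfolding app_ops Z_act[OF S] app_vscale tau_act[OF S] app_add Z_act[OF S'] expand
    using e by (auto simp: algebra_simps simp del: opt_vec_simps)
  then show ?thesis by simp
qed

lemma X_Z_comm: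
  assumes "T \<in> \<Lambda>" "2 \<le> j" "j \<le> k"
  shows "app (X * Z j) (basis_vec T) = app (Z j * X) (basis_vec T)"
proof -
  have S: "Some T \<in> states" using assms by simp
  have S': "s 0 (Some T) \<in> states" using k_pos by (intro s_state[OF S]) auto
  have e: "eX (Some T) * co (s 0 (Some T)) j = eX (Some T) * c T j"
    using co_s0(3)[OF S, of j] assms by (cases "s 0 (Some T) = None") auto
  have "app (X * Z j) (opt_vec (Some T)) = app (Z j * X) (opt_vec (Some T))"
    unfolding app_ops Z_act[OF S] app_vscale X_act[OF S] app_add Z_act[OF S'] expand
    using e by (auto simp: algebra_simps simp del: opt_vec_simps)
  then show ?thesis by simp
qed

text \<open>The move s_0 sends c_0 to c_0 + 2 c_1 and c_1 to - c_1, and so preserves their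
  sum.\<close>

lemma X_Z01_comm:
  assumes "T \<in> \<Lambda>"
  shows "app (X * (Z 0 + Z 1)) (basis_vec T) = app ((Z 0 + Z 1) * X) (basis_vec T)"
proof -
  have S: "Some T \<in> states" using assms by simp
  have S': "s 0 (Some T) \<in> states" using k_pos by (intro s_state[OF S]) auto
  have e: "eX (Some T) * (co (s 0 (Some T)) 0 + co (s 0 (Some T)) 1)
      = eX (Some T) * (c T 0 + c T 1)"
    using co_s0(1,2)[OF S] by (cases "s 0 (Some T) = None") auto
  have "app (X * (Z 0 + Z 1)) (opt_vec (Some T)) - app ((Z 0 + Z 1) * X) (opt_vec (Some T))
    = vscale (eX (Some T) * (c T 0 + c T 1)
        - eX (Some T) * (co (s 0 (Some T)) 0 + co (s 0 (Some T)) 1)) (opt_vec (s 0 (Some T)))"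
    unfolding app_ops Z_act[OF S] app_vscale X_act[OF S] app_add Z_act[OF S']
    by (rule poly_mapping_eqI)
      (simp add: lookup_add lookup_minus lookup_vscale algebra_simps del: opt_vec_simps)
  then show ?thesis
    unfolding e by (simp only: diff_self vec.scale_zero_left right_minus_eq opt_vec_simps)
qed

lemma Z_Z_comm: "Z i * Z j = Z j * Z i"
  by (rule lop_eqI) (simp add: Z_def app_matrix_op app_vscale mult.commute)

text \<open>The operator is (y_1 - b)(y_1 + q) - (x_1 - a)(x_1 + p) with y_1 = z_1 - x_1, from which
  the square of x_1 has dropped out. Off the diagonal, z_1 x_1 + x_1 z_1 contributes c_T(1) - c_T(1)
  plus twice the shift, which a - p + b - q cancels: this is what the shift of the contents is made
  for.\<close>

lemma Y_quadratic:
  assumes T: "T \<in> \<Lambda>"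
  shows "app (Z 1 * Z 1 - Z 1 * X - X * Z 1 + (of_nat a - of_nat p) * X + of_nat (a * p)
      - (of_nat b - of_nat q) * (Z 1 - X) - of_nat (b * q)) (basis_vec T)
    = vscale (- 2 * c T 1 * x T T + ((of_nat a - of_nat p) * c T 1 + (c T 1)\<^sup>2 + \<sigma> * \<delta>)) (basis_vec T)"
proof -
  have S: "Some T \<in> states" using T by simp
  have S': "s 0 (Some T) \<in> states" using k_pos by (intro s_state[OF S]) auto
  have e: "eX (Some T) * co (s 0 (Some T)) 1 = - eX (Some T) * c T 1"
    using co_s0(2)[OF S] by (cases "s 0 (Some T) = None") auto
  let ?r = "eX (Some T)" and ?u = "opt_vec (s 0 (Some T))" and ?v = "opt_vec (Some T)"
  have "app (Z 1 * Z 1 - Z 1 * X - X * Z 1 + (of_nat a - of_nat p) * X + of_nat (a * p)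
      - (of_nat b - of_nat q) * (Z 1 - X) - of_nat (b * q)) ?v
    = vscale ((c T 1 + shift)\<^sup>2 - 2 * (c T 1 + shift) * x T T + (of_nat a - of_nat p) * x T T
         + of_nat (a * p) - (of_nat b - of_nat q) * (c T 1 + shift - x T T) - of_nat (b * q)) ?v
      + vscale (- (?r * co (s 0 (Some T)) 1) - ?r * c T 1
          + ?r * (of_nat a - of_nat p + (of_nat b - of_nat q) - 2 * shift)) ?u"
    unfolding app_ops app_of_nat Z_act[OF S] app_vscale X_act[OF S] app_add app_diff Z_act[OF S']
    by (rule poly_mapping_eqI)
      (simp add: lookup_add lookup_minus lookup_vscale dX_def algebra_simps power2_eq_square
        del: opt_vec_simps)
  also have "- (?r * co (s 0 (Some T)) 1) - ?r * c T 1
          + ?r * (of_nat a - of_nat p + (of_nat b - of_nat q) - 2 * shift) = 0"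
    unfolding e half_shift_def by (simp add: field_simps)
  also have "(c T 1 + shift)\<^sup>2 - 2 * (c T 1 + shift) * x T T + (of_nat a - of_nat p) * x T T
         + of_nat (a * p) - (of_nat b - of_nat q) * (c T 1 + shift - x T T) - of_nat (b * q)
    = - 2 * c T 1 * x T T + ((of_nat a - of_nat p) * c T 1 + (c T 1)\<^sup>2 + \<sigma> * \<delta>)"
    by (simp add: half_shift_def sigma delta field_simps power2_eq_square)
  finally show ?thesis by simp
qed

end

text \<open>The second identity is d d' = d'' (d + d'), true because w - u is the sum of v - u and w
  - v. The two sides of the first differ by (d - d') times the second. The first will settle the
  coefficient of v_T in the braid relation, the second those of its two neighbours.\<close>

lemma inverse_difference_identities:
  fixes u v w :: complex
  assumes "v \<noteq> u" "w \<noteq> v" "w \<noteq> u"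
  defines "d \<equiv> 1 / (v - u)" and "d' \<equiv> 1 / (w - v)" and "d'' \<equiv> 1 / (w - u)"
  shows "d * d * d' + (1 - d\<^sup>2) * d'' = d' * d' * d + (1 - d'\<^sup>2) * d''"
    and "d * d' - d * d'' = d' * d''"
proof -
  have nz: "v - u \<noteq> 0" "w - v \<noteq> 0" "w - u \<noteq> 0" using assms by auto
  show 2: "d * d' - d * d'' = d' * d''"
    unfolding d_def d'_def d''_def using nz by (simp add: divide_simps)
  have "d * d * d' + (1 - d\<^sup>2) * d'' - (d' * d' * d + (1 - d'\<^sup>2) * d'')
      = (d - d') * (d * d' - d * d'' - d' * d'')"
    by (simp add: algebra_simps power2_eq_square)
  then show "d * d * d' + (1 - d\<^sup>2) * d'' = d' * d' * d + (1 - d'\<^sup>2) * d''"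
    using 2 by simp
qed

section \<open>Relations among the t_i with known diagonal entries\<close>

locale seminormal_t = seminormal +
  assumes t_diag: "T \<in> \<Lambda> \<Longrightarrow> 1 \<le> i \<Longrightarrow> i < k \<Longrightarrow> t i T T = 1 / (c T (Suc i) - c T i)"
begin

lemma dT_eq:
  "S \<in> states \<Longrightarrow> S \<noteq> None \<Longrightarrow> 1 \<le> i \<Longrightarrow> i < k \<Longrightarrow> dT i S = 1 / (co S (Suc i) - co S i)"
  by (cases S) (auto simp: dT_def t_diag)

lemma dT_move:
  assumes "S \<in> states" "1 \<le> i" "i < k" "1 \<le> j" "j < k" "s i S \<noteq> None"
  shows "dT j (s i S) = 1 / (co S (transpose i (Suc i) (Suc j)) - co S (transpose i (Suc i) j))"
  using dT_eq[OF s_state[OF assms(1,3)] assms(6,4,5)] co_s[OF assms(1,2,3,6), of j]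
    co_s[OF assms(1,2,3,6), of "Suc j"] assms(5) by simp

lemma minus_inverse_diff: "1 / (u - v) = - (1 / (v - u))" for u v :: complex
  by (metis minus_diff_eq minus_divide_right)

lemma dT_swap:
  assumes "S \<in> states" "1 \<le> i" "i < k" "s i S \<noteq> None"
  shows "dT i (s i S) = - dT i S"
proof -
  have "S \<noteq> None" using assms(4) by (cases S) auto
  then show ?thesis
    using assms minus_inverse_diff[of "co S i" "co S (Suc i)"] dT_move[OF assms(1-3,2,3,4)]
      dT_eq[OF assms(1) _ assms(2,3)] by simp
qed

text \<open>The mixed terms cancel since the diagonal entries at T and s_i T are opposite.\<close>

lemma tau_square:
  assumes "T \<in> \<Lambda>" "1 \<le> i" "i < k"
  shows "app (tau i * tau i - 1) (basis_vec T)
    = vscale ((t i T T)\<^sup>2 + eT i (Some T) * eT i (s i (Some T)) - 1) (basis_vec T)"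
proof -
  let ?S = "Some T"
  have S: "?S \<in> states" using assms by simp
  have "eT i ?S = 0 \<or> dT i (s i ?S) = - dT i ?S"
    using dT_swap[OF S assms(2,3)] by (cases "s i ?S = None") auto
  then have e: "dT i ?S * eT i ?S + eT i ?S * dT i (s i ?S) = 0" by auto
  have "app (tau i * tau i - 1) (opt_vec ?S)
    = vscale ((dT i ?S)\<^sup>2 + eT i ?S * eT i (s i ?S) - 1) (opt_vec ?S)
      + vscale (dT i ?S * eT i ?S + eT i ?S * dT i (s i ?S)) (opt_vec (s i ?S))"
    unfolding app_ops tau_act[OF S] tau_act_back[OF S assms(3)] app_add app_vscale
    by (rule poly_mapping_eqI)
      (simp add: lookup_add lookup_minus lookup_vscale algebra_simps power2_eq_square del: opt_vec_simps)
  then show ?thesis unfolding e by (simp add: dT_def)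
qed

text \<open>A distant swap leaves the two contents in a diagonal entry alone, so the terms with one
  diagonal and one off-diagonal factor agree on both sides.\<close>

lemma tau_far:
  assumes "T \<in> \<Lambda>" "1 \<le> i" "Suc i < j" "j < k"
  shows "app (tau i * tau j - tau j * tau i) (basis_vec T)
    = vscale (eT i (s j (Some T)) * eT j (Some T) - eT i (Some T) * eT j (s i (Some T)))
        (opt_vec (s i (s j (Some T))))"
proof -
  let ?S = "Some T"
  have S: "?S \<in> states" and ij: "1 \<le> j" "i < k" using assms by auto
  note Si = s_state[OF S ij(2)] and Sj = s_state[OF S assms(4)]
  have "eT i ?S = 0 \<or> dT j (s i ?S) = dT j ?S"
    using dT_move[OF S assms(2) ij(2,1) assms(4)] dT_eq[OF S _ ij(1) assms(4)] assms
    by (cases "s i ?S = None") auto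
  then have e1: "eT i ?S * dT j (s i ?S) = eT i ?S * dT j ?S" by auto
  have "eT j ?S = 0 \<or> dT i (s j ?S) = dT i ?S"
    using dT_move[OF S ij(1) assms(4,2) ij(2)] dT_eq[OF S _ assms(2) ij(2)] assms
    by (cases "s j ?S = None") auto
  then have e2: "eT j ?S * dT i (s j ?S) = eT j ?S * dT i ?S" by auto
  have w: "s j (s i ?S) = s i (s j ?S)" using s_far[OF S assms(2-4)] by (rule sym)
  have "app (tau i * tau j - tau j * tau i) (opt_vec ?S)
    = vscale (dT j ?S * eT i ?S - eT i ?S * dT j (s i ?S)) (opt_vec (s i ?S))
      + vscale (eT j ?S * dT i (s j ?S) - dT i ?S * eT j ?S) (opt_vec (s j ?S))
      + vscale (eT i (s j ?S) * eT j ?S - eT i ?S * eT j (s i ?S)) (opt_vec (s i (s j ?S)))"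
    unfolding app_ops tau_act[OF S] tau_act[OF Si] tau_act[OF Sj] w app_add app_vscale
    by (rule poly_mapping_eqI)
      (simp add: lookup_add lookup_minus lookup_vscale algebra_simps del: opt_vec_simps)
  then show ?thesis unfolding e1 e2 by (simp add: mult.commute)
qed

text \<open>The expansion runs over the six states of an S_3-orbit. At v_T the returning paths are
  evaluated by the quadratic relations, at the neighbours the partial fraction identity applies, and
  two steps away equal diagonal entries cancel. Only the two paths to the far end remain.\<close>

lemma tau_braid:
  assumes "T \<in> \<Lambda>" "1 \<le> i" "Suc i < k"
    and quad: "eT i (Some T) * eT i (s i (Some T)) = 1 - (t i T T)\<^sup>2"
      "eT (Suc i) (Some T) * eT (Suc i) (s (Suc i) (Some T)) = 1 - (t (Suc i) T T)\<^sup>2"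
  shows "app (tau i * tau (Suc i) * tau i - tau (Suc i) * tau i * tau (Suc i)) (basis_vec T)
    = vscale (eT i (Some T) * eT (Suc i) (s i (Some T)) * eT i (s (Suc i) (s i (Some T)))
        - eT (Suc i) (Some T) * eT i (s (Suc i) (Some T)) * eT (Suc i) (s i (s (Suc i) (Some T))))
        (opt_vec (s i (s (Suc i) (s i (Some T)))))"
proof -
  define j where "j = Suc i"
  define S where "S = Some T"
  have S: "S \<in> states" "S \<noteq> None" and ij: "1 \<le> i" "i < k" "1 \<le> j" "j < k"
    using assms by (auto simp: S_def j_def)
  define S1 where "S1 = s i S" define S2 where "S2 = s j S"
  define S12 where "S12 = s j S1" define S21 where "S21 = s i S2"
  define top where "top = s i S12"
  have st: "S1 \<in> states" "S2 \<in> states" "S12 \<in> states" "S21 \<in> states"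
    unfolding S1_def S2_def S12_def S21_def using S ij by (auto intro!: s_state)
  have top': "s j S21 = top"
    unfolding top_def S12_def S21_def S1_def S2_def j_def using s_braid[OF S(1) ij(1)] assms by simp
  define u v w where uvw: "u = co S i" "v = co S j" "w = co S (Suc j)"
  have ne: "v \<noteq> u" "w \<noteq> v" "w \<noteq> u"
    using content_neq[of T i] content_neq[of T j] content_neq2[of T i] assms
    by (auto simp: uvw S_def j_def)
  let ?d12 = "1 / (v - u)" and ?d23 = "1 / (w - v)" and ?d13 = "1 / (w - u)"
  have d: "dT i S = ?d12" "dT j S = ?d23"
    using S ij by (auto simp: dT_eq uvw j_def)
  let ?e1 = "eT i S" and ?e2 = "eT j S" and ?f1 = "eT j S1" and ?f2 = "eT i S2"
  have F1: "?e1 = 0 \<or> dT j S1 = ?d13 \<and> dT i S1 = - ?d12 \<and> (?f1 = 0 \<or> dT i S12 = ?d23)"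
  proof (cases "S1 = None")
    case False
    then have c1: "co S1 l = co S (transpose i (Suc i) l)" if "l \<le> k" for l
      using co_s[OF S(1) ij(1,2)] that unfolding S1_def by simp
    have "dT j S1 = ?d13"
      using dT_eq[OF st(1) False ij(3,4)] c1[of j] c1[of "Suc j"] assms(3) by (simp add: uvw j_def)
    moreover have "dT i S1 = - ?d12"
      using dT_swap[OF S(1) ij(1,2)] False d by (simp add: S1_def)
    moreover have "dT i S12 = ?d23" if "S12 \<noteq> None"
      using dT_move[OF st(1) ij(3,4,1,2)] that assms(3) by (simp add: c1 uvw j_def S12_def)
    ultimately show ?thesis by (cases "S12 = None") (auto simp: S12_def)
  qed (simp add: S1_def)
  have F2: "?e2 = 0 \<or> dT i S2 = ?d13 \<and> dT j S2 = - ?d23 \<and> (?f2 = 0 \<or> dT j S21 = ?d12)"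
  proof (cases "S2 = None")
    case False
    then have c1: "co S2 l = co S (transpose j (Suc j) l)" if "l \<le> k" for l
      using co_s[OF S(1) ij(3,4)] that unfolding S2_def by simp
    have "dT i S2 = ?d13"
      using dT_eq[OF st(2) False ij(1,2)] c1[of i] c1[of "Suc i"] assms(3) by (simp add: uvw j_def)
    moreover have "dT j S2 = - ?d23"
      using dT_swap[OF S(1) ij(3,4)] False d by (simp add: S2_def)
    moreover have "dT j S21 = ?d12" if "S21 \<noteq> None"
      using dT_move[OF st(2) ij] that assms(3) by (simp add: c1 uvw j_def S21_def)
    ultimately show ?thesis by (cases "S21 = None") (auto simp: S21_def)
  qed (simp add: S2_def)
  have q: "?e1 * eT i S1 = 1 - ?d12\<^sup>2" "?e2 * eT j S2 = 1 - ?d23\<^sup>2"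
    using quad d by (simp_all add: S1_def S2_def S_def j_def dT_def)
  note id = inverse_difference_identities[OF ne]
  have "app (tau i * tau j * tau i - tau j * tau i * tau j) (opt_vec S)
    = vscale (dT i S * dT i S * dT j S + (?e1 * eT i S1) * dT j S1
        - (dT j S * dT j S * dT i S + (?e2 * eT j S2) * dT i S2)) (opt_vec S)
    + vscale (?e1 * (dT i S * dT j S + dT j S1 * dT i S1 - dT j S * dT j S1)) (opt_vec S1)
    + vscale (?e2 * (dT i S * dT i S2 - dT j S * dT i S - dT i S2 * dT j S2)) (opt_vec S2)
    + vscale (?e1 * ?f1 * (dT i S12 - dT j S)) (opt_vec S12)
    + vscale (?e2 * ?f2 * (dT i S - dT j S21)) (opt_vec S21)
    + vscale (?e1 * ?f1 * eT i S12 - ?e2 * ?f2 * eT j S21) (opt_vec top)"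
    using tau_act[OF S(1), of i] tau_act[OF S(1), of j] tau_act[OF st(1), of j] tau_act[OF st(2), of i]
      tau_act[OF st(3), of i] tau_act[OF st(4), of j]
      tau_act_back[OF S(1) ij(2)] tau_act_back[OF S(1) ij(4)] top'
    unfolding app_ops S1_def[symmetric] S2_def[symmetric] S12_def[symmetric] S21_def[symmetric]
      top_def[symmetric]
    by (intro poly_mapping_eqI)
      (simp add: app_add app_vscale lookup_add lookup_minus lookup_vscale algebra_simps del: opt_vec_simps)
  also have "dT i S * dT i S * dT j S + (?e1 * eT i S1) * dT j S1
        - (dT j S * dT j S * dT i S + (?e2 * eT j S2) * dT i S2) = 0"
  proof -
    have "(?e1 * eT i S1) * dT j S1 = (1 - ?d12\<^sup>2) * ?d13"
      using F1 q(1) by auto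
    moreover have "(?e2 * eT j S2) * dT i S2 = (1 - ?d23\<^sup>2) * ?d13"
      using F2 q(2) by auto
    ultimately show ?thesis using id(1) by (simp only: d) simp
  qed
  also have "?e1 * (dT i S * dT j S + dT j S1 * dT i S1 - dT j S * dT j S1) = 0"
  proof -
    have "?d12 * ?d23 + ?d13 * (- ?d12) - ?d23 * ?d13 = 0" using id(2) by (simp add: mult.commute)
    then show ?thesis using F1 d by (metis mult_eq_0_iff)
  qed
  also have "?e2 * (dT i S * dT i S2 - dT j S * dT i S - dT i S2 * dT j S2) = 0"
  proof -
    have "r * r'' - r' * r - r'' * (- r') = 0" if "r * r' - r * r'' = r' * r''" for r r' r'' :: complex
      using that by (simp add: algebra_simps)
    then have "?d12 * ?d13 - ?d23 * ?d12 - ?d13 * (- ?d23) = 0" using id(2) .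
    then show ?thesis using F2 d by (metis mult_eq_0_iff)
  qed
  also have "?e1 * ?f1 * (dT i S12 - dT j S) = 0" using F1 d by auto
  also have "?e2 * ?f2 * (dT i S - dT j S21) = 0" using F2 d by auto
  finally show ?thesis
    by (simp add: S_def S1_def S2_def S12_def S21_def top_def j_def)
qed

end

text \<open>In this lemma and the next three, d and f stand for 1 / (v - u) and 1 / (u + v), and m +
  g and m + g' for the diagonal entries of x_1 at contents u and v. Each coefficient is a multiple
  of (d - f) g - (d + f) g' + 1; here a second term appears, whose factor r - r' - (g'^2 - g^2)
  vanishes by the quadratic relation of x_1.\<close>

lemma boundary_coefficient_t:
  fixes d f m g g' r r' :: complex
  shows "d * (m + g) * (m + g') + (m + g') * (- d) * (m + g') + f * r' + (m + g')
      - ((m + g) * d * (m + g) + (m + g) * (m + g') * (- d) + (m + g)) - f * r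
    = - ((g - g') * ((d - f) * g - (d + f) * g' + 1)) - f * (r - r' - (g'\<^sup>2 - g\<^sup>2))"
  by (simp add: algebra_simps power2_eq_square)

lemma boundary_coefficient_x:
  fixes d f m g g' :: complex
  shows "d * d * (m + g) + d * f * (m - g) + d + (1 - d\<^sup>2) * (m + g')
      - ((m + g) * d * f + f * (m - g) * f + (1 - f\<^sup>2) * (m + g') + f)
    = (d - f) * ((d - f) * g - (d + f) * g' + 1)"
  by (simp add: algebra_simps power2_eq_square)

lemma boundary_coefficient_xt:
  fixes d f m g g' :: complex
  shows "d * (m + g') - (m + g) * d - f * (m - g) - (m + g') * (- f) - 1
    = - ((d - f) * g - (d + f) * g' + 1)"
  by (simp add: algebra_simps)

lemma boundary_coefficient_tx:
  fixes d f m g g' :: complex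
  shows "d * (m + g) + (m + g') * (- d) + f * (m - g') + 1 - (m + g) * f
    = (d - f) * g - (d + f) * g' + 1"
  by (simp add: algebra_simps)

section \<open>Relations involving x_1 with known diagonal entries\<close>

locale seminormal_tx = seminormal_t +
  assumes x_diag: "T \<in> \<Lambda> \<Longrightarrow>
    x T T = ((of_nat a - of_nat p) * c T 1 + (c T 1)\<^sup>2 + \<sigma> * \<delta>) / (2 * c T 1)"
begin

text \<open>The part of the diagonal entry of x_1 that is odd in the content, and hence changes sign
  under s_0; \<open>mid\<close> is the part that s_0 fixes.\<close>

definition Gx :: "complex \<Rightarrow> complex" where "Gx u = (u + \<sigma> * \<delta> / u) / 2"

text \<open>The right-hand side of (5). At nonzero contents it vanishes exactly where the content is
  exceptional.\<close>

definition rho4 :: "complex \<Rightarrow> complex" where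
  "rho4 u = - (1 / (2 * u)\<^sup>2) * (u + \<sigma>) * (u - \<delta>) * (u - \<sigma>) * (u + \<delta>)"

abbreviation mid :: complex where "mid \<equiv> (of_nat a - of_nat p) / 2"

lemma Gx_minus: "Gx (- u) = - Gx u"
  by (simp add: Gx_def field_simps)

lemma Gx_mult: "u \<noteq> 0 \<Longrightarrow> 2 * u * Gx u = u * u + \<sigma> * \<delta>"
  by (simp add: Gx_def field_simps)

lemma sigma_delta: "\<sigma> + \<delta> = of_nat a + of_nat p"
  by (simp add: sigma delta field_simps)

text \<open>A 2 by 2 matrix with diagonal \<open>mid\<close> plus and minus \<open>Gx u\<close> and
  determinant - a p has this product of off-diagonal entries, because the square of
  \<open>mid\<close> plus a p is the square of (a + p) / 2.\<close>

lemma rho4_eq: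
  assumes "u \<noteq> 0"
  shows "rho4 u = ((\<sigma> + \<delta>) / 2)\<^sup>2 - (Gx u)\<^sup>2"
proof -
  have g: "Gx u = (u * u + \<sigma> * \<delta>) / (2 * u)" using Gx_mult[OF assms] assms by (simp add: field_simps)
  show ?thesis
    unfolding rho4_def g using assms by (simp add: field_simps power2_eq_square)
qed

lemma dX_eq:
  assumes "S \<in> states" "S \<noteq> None"
  shows "dX S = mid + Gx (co S 1)"
proof -
  have "co S 1 \<noteq> 0" using co_nonzero assms by blast
  moreover obtain T where "S = Some T" "T \<in> \<Lambda>" using assms by (cases S) auto
  ultimately have "dX S = ((of_nat a - of_nat p) * co S 1 + (co S 1)\<^sup>2 + \<sigma> * \<delta>) / (2 * co S 1)"
    using x_diag[of T] by (simp add: dX_def)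
  then show ?thesis using \<open>co S 1 \<noteq> 0\<close>
    by (simp add: Gx_def add_divide_distrib power2_eq_square)
qed

lemma dX_move0:
  assumes "S \<in> states" "s 0 S \<noteq> None"
  shows "dX (s 0 S) = mid - Gx (co S 1)"
  using dX_eq[OF s_state[OF assms(1)] assms(2)] co_s0(2)[OF assms] k_pos by (simp add: Gx_minus)

lemma dX_move1:
  assumes "S \<in> states" "2 \<le> k" "s 1 S \<noteq> None"
  shows "dX (s 1 S) = mid + Gx (co S 2)"
  using dX_eq[OF s_state[OF assms(1)] assms(3)] co_s[OF assms(1) _ _ assms(3), of 1] assms(2)
  by (simp add: numeral_2_eq_2)

lemma dX_move_far:
  assumes "S \<in> states" "2 \<le> i" "i < k" "s i S \<noteq> None"
  shows "dX (s i S) = dX S"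
proof -
  have "S \<noteq> None" using assms(4) by (cases S) auto
  moreover have "transpose i (Suc i) 1 = 1" using assms(2) by (simp add: transpose_def)
  ultimately show ?thesis
    using dX_eq[OF s_state[OF assms(1,3)] assms(4)] dX_eq[OF assms(1)]
      co_s[OF assms(1) _ assms(3,4), of 1] assms k_pos by simp
qed

lemma dT_move0_far:
  assumes "S \<in> states" "2 \<le> i" "i < k" "s 0 S \<noteq> None"
  shows "dT i (s 0 S) = dT i S"
proof -
  have "S \<noteq> None" using assms(4) by (cases S) auto
  then show ?thesis
    using dT_eq[OF s_state[OF assms(1)] assms(4) _ assms(3)] dT_eq[OF assms(1) _ _ assms(3)]
      co_s0(3)[OF assms(1,4)] assms(2,3) by simp
qed

lemma dT_move0:
  assumes "S \<in> states" "2 \<le> k" "s 0 S \<noteq> None"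
  shows "dT 1 (s 0 S) = 1 / (co S 1 + co S 2)"
  using dT_eq[OF s_state[OF assms(1)] assms(3), of 1] assms(2)
    co_s0(2,3)[OF assms(1,3)] by (simp add: numeral_2_eq_2 add.commute)

text \<open>The diagonal entries at T and s_0 T add up to a - p, the trace that the quadratic
  relation prescribes, so the off-diagonal part vanishes; the rest is the determinant.\<close>

lemma X_quadratic:
  assumes T: "T \<in> \<Lambda>"
  shows "app (X * X - (of_nat a - of_nat p) * X - of_nat (a * p)) (basis_vec T)
    = vscale (eX (Some T) * eX (s 0 (Some T)) - rho4 (c T 1)) (basis_vec T)"
proof -
  let ?S = "Some T"
  have S: "?S \<in> states" using T by simp
  have c0: "c T 1 \<noteq> 0" using content_nonzero T by blast
  have "dX ?S + dX (s 0 ?S) = of_nat a - of_nat p" if "s 0 ?S \<noteq> None"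
    unfolding dX_move0[OF S that] dX_eq[OF S option.distinct(2)] by simp
  then have "eX ?S = 0 \<or> dX ?S + dX (s 0 ?S) = of_nat a - of_nat p"
    by (cases "s 0 ?S = None") auto
  then have e: "eX ?S * (dX ?S + dX (s 0 ?S) - (of_nat a - of_nat p)) = 0" by auto
  have d: "dX ?S = mid + Gx (c T 1)" using dX_eq[OF S] by simp
  have f: "(dX ?S)\<^sup>2 - (of_nat a - of_nat p) * dX ?S - of_nat (a * p) = - rho4 (c T 1)"
    unfolding d rho4_eq[OF c0] sigma_delta by (simp add: field_simps power2_eq_square)
  have "app (X * X - (of_nat a - of_nat p) * X - of_nat (a * p)) (opt_vec ?S)
    = vscale ((dX ?S)\<^sup>2 - (of_nat a - of_nat p) * dX ?S - of_nat (a * p) + eX ?S * eX (s 0 ?S)) (opt_vec ?S)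
      + vscale (eX ?S * (dX ?S + dX (s 0 ?S) - (of_nat a - of_nat p))) (opt_vec (s 0 ?S))"
    unfolding app_ops app_of_nat X_act[OF S] app_add app_vscale X_act_back[OF S]
    by (rule poly_mapping_eqI)
      (simp add: lookup_add lookup_minus lookup_vscale algebra_simps power2_eq_square del: opt_vec_simps)
  then show ?thesis unfolding e f by simp
qed

lemma tau_X_far:
  assumes "T \<in> \<Lambda>" "2 \<le> i" "i < k"
  shows "app (tau i * X - X * tau i) (basis_vec T)
    = vscale (eT i (s 0 (Some T)) * eX (Some T) - eT i (Some T) * eX (s i (Some T)))
        (opt_vec (s i (s 0 (Some T))))"
proof -
  let ?S = "Some T"
  have S: "?S \<in> states" using assms by simp
  have S0: "s 0 ?S \<in> states" using k_pos by (intro s_state[OF S]) auto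
  note Si = s_state[OF S assms(3)]
  have "eT i ?S = 0 \<or> dX (s i ?S) = dX ?S"
    using dX_move_far[OF S assms(2,3)] by (cases "s i ?S = None") auto
  then have e1: "eT i ?S * dX (s i ?S) = eT i ?S * dX ?S" by auto
  have "eX ?S = 0 \<or> dT i (s 0 ?S) = dT i ?S"
    using dT_move0_far[OF S assms(2,3)] by (cases "s 0 ?S = None") auto
  then have e2: "eX ?S * dT i (s 0 ?S) = eX ?S * dT i ?S" by auto
  have w: "s 0 (s i ?S) = s i (s 0 ?S)" using s_far0[OF S assms(2,3)] by (rule sym)
  have "app (tau i * X - X * tau i) (opt_vec ?S)
    = vscale (dX ?S * eT i ?S - eT i ?S * dX (s i ?S)) (opt_vec (s i ?S))
      + vscale (eX ?S * dT i (s 0 ?S) - dT i ?S * eX ?S) (opt_vec (s 0 ?S))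
      + vscale (eT i (s 0 ?S) * eX ?S - eT i ?S * eX (s i ?S)) (opt_vec (s i (s 0 ?S)))"
    unfolding app_ops tau_act[OF S] X_act[OF S] tau_act[OF S0] X_act[OF Si] w app_add app_vscale
    by (rule poly_mapping_eqI)
      (simp add: lookup_add lookup_minus lookup_vscale algebra_simps del: opt_vec_simps)
  then show ?thesis unfolding e1 e2 by (simp add: mult.commute)
qed

text \<open>
  The only relation between the diagonal entries of \<open>t\<^sub>1\<close> and \<open>x\<^sub>1\<close> that the four-term braid
  relation needs; all its coefficients are multiples of this one.
\<close>

lemma boundary_identity:
  assumes gu: "2 * u * Gx u = u * u + \<sigma> * \<delta>" and gv: "2 * v * Gx v = v * v + \<sigma> * \<delta>"
    and "v \<noteq> u" "u + v \<noteq> 0"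
  defines "d \<equiv> 1 / (v - u)" and "f \<equiv> 1 / (u + v)"
  shows "(d - f) * Gx u - (d + f) * Gx v + 1 = 0"
proof -
  have nz: "v - u \<noteq> 0" "u + v \<noteq> 0" using assms by auto
  \<comment> \<open>The sum and the difference of the denominators u + v and v - u are 2 v and 2 u.
    Thus \<open>Gx\<close> occurs only multiplied by its own denominator, which is why the
    hypotheses are stated without division and can hold for v = 0.\<close>
  have "d - f = 2 * u * (d * f)" "d + f = 2 * v * (d * f)"
    unfolding d_def f_def using nz by (simp_all add: field_simps)
  then have "(d - f) * Gx u - (d + f) * Gx v = d * f * (2 * u * Gx u - 2 * v * Gx v)"
    by (simp only:) (simp add: algebra_simps)
  also have "\<dots> = d * f * (- ((v - u) * (u + v)))"
    unfolding gu gv by (simp add: algebra_simps)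
  also have "\<dots> = - 1" unfolding d_def f_def using nz by simp
  finally show ?thesis by simp
qed

text \<open>The relation of type B_2 on the orbit of T under s_0 and s_1. In the proof K1 to K4
  reduce to \<open>boundary_identity\<close>, with quadratic relations also at s_0 T and s_1 T for
  the paths that turn back; K5 and K6 compare equal diagonal entries at the two ends of a path. The
  two longest paths remain.\<close>

lemma X_tau_braid:
  assumes T: "T \<in> \<Lambda>" and k: "2 \<le> k"
    and quad_t: "\<And>U. U \<in> \<Lambda> \<Longrightarrow> eT 1 (Some U) * eT 1 (s 1 (Some U)) = 1 - (t 1 U U)\<^sup>2"
    and quad_x: "\<And>U. U \<in> \<Lambda> \<Longrightarrow> eX (Some U) * eX (s 0 (Some U)) = rho4 (c U 1)"
  shows "app (X * (tau 1 * X * tau 1 + tau 1) - (tau 1 * X * tau 1 + tau 1) * X) (basis_vec T)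
    = vscale (eX (s 1 (Some T)) * eX (s 1 (s 0 (s 1 (Some T)))) * eT 1 (Some T) * eT 1 (s 0 (s 1 (Some T)))
        - eX (Some T) * eX (s 1 (s 0 (Some T))) * eT 1 (s 0 (Some T)) * eT 1 (s 0 (s 1 (s 0 (Some T)))))
        (opt_vec (s 0 (s 1 (s 0 (s 1 (Some T))))))"
proof -
  define S where "S = Some T"
  have S: "S \<in> states" "S \<noteq> None" and k1: "1 < k" "0 < k" using T k by (auto simp: S_def)
  have k11: "(1::nat) \<le> 1" by simp
  define Sx where "Sx = s 0 S" define St where "St = s 1 S"
  define Sxt where "Sxt = s 1 Sx" define Stx where "Stx = s 0 St"
  define Sxtx where "Sxtx = s 0 Sxt" define Stxt where "Stxt = s 1 Stx"
  define top where "top = s 0 Stxt"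
  note defs = Sx_def St_def Sxt_def Stx_def Sxtx_def Stxt_def
  have st: "Sx \<in> states" "St \<in> states" "Sxt \<in> states" "Stx \<in> states" "Sxtx \<in> states" "Stxt \<in> states"
    unfolding defs using S k1 by (auto intro!: s_state)
  have top': "s 1 Sxtx = top"
    unfolding top_def defs by (rule s_braid0[OF S(1) k, symmetric])
  define u v where uv: "u = co S 1" "v = co S 2"
  have nz: "u \<noteq> 0" using co_nonzero[OF S] by (simp add: uv)
  have vu: "v \<noteq> u" using co_neq[OF S, of 1] k1 by (simp add: uv numeral_2_eq_2)
  have QT: "eT 1 S' * eT 1 (s 1 S') = 1 - (dT 1 S')\<^sup>2" if "S' \<in> states" "S' \<noteq> None" for S'
    using that quad_t by (cases S') (auto simp: dT_def)
  have QX: "eX S' * eX (s 0 S') = rho4 (co S' 1)" if "S' \<in> states" "S' \<noteq> None" for S'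
    using that quad_x by (cases S') auto
  let ?D = "dX S" and ?d = "dT 1 S" and ?x = "eX S" and ?t = "eT 1 S"
  let ?xt = "eT 1 Sx" and ?tx = "eX St" and ?xtx = "eX Sxt" and ?txt = "eT 1 Stx"
  \<comment> \<open>There is no term at \<open>S\<close>: a closed path of this length returns along
    its own edges, so the two products contribute the same there.\<close>
  have expansion: "app (X * (tau 1 * X * tau 1 + tau 1) - (tau 1 * X * tau 1 + tau 1) * X) (opt_vec S)
    = vscale (?t * (?d * ?D * dX St + dX St * dT 1 St * dX St + ?tx * dT 1 Stx * eX Stx + dX St)
         - ?t * (?D * ?d * ?D + ?D * dX St * dT 1 St + ?D) - ?x * dT 1 Sx * eX Sx * ?t) (opt_vec St)
    + vscale (?x * (?d * ?d * ?D + ?d * dT 1 Sx * dX Sx + ?d) + ?t * dX St * eT 1 St * ?x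
         - ?x * (?D * ?d * dT 1 Sx + dT 1 Sx * dX Sx * dT 1 Sx + ?xt * dX Sxt * eT 1 Sxt + dT 1 Sx))
        (opt_vec Sx)
    + vscale (?x * ?xt * (?d * dX Sxt - ?D * ?d - dT 1 Sx * dX Sx - dX Sxt * dT 1 Sxt - 1)) (opt_vec Sxt)
    + vscale (?t * ?tx * (?d * ?D + dX St * dT 1 St + dT 1 Stx * dX Stx + 1 - ?D * dT 1 Stx)) (opt_vec Stx)
    + vscale (?t * ?tx * ?txt * (dX Stxt - ?D)) (opt_vec Stxt)
    + vscale (?x * ?xt * ?xtx * (?d - dT 1 Sxtx)) (opt_vec Sxtx)
    + vscale (?tx * eX Stxt * ?t * ?txt - ?x * ?xtx * ?xt * eT 1 Sxtx) (opt_vec top)"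
    using tau_act[OF S(1), of 1] X_act[OF S(1)] tau_act[OF st(1), of 1] X_act[OF st(2)]
      X_act[OF st(3)] tau_act[OF st(4), of 1] tau_act[OF st(5), of 1] X_act[OF st(6)]
      X_act_back[OF S(1)] tau_act_back[OF S(1) k1(1)] tau_act_back[OF st(1) k1(1)] X_act_back[OF st(2)] top'
    unfolding app_ops defs[symmetric] top_def[symmetric]
    by (intro poly_mapping_eqI)
      (simp add: app_add app_vscale lookup_add lookup_minus lookup_vscale algebra_simps
        del: opt_vec_simps One_nat_def)
  show ?thesis
  proof (cases "u + v = 0")
    \<comment> \<open>Here \<open>f\<close> would be a division by 0. Neither move is defined at T,
      and each coefficient of the expansion has a factor \<open>?x\<close> or
      \<open>?t\<close>.\<close>
    case True
    then have "Sx = None" "St = None"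
      using opposite_fixed[OF S k] by (simp_all add: uv Sx_def St_def)
    then have "?x = 0" "?t = 0" by (simp_all add: Sx_def St_def)
    then show ?thesis using expansion
      by (simp add: S_def defs top_def mult.assoc del: One_nat_def)
  next
    case False
    define d f where df: "d = 1 / (v - u)" "f = 1 / (u + v)"
    define D where "D = mid + Gx u"
    define E where "E = mid + Gx v"
    have here: "?D = D" "?d = d"
      using dX_eq[OF S] dT_eq[OF S, of 1] k1 by (simp_all add: D_def df uv numeral_2_eq_2)
    have Fx: "?x = 0 \<or> dX Sx = mid - Gx u \<and> dT 1 Sx = f \<and> ?x * eX Sx = rho4 u \<and>
        ?xt * eT 1 Sxt = 1 - f\<^sup>2 \<and> (?xt = 0 \<or> dX Sxt = E \<and> dT 1 Sxt = - f \<and>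
        (?xtx = 0 \<or> dT 1 Sxtx = d))"
    proof (cases "Sx = None")
      case nx: False
      have c: "co Sx 1 = - u" "co Sx 2 = v"
        using co_s0(2,3)[OF S(1)] nx k by (simp_all add: Sx_def uv)
      have 1: "dX Sx = mid - Gx u" using dX_move0[OF S(1)] nx by (simp add: Sx_def uv)
      have 2: "dT 1 Sx = f" using dT_move0[OF S(1) k] nx by (simp add: Sx_def uv df)
      have 3: "?x * eX Sx = rho4 u" using QX[OF S] by (simp add: Sx_def uv)
      have 4: "?xt * eT 1 Sxt = 1 - f\<^sup>2" using QT[OF st(1) nx] 2 by (simp add: Sxt_def)
      have 5: "dX Sxt = E \<and> dT 1 Sxt = - f \<and> (?xtx = 0 \<or> dT 1 Sxtx = d)" if nxt: "Sxt \<noteq> None"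
      proof -
        have c': "co Sxt 1 = v" "co Sxt 2 = - u"
          using co_s[OF st(1) k11 k1(1), of 1] co_s[OF st(1) k11 k1(1), of 2] nxt c k
          by (simp_all add: Sxt_def numeral_2_eq_2)
        have "dX Sxt = E" using dX_eq[OF st(3) nxt] c' by (simp add: E_def)
        moreover have "dT 1 Sxt = - f"
          using dT_swap[OF st(1) k11 k1(1)] nxt 2 by (simp add: Sxt_def)
        moreover have "dT 1 Sxtx = d" if "Sxtx \<noteq> None"
          using dT_move0[OF st(3) k] that c' by (simp add: Sxtx_def df)
        ultimately show ?thesis by (cases "Sxtx = None") (auto simp: Sxtx_def)
      qed
      show ?thesis using 1 2 3 4 5 by (cases "Sxt = None") (auto simp: Sxt_def)
    qed (simp add: Sx_def)
    have Ft: "?t = 0 \<or> dX St = E \<and> dT 1 St = - d \<and> ?t * eT 1 St = 1 - d\<^sup>2 \<and> v \<noteq> 0 \<and>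
        ?tx * eX Stx = rho4 v \<and> (?tx = 0 \<or> dX Stx = mid - Gx v \<and> dT 1 Stx = f \<and>
        (?txt = 0 \<or> dX Stxt = D))"
    proof (cases "St = None")
      case nt: False
      have c: "co St 1 = v" "co St 2 = u"
        using co_s[OF S(1) k11 k1(1), of 1] co_s[OF S(1) k11 k1(1), of 2] nt k
        by (simp_all add: St_def uv numeral_2_eq_2)
      have 1: "dX St = E" using dX_eq[OF st(2) nt] c by (simp add: E_def)
      have 2: "dT 1 St = - d" using dT_swap[OF S(1) k11 k1(1)] nt here by (simp add: St_def)
      have 3: "?t * eT 1 St = 1 - d\<^sup>2" using QT[OF S] here by (simp add: St_def)
      have 4: "?tx * eX Stx = rho4 v" using QX[OF st(2) nt] c by (simp add: Stx_def)
      have 5: "dX Stx = mid - Gx v \<and> dT 1 Stx = f \<and> (?txt = 0 \<or> dX Stxt = D)" if ntx: "Stx \<noteq> None"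
      proof -
        have c': "co Stx 2 = u"
          using co_s0(3)[OF st(2), of 2] ntx c k by (simp add: Stx_def)
        have "dX Stx = mid - Gx v" using dX_move0[OF st(2)] ntx c by (simp add: Stx_def)
        moreover have "dT 1 Stx = f"
          using dT_move0[OF st(2) k] ntx c by (simp add: Stx_def df add.commute)
        moreover have "dX Stxt = D" if "Stxt \<noteq> None"
          using dX_move1[OF st(4) k] that c' by (simp add: Stxt_def D_def)
        ultimately show ?thesis by (cases "Stxt = None") (auto simp: Stxt_def)
      qed
      have "v \<noteq> 0" using co_nonzero[OF st(2) nt] c by simp
      then show ?thesis using 1 2 3 4 5 by (cases "Stx = None") (auto simp: Stx_def)
    qed (simp add: St_def)
    \<comment> \<open>For v = 0 the quotient in \<open>Gx\<close> is 0 by convention, and the claim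
      becomes \<sigma> \<delta> = 0. If \<open>?t\<close> is nonzero, then v is the first content of
      s_1 T and cannot vanish; otherwise s_0 T is defined and \<open>content_zero\<close>
      applies.\<close>
    have gv: "2 * v * Gx v = v * v + \<sigma> * \<delta>" if "?x \<noteq> 0 \<or> ?t \<noteq> 0"
    proof (cases "v = 0")
      case True
      then have "?x \<noteq> 0" using that Ft by blast
      then have "s 0 S \<noteq> None" using eX_None(1)[of S] by blast
      then have "\<sigma> * \<delta> = 0" using content_zero[OF T k] True by (simp add: S_def uv)
      then show ?thesis using True by simp
    qed (rule Gx_mult)
    have bi: "(d - f) * Gx u - (d + f) * Gx v + 1 = 0" if "?x \<noteq> 0 \<or> ?t \<noteq> 0"
      using boundary_identity[OF Gx_mult[OF nz] gv[OF that] vu False] by (simp add: df)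
    have factor_t: "e * A - e * B - C * e = e * (A - B - C)"
      and factor_x: "e * A + B * e - e * C = e * (A + B - C)" for e A B C :: complex
      by (simp_all add: algebra_simps)
    have K1: "?t * (?d * ?D * dX St + dX St * dT 1 St * dX St + ?tx * dT 1 Stx * eX Stx + dX St)
         - ?t * (?D * ?d * ?D + ?D * dX St * dT 1 St + ?D) - ?x * dT 1 Sx * eX Sx * ?t = 0"
    proof (cases "?t = 0")
      case ne: False
      have *: "?tx * dT 1 Stx * eX Stx = f * rho4 v" using Ft ne by auto
      \<comment> \<open>If \<open>?x\<close> is 0, then the quadratic relation makes
        \<open>rho4 u\<close> vanish, so the formula holds even though \<open>dT 1 Sx\<close> may be
        unknown.\<close>
      have **: "?x * dT 1 Sx * eX Sx = f * rho4 u"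
      proof (cases "?x = 0")
        case True
        then show ?thesis using QX[OF S] by (simp add: uv)
      qed (use Fx in auto)
      have "rho4 u - rho4 v = (Gx v)\<^sup>2 - (Gx u)\<^sup>2"
        using Ft ne nz by (simp add: rho4_eq)
      moreover have "(Gx u - Gx v) * ((d - f) * Gx u - (d + f) * Gx v + 1) = 0" using bi ne by simp
      moreover have "d * D * E + E * (- d) * E + f * rho4 v + E - (D * d * D + D * E * (- d) + D) - f * rho4 u
          = - ((Gx u - Gx v) * ((d - f) * Gx u - (d + f) * Gx v + 1))
            - f * (rho4 u - rho4 v - ((Gx v)\<^sup>2 - (Gx u)\<^sup>2))"
        unfolding D_def E_def by (rule boundary_coefficient_t)
      ultimately have "d * D * E + E * (- d) * E + f * rho4 v + E - (D * d * D + D * E * (- d) + D) - f * rho4 u = 0"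
        by simp
      then have "?t * (d * D * E + E * (- d) * E + f * rho4 v + E) - ?t * (D * d * D + D * E * (- d) + D)
          - f * rho4 u * ?t = 0"
        unfolding factor_t by simp
      moreover have "dX St = E" "dT 1 St = - d" using Ft ne by blast+
      ultimately show ?thesis unfolding here * ** by (simp only:)
    qed simp
    have K2: "?x * (?d * ?d * ?D + ?d * dT 1 Sx * dX Sx + ?d) + ?t * dX St * eT 1 St * ?x
         - ?x * (?D * ?d * dT 1 Sx + dT 1 Sx * dX Sx * dT 1 Sx + ?xt * dX Sxt * eT 1 Sxt + dT 1 Sx) = 0"
    proof (cases "?x = 0")
      case ne: False
      have *: "?t * dX St * eT 1 St = (1 - d\<^sup>2) * E"
      proof (cases "?t = 0")
        case True
        then show ?thesis using QT[OF S] here by simp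
      qed (use Ft in auto)
      have **: "?xt * dX Sxt * eT 1 Sxt = (1 - f\<^sup>2) * E"
        using Fx ne by auto
      have "d * d * D + d * f * (mid - Gx u) + d + (1 - d\<^sup>2) * E
          - (D * d * f + f * (mid - Gx u) * f + (1 - f\<^sup>2) * E + f)
          = (d - f) * ((d - f) * Gx u - (d + f) * Gx v + 1)"
        unfolding D_def E_def by (rule boundary_coefficient_x)
      then have "d * d * D + d * f * (mid - Gx u) + d + (1 - d\<^sup>2) * E
          - (D * d * f + f * (mid - Gx u) * f + (1 - f\<^sup>2) * E + f) = 0"
        using bi ne by simp
      then have "?x * (d * d * D + d * f * (mid - Gx u) + d) + (1 - d\<^sup>2) * E * ?x
          - ?x * (D * d * f + f * (mid - Gx u) * f + (1 - f\<^sup>2) * E + f) = 0"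
        unfolding factor_x by simp
      moreover have "dX Sx = mid - Gx u" "dT 1 Sx = f" using Fx ne by blast+
      ultimately show ?thesis unfolding here * ** by (simp only:)
    qed simp
    have K3: "?x * ?xt * (?d * dX Sxt - ?D * ?d - dT 1 Sx * dX Sx - dX Sxt * dT 1 Sxt - 1) = 0"
    proof (cases "?x = 0 \<or> ?xt = 0")
      case ne: False
      then have "dX Sxt = E" "dX Sx = mid - Gx u" "dT 1 Sx = f" "dT 1 Sxt = - f" using Fx by blast+
      then have "?d * dX Sxt - ?D * ?d - dT 1 Sx * dX Sx - dX Sxt * dT 1 Sxt - 1
          = - ((d - f) * Gx u - (d + f) * Gx v + 1)"
        unfolding here D_def E_def by (simp only: boundary_coefficient_xt)
      also have "\<dots> = 0" using bi ne by auto
      finally show ?thesis by (simp only: mult_zero_right)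
    qed auto
    have K4: "?t * ?tx * (?d * ?D + dX St * dT 1 St + dT 1 Stx * dX Stx + 1 - ?D * dT 1 Stx) = 0"
    proof (cases "?t = 0 \<or> ?tx = 0")
      case ne: False
      then have "dX St = E" "dT 1 St = - d" "dX Stx = mid - Gx v" "dT 1 Stx = f" using Ft by blast+
      then have "?d * ?D + dX St * dT 1 St + dT 1 Stx * dX Stx + 1 - ?D * dT 1 Stx
          = (d - f) * Gx u - (d + f) * Gx v + 1"
        unfolding here D_def E_def by (simp only: boundary_coefficient_tx)
      also have "\<dots> = 0" using bi ne by auto
      finally show ?thesis by (simp only: mult_zero_right)
    qed auto
    have K5: "?t * ?tx * ?txt * (dX Stxt - ?D) = 0" using Ft here by fastforce
    have K6: "?x * ?xt * ?xtx * (?d - dT 1 Sxtx) = 0" using Fx here by auto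
    show ?thesis
      using expansion unfolding K1 K2 K3 K4 K5 K6
      by (simp add: S_def defs top_def mult.assoc del: One_nat_def)
  qed
qed

end

section \<open>Partitions and tableaux\<close>

abbreviation grow :: "partn \<Rightarrow> nat \<Rightarrow> partn" where
  "grow \<mu> r \<equiv> \<mu>(r := Suc (\<mu> r))"

lemma partn_antimono:
  assumes "is_partn \<mu>" "1 \<le> r" "r \<le> r'"
  shows "\<mu> r' \<le> \<mu> r"
  using assms(3,1,2)
  by (induction r' rule: dec_induct) (auto simp: is_partn_def intro: order_trans)

lemma partn_content_less:
  assumes "is_partn \<mu>" "1 \<le> r" "r < r'"
  shows "int (\<mu> r') - int r' < int (\<mu> r) - int r"
  using partn_antimono[OF assms(1,2), of r'] assms(3) by simp

lemma grow_partn_iff: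
  assumes "is_partn \<mu>" "1 \<le> r"
  shows "is_partn (grow \<mu> r) \<longleftrightarrow> r = 1 \<or> \<mu> r < \<mu> (r - 1)"
proof
  assume g: "is_partn (grow \<mu> r)"
  show "r = 1 \<or> \<mu> r < \<mu> (r - 1)"
  proof (cases "r = 1")
    case False
    then have "grow \<mu> r (Suc (r - 1)) \<le> grow \<mu> r (r - 1)"
      using g assms(2) unfolding is_partn_def by (metis One_nat_def Suc_leI le_neq_implies_less zero_less_diff)
    then show ?thesis using False assms(2) by (auto split: if_splits)
  qed simp
next
  assume r: "r = 1 \<or> \<mu> r < \<mu> (r - 1)"
  have "finite {i. grow \<mu> r i \<noteq> 0}"
    by (rule finite_subset[of _ "insert r {i. \<mu> i \<noteq> 0}"]) (use assms in \<open>auto simp: is_partn_def\<close>)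
  moreover have "grow \<mu> r (Suc i) \<le> grow \<mu> r i" if "1 \<le> i" for i
    using r that assms unfolding is_partn_def by (cases "Suc i = r") (auto simp: le_SucI)
  ultimately show "is_partn (grow \<mu> r)"
    using assms by (auto simp: is_partn_def)
qed

lemma adds_box_iff:
  "adds_box \<mu> \<nu> \<longleftrightarrow> is_partn \<mu> \<and> is_partn \<nu> \<and> (\<exists>r\<ge>1. \<nu> = grow \<mu> r)"
proof (cases "is_partn \<mu> \<and> is_partn \<nu>")
  case True
  have "(\<exists>B. B \<notin> boxes \<mu> \<and> boxes \<nu> = insert B (boxes \<mu>)) \<longleftrightarrow> (\<exists>r\<ge>1. \<nu> = grow \<mu> r)"
  proof
    assume "\<exists>B. B \<notin> boxes \<mu> \<and> boxes \<nu> = insert B (boxes \<mu>)"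
    then obtain r c where B: "(r, c) \<notin> boxes \<mu>" "boxes \<nu> = insert (r, c) (boxes \<mu>)" by auto
    have mem: "1 \<le> i \<and> 1 \<le> j \<and> j \<le> \<nu> i \<longleftrightarrow> i = r \<and> j = c \<or> 1 \<le> i \<and> 1 \<le> j \<and> j \<le> \<mu> i" for i j
      using B(2) unfolding boxes_def by (auto simp: set_eq_iff)
    have r: "1 \<le> r" "1 \<le> c" "\<mu> r < c" using mem[of r c] B(1) by (auto simp: boxes_def)
    have other: "\<nu> i = \<mu> i" if "i \<noteq> r" "1 \<le> i" for i
      using mem[of i "\<nu> i"] mem[of i "\<mu> i"] that by (cases "\<nu> i"; cases "\<mu> i") auto
    have "\<nu> r = Suc (\<mu> r)"
      using mem[of r c] mem[of r "Suc (\<mu> r)"] mem[of r "Suc (Suc (\<mu> r))"] r by auto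
    then have "\<nu> = grow \<mu> r"
      using other True r(1) by (auto simp: fun_eq_iff is_partn_def) (metis Suc_leI neq0_conv)
    then show "\<exists>r\<ge>1. \<nu> = grow \<mu> r" using r by blast
  next
    assume "\<exists>r\<ge>1. \<nu> = grow \<mu> r"
    then obtain r where r: "1 \<le> r" "\<nu> = grow \<mu> r" by blast
    then have "(r, Suc (\<mu> r)) \<notin> boxes \<mu>" "boxes \<nu> = insert (r, Suc (\<mu> r)) (boxes \<mu>)"
      by (auto simp: boxes_def split: if_splits)
    then show "\<exists>B. B \<notin> boxes \<mu> \<and> boxes \<nu> = insert B (boxes \<mu>)" by blast
  qed
  then show ?thesis by (simp add: adds_box_def)
qed (auto simp: adds_box_def)

lemma added_box_grow: "1 \<le> r \<Longrightarrow> added_box \<mu> (grow \<mu> r) = (r, Suc (\<mu> r))"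
proof -
  assume "1 \<le> r"
  then have "boxes (grow \<mu> r) - boxes \<mu> = {(r, Suc (\<mu> r))}"
    by (auto simp: boxes_def split: if_splits)
  then show ?thesis by (simp add: added_box_def)
qed

lemma boxes_subset_iff:
  "boxes \<mu> \<subseteq> boxes \<nu> \<longleftrightarrow> (\<forall>r\<ge>1. \<mu> r \<le> \<nu> r)"
proof
  assume s: "boxes \<mu> \<subseteq> boxes \<nu>"
  have "\<mu> r \<le> \<nu> r" if "1 \<le> r" for r
    using subsetD[OF s, of "(r, \<mu> r)"] that by (cases "\<mu> r = 0") (auto simp: boxes_def)
  then show "\<forall>r\<ge>1. \<mu> r \<le> \<nu> r" by blast
qed (auto simp: boxes_def intro: order_trans)

lemma finite_boxes: "is_partn \<mu> \<Longrightarrow> finite (boxes \<mu>)"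
proof -
  assume "is_partn \<mu>"
  then have "finite (Sigma {r. \<mu> r \<noteq> 0} (\<lambda>r. {1..\<mu> r}))" by (auto simp: is_partn_def)
  moreover have "boxes \<mu> \<subseteq> Sigma {r. \<mu> r \<noteq> 0} (\<lambda>r. {1..\<mu> r})" by (auto simp: boxes_def)
  ultimately show ?thesis by (rule rev_finite_subset)
qed

text \<open>\<open>zc \<mu> r\<close> is the content of the box that \<open>grow \<mu> r\<close> adds to \<open>\<mu>\<close>.\<close>

definition zc :: "partn \<Rightarrow> nat \<Rightarrow> int" where
  "zc \<mu> r = int (\<mu> r) + 1 - int r"

text \<open>A diagonal meets the outer rim of a partition once: the contents of the next free
  positions decrease strictly from row to row.\<close>

lemma zc_inj:
  assumes "is_partn \<mu>" "1 \<le> r" "1 \<le> r'" "zc \<mu> r = zc \<mu> r'"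
  shows "r = r'"
  using partn_content_less[OF assms(1,2), of r'] partn_content_less[OF assms(1,3), of r] assms(4)
  unfolding zc_def by (cases r r' rule: linorder_cases) auto

text \<open>The content difference of two successive boxes reveals their position: +1 is the right
  neighbour, -1 the box directly below, and in all other cases the boxes are independent and the
  second can be added first.\<close>

lemma two_steps:
  assumes \<mu>: "is_partn \<mu>" "is_partn (grow \<mu> r)" "is_partn (grow (grow \<mu> r) r')"
    and r: "1 \<le> r" "1 \<le> r'"
  shows "zc (grow \<mu> r) r' \<noteq> zc \<mu> r"
    and "zc (grow \<mu> r) r' = zc \<mu> r + 1 \<Longrightarrow> r' = r"
    and "zc (grow \<mu> r) r' = zc \<mu> r - 1 \<Longrightarrow> r' = Suc r \<and> \<mu> r' = \<mu> r"
    and "zc (grow \<mu> r) r' \<noteq> zc \<mu> r + 1 \<Longrightarrow> zc (grow \<mu> r) r' \<noteq> zc \<mu> r - 1 \<Longrightarrow>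
      r' \<noteq> r \<and> is_partn (grow \<mu> r')"
proof -
  have hi: "\<mu> r' \<le> \<mu> r" if "r < r'"
    using partn_antimono[OF \<mu>(1) r(1)] that by simp
  have lo: "Suc (\<mu> r) \<le> \<mu> r'" if "r' < r"
    using partn_antimono[OF \<mu>(2) r(2), of r] that by simp
  show "zc (grow \<mu> r) r' \<noteq> zc \<mu> r"
    using hi lo by (cases r r' rule: linorder_cases) (auto simp: zc_def)
  show "zc (grow \<mu> r) r' = zc \<mu> r + 1 \<Longrightarrow> r' = r"
    using hi lo by (cases r r' rule: linorder_cases) (auto simp: zc_def)
  show "zc (grow \<mu> r) r' = zc \<mu> r - 1 \<Longrightarrow> r' = Suc r \<and> \<mu> r' = \<mu> r"
    using hi lo by (cases r r' rule: linorder_cases) (auto simp: zc_def)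
  assume n: "zc (grow \<mu> r) r' \<noteq> zc \<mu> r + 1" "zc (grow \<mu> r) r' \<noteq> zc \<mu> r - 1"
  then have "r' \<noteq> r" by (auto simp: zc_def)
  moreover have "is_partn (grow \<mu> r')"
    unfolding grow_partn_iff[OF \<mu>(1) r(2)]
    using \<mu>(3) n(2) \<open>r' \<noteq> r\<close> hi r
    unfolding grow_partn_iff[OF \<mu>(2) r(2)] by (auto simp: zc_def split: if_splits)
  ultimately show "r' \<noteq> r \<and> is_partn (grow \<mu> r')" ..
qed

text \<open>Before the next box of the same diagonal can be added, both the right and the lower
  neighbour of the first must be present, and a single step lies in between.\<close>

lemma three_steps:
  assumes \<mu>: "is_partn \<mu>" "is_partn (grow \<mu> r)" "is_partn (grow (grow \<mu> r) r')"
      "is_partn (grow (grow (grow \<mu> r) r') r'')"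
    and r: "1 \<le> r" "1 \<le> r'" "1 \<le> r''"
  shows "zc (grow (grow \<mu> r) r') r'' \<noteq> zc \<mu> r"
proof (cases r r'' rule: linorder_cases)
  case less
  have "\<mu> r'' \<le> \<mu> r" using partn_antimono[OF \<mu>(1) r(1)] less by simp
  moreover have "grow (grow (grow \<mu> r) r') r'' r'' \<le> grow (grow (grow \<mu> r) r') r'' r"
    using partn_antimono[OF \<mu>(4) r(1), of r''] less by linarith
  ultimately show ?thesis using less by (auto simp: zc_def split: if_splits)
next
  case equal
  then show ?thesis by (auto simp: zc_def)
next
  case greater
  have "grow \<mu> r r \<le> grow \<mu> r r''" using partn_antimono[OF \<mu>(2) r(3), of r] greater by linarith
  then show ?thesis using greater by (auto simp: zc_def)
qed

text \<open>The rows after p are complements of the first q rows, so their monotonicity is that of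
  the first q. The junctions at q and p follow from the bound on row q.\<close>

lemma P0_iff:
  assumes "q \<le> p" "1 \<le> q"
  shows "\<mu> \<in> \<P> a b p q 0 \<longleftrightarrow> \<mu> 0 = 0 \<and> (\<forall>r > p + q. \<mu> r = 0) \<and> (\<forall>r \<in> {q+1..p}. \<mu> r = a) \<and>
    \<mu> q \<ge> max a b \<and> (\<forall>r \<in> {1..q}. \<mu> r + \<mu> (p + q - r + 1) = a + b) \<and>
    (\<forall>r. 1 \<le> r \<and> r < q \<longrightarrow> \<mu> (Suc r) \<le> \<mu> r)" (is "_ \<longleftrightarrow> ?R")
proof
  assume "\<mu> \<in> \<P> a b p q 0"
  then show ?R by (auto simp: is_partn_def)
next
  assume R: ?R
  have sym: "\<mu> r + \<mu> (p + q - r + 1) = a + b" if "1 \<le> r" "r \<le> q" for r using R that by simp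
  have "\<mu> (Suc r) \<le> \<mu> r" if r: "1 \<le> r" for r
  proof -
    consider "r < q" | "r = q" "q < p" | "r = q" "q = p" | "q < r" "r < p" | "q < r" "r = p"
      | "p < r" "r < p + q" | "p + q \<le> r" using assms r by linarith
    then show ?thesis
    proof cases
      case 1 then show ?thesis using R r by blast
    next
      case 2 then show ?thesis using R by auto
    next
      case 3 then show ?thesis using R sym[of q] assms by auto
    next
      case 4 then show ?thesis using R by auto
    next
      case 5 then show ?thesis using R sym[of q] assms by auto
    next
      case 6
      define i where "i = p + q - r"
      have i: "1 \<le> i" "i < q" "r = p + q - Suc i + 1" "Suc r = p + q - i + 1" using 6 by (auto simp: i_def)
      have "\<mu> (Suc i) \<le> \<mu> i" using R i by blast
      then show ?thesis using sym[of i] sym[of "Suc i"] i by simp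
    next
      case 7 then show ?thesis using R by auto
    qed
  qed
  moreover have "finite {r. \<mu> r \<noteq> 0}"
  proof (rule finite_subset)
    show "{r. \<mu> r \<noteq> 0} \<subseteq> {..p+q}" using R by (metis (mono_tags) atMost_iff mem_Collect_eq not_le subsetI)
  qed simp
  ultimately have "is_partn \<mu>" using R unfolding is_partn_def by blast
  then show "\<mu> \<in> \<P> a b p q 0" using R by simp
qed

text \<open>The four values are the contents of the positions (1, a+b+1), (p+q+1, 1), (q+1, a+1) and
  (p+1, b+1), the corners of the shapes in \<open>\<P>\<close> at level 0.\<close>

lemma exceptional_iff:
  "exceptional a b p q (of_int z - half_shift a b p q) \<longleftrightarrow>
     z = int a + int b \<or> z = - int p - int q \<or> z = int a - int q \<or> z = int b - int p"
proof -
  have e: "of_int z - half_shift a b p q = w / 2 \<longleftrightarrow> of_int (2 * z) = w + (of_nat a - of_nat p + of_nat b - of_nat q)"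
    for w :: complex
  proof -
    have h: "of_nat a - of_nat p + of_nat b - of_nat q = 2 * half_shift a b p q"
      by (simp add: half_shift_def)
    show ?thesis unfolding h by (simp add: divide_eq_eq eq_divide_eq algebra_simps)
  qed
  have i: "of_int (2 * z) = (of_int w :: complex) \<longleftrightarrow> 2 * z = w" for w by (rule of_int_eq_iff)
  have "exceptional a b p q (of_int z - half_shift a b p q) \<longleftrightarrow>
     2 * z = (int a + int p) + (int b + int q) + (int a - int p + int b - int q) \<or>
     2 * z = (int a + int p) - (int b + int q) + (int a - int p + int b - int q) \<or>
     2 * z = - (int a + int p) + (int b + int q) + (int a - int p + int b - int q) \<or>
     2 * z = - (int a + int p) - (int b + int q) + (int a - int p + int b - int q)"
    unfolding exceptional_def e i[symmetric] by (simp add: algebra_simps eq_neg_iff_add_eq_0)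
  also have "\<dots> \<longleftrightarrow> z = int a + int b \<or> z = int a - int q \<or> z = int b - int p \<or> z = - int p - int q"
    by (intro arg_cong2[where f = "(\<or>)"]) auto
  finally show ?thesis by blast
qed

lemma exceptional_exc:
  assumes "\<sigma> = (of_nat (a + p) + of_nat (b + q)) / 2" "\<delta> = (of_nat (a + p) - of_nat (b + q)) / 2"
  shows "exceptional a b p q u \<longleftrightarrow> exc \<sigma> \<delta> u"
  unfolding exceptional_def exc_def assms by (auto simp: field_simps)

section \<open>Starting partitions and the boxes that can be added to them\<close>

locale boundary_data =
  fixes a b p q :: nat
  assumes pos: "0 < a" "0 < b" "0 < p" "0 < q" and qp: "q \<le> p"
begin

abbreviation P0 :: "partn set" where "P0 \<equiv> \<P> a b p q 0"

abbreviation opp :: "nat \<Rightarrow> nat" where "opp r \<equiv> p + q + 1 - r"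

text \<open>The box gained in row r is paid for in the complementary row, which keeps the row sum a
  + b. The truncated subtraction is a true one in the generic case, where that row is shown to be
  nonempty.\<close>

definition partner :: "nat \<Rightarrow> partn \<Rightarrow> partn" where
  "partner r \<mu> = \<mu>(r := Suc (\<mu> r), opp r := \<mu> (opp r) - 1)"

definition generic :: "int \<Rightarrow> bool" where
  "generic z \<longleftrightarrow> z \<noteq> int a + int b \<and> z \<noteq> - int p - int q \<and> z \<noteq> int a - int q \<and> z \<noteq> int b - int p"

lemma P0_facts:
  assumes "\<mu> \<in> P0"
  shows "is_partn \<mu>" "\<mu> 0 = 0" "p + q < r \<Longrightarrow> \<mu> r = 0" "q < r \<Longrightarrow> r \<le> p \<Longrightarrow> \<mu> r = a"
    "max a b \<le> \<mu> q" "1 \<le> r \<Longrightarrow> r \<le> q \<Longrightarrow> \<mu> r + \<mu> (opp r) = a + b"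
    "p < r \<Longrightarrow> r \<le> p + q \<Longrightarrow> \<mu> r + \<mu> (opp r) = a + b"
    "1 \<le> r \<Longrightarrow> r \<le> q \<Longrightarrow> max a b \<le> \<mu> r" "p < r \<Longrightarrow> r \<le> p + q \<Longrightarrow> \<mu> r \<le> min a b"
proof -
  show 1: "is_partn \<mu>" using assms by simp
  show "\<mu> 0 = 0" "p + q < r \<Longrightarrow> \<mu> r = 0" "q < r \<Longrightarrow> r \<le> p \<Longrightarrow> \<mu> r = a"
    using assms by (auto simp: is_partn_def)
  show q: "max a b \<le> \<mu> q" using assms by simp
  have s: "\<mu> r + \<mu> (opp r) = a + b" if "1 \<le> r" "r \<le> q" for r
  proof -
    have "p + q - r + 1 = opp r" using that by simp
    moreover have "\<mu> r + \<mu> (p + q - r + 1) = a + b" using assms that by auto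
    ultimately show ?thesis by simp
  qed
  show "1 \<le> r \<Longrightarrow> r \<le> q \<Longrightarrow> \<mu> r + \<mu> (opp r) = a + b" by (rule s)
  show s': "\<mu> r + \<mu> (opp r) = a + b" if "p < r" "r \<le> p + q" for r
  proof -
    have o: "1 \<le> opp r" "opp r \<le> q" "opp (opp r) = r" using that by auto
    show ?thesis using s[OF o(1,2)] unfolding o(3) by simp
  qed
  have m: "max a b \<le> \<mu> r" if "1 \<le> r" "r \<le> q" for r
    using partn_antimono[OF 1 that] q by (rule order_trans[rotated])
  then show "1 \<le> r \<Longrightarrow> r \<le> q \<Longrightarrow> max a b \<le> \<mu> r" .
  show "\<mu> r \<le> min a b" if "p < r" "r \<le> p + q"
  proof -
    have "max a b \<le> \<mu> (opp r)" using that by (intro m) auto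
    then show ?thesis using s'[OF that] by linarith
  qed
qed

lemma grow_above:
  assumes "is_partn (grow \<mu> r)" "1 < r"
  shows "\<mu> r < \<mu> (r - 1)"
proof -
  have "r - 1 \<noteq> r" "1 \<le> r - 1" using assms(2) by auto
  then show ?thesis using partn_antimono[OF assms(1), of "r - 1" r] by simp
qed

text \<open>The boxes that can be added to \<open>\<mu> \<in> \<P>\<^sub>0\<close>, row by row: the non-generic contents are exactly
  those of the boxes whose addition cannot be compensated in row \<open>opp r\<close>.\<close>

lemma addable_cases:
  assumes \<mu>: "\<mu> \<in> P0" and g: "is_partn (grow \<mu> r)" and r: "1 \<le> r"
  obtains (top) "r \<le> q" "max a b \<le> \<mu> r" "\<mu> r < a + b"
  | (corner) "r = 1" "\<mu> 1 = a + b"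
  | (middle) "r = Suc q" "q < p" "\<mu> r = a" "a < \<mu> q"
  | (bottom) "p < r" "r \<le> p + q" "max a b < \<mu> (opp r)" "\<mu> r < min a b"
  | (join) "r = Suc p" "\<mu> r = min a b" "\<mu> q = max a b" "q = p \<Longrightarrow> min a b < max a b" "q < p \<Longrightarrow> b < a"
  | (new) "r = p + q + 1" "0 < \<mu> (p + q)" "\<mu> r = 0"
proof -
  note f = P0_facts[OF \<mu>]
  consider "r \<le> q" | "q < r" "r \<le> p" | "p < r" "r \<le> p + q" | "p + q < r" by linarith
  then show ?thesis
  proof cases
    case 1
    show ?thesis
    proof (cases "\<mu> r < a + b")
      case True then show ?thesis using 1 f(8) r top by blast
    next
      case False
      then have e: "\<mu> r = a + b" using f(6)[OF r 1] by simp
      have "r = 1"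
      proof (rule ccontr)
        assume "r \<noteq> 1"
        then have "\<mu> r < \<mu> (r - 1)" using grow_above[OF g] r by simp
        moreover have "1 \<le> r - 1" "r - 1 \<le> q" using \<open>r \<noteq> 1\<close> r 1 by auto
        then have "\<mu> (r - 1) \<le> a + b" using f(6)[of "r - 1"] by linarith
        ultimately show False using e by simp
      qed
      then show ?thesis using e corner by blast
    qed
  next
    case 2
    have l: "\<mu> r < \<mu> (r - 1)" using 2 pos by (intro grow_above[OF g]) auto
    have e: "\<mu> r = a" using f(4) 2 by blast
    have "r = Suc q"
    proof (rule ccontr)
      assume "r \<noteq> Suc q"
      then have "\<mu> (r - 1) = a" using f(4)[of "r - 1"] 2 by auto
      then show False using l e by simp
    qed
    then show ?thesis using 2 e l middle by simp
  next
    case 3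
    have l: "\<mu> r < \<mu> (r - 1)" using 3 pos by (intro grow_above[OF g]) auto
    have o: "1 \<le> opp r" "opp r \<le> q" using 3 by auto
    have m: "max a b \<le> \<mu> (opp r)" using f(8)[OF o] .
    have e: "\<mu> r + \<mu> (opp r) = a + b" using f(7) 3 by blast
    show ?thesis
    proof (cases "max a b < \<mu> (opp r)")
      case True then show ?thesis using 3 e bottom by linarith
    next
      case False
      then have E: "\<mu> (opp r) = max a b" "\<mu> r = min a b" using m e by linarith+
      have rp: "r = Suc p"
      proof (rule ccontr)
        assume "r \<noteq> Suc p"
        then have "\<mu> (r - 1) \<le> min a b" using 3 by (intro f(9)) auto
        then show False using l E by linarith
      qed
      then have "\<mu> q = max a b" using E by simp
      moreover have "min a b < \<mu> p" using l E rp by simp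
      moreover have "b < a" if "q < p"
        using f(4)[of p] that \<open>min a b < \<mu> p\<close> by (simp add: min_def split: if_splits)
      moreover have "min a b < max a b" if "q = p"
        using \<open>min a b < \<mu> p\<close> \<open>\<mu> q = max a b\<close> that by simp
      ultimately show ?thesis using join[OF rp E(2)] by blast
    qed
  next
    case 4
    have l: "\<mu> r < \<mu> (r - 1)" using 4 pos by (intro grow_above[OF g]) auto
    have "r = p + q + 1"
    proof (rule ccontr)
      assume "r \<noteq> p + q + 1"
      then have "\<mu> (r - 1) = 0" using 4 by (intro f(3)) auto
      then show False using l by simp
    qed
    then show ?thesis using l new f(3)[OF 4] by simp
  qed
qed

text \<open>In the case \<open>top\<close> the content lies strictly between max (a-q) (b-p) and
  a+b, in the case \<open>bottom\<close> strictly between -p-q and min (a-q) (b-p). In each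
  remaining case it equals one of the four excluded values.\<close>

lemma generic_iff:
  assumes \<mu>: "\<mu> \<in> P0" and g: "is_partn (grow \<mu> r)" and r: "1 \<le> r"
  shows "generic (zc \<mu> r) \<longleftrightarrow> (r \<le> q \<and> \<mu> r < a + b) \<or> (p < r \<and> r \<le> p + q \<and> max a b < \<mu> (opp r))"
  using \<mu> g r
proof (cases rule: addable_cases)
  case top
  then show ?thesis using qp r by (auto simp: generic_def zc_def)
next
  case corner
  then show ?thesis using qp pos by (auto simp: generic_def zc_def)
next
  case middle
  then show ?thesis by (auto simp: generic_def zc_def)
next
  case bottom
  then show ?thesis using qp by (auto simp: generic_def zc_def)
next
  case join
  then have "opp r = q" by simp
  moreover have "zc \<mu> r = int a - int q \<or> zc \<mu> r = int b - int p"
    using join qp by (cases "q = p") (auto simp: zc_def min_def max_def split: if_splits)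
  ultimately show ?thesis using join qp by (auto simp: generic_def)
next
  case new
  then show ?thesis by (auto simp: generic_def zc_def)
qed

text \<open>Half a turn of the rectangle with p+q rows and a+b columns exchanges the new box of row
  r with the last box of row \<open>opp r\<close>. So their contents add up to a+b-p-q, twice the
  shift, and s_0 negates the shifted content.\<close>

lemma partner:
  assumes \<mu>: "\<mu> \<in> P0" and g: "is_partn (grow \<mu> r)" and r: "1 \<le> r" and z: "generic (zc \<mu> r)"
  shows "partner r \<mu> \<in> P0" "grow \<mu> r = grow (partner r \<mu>) (opp r)" "1 \<le> opp r" "opp r \<noteq> r"
    "1 \<le> \<mu> (opp r)" "zc (partner r \<mu>) (opp r) = int a + int b - int p - int q - zc \<mu> r"
proof -
  note f = P0_facts[OF \<mu>]
  have R: "(r \<le> q \<and> \<mu> r < a + b) \<or> (p < r \<and> r \<le> p + q \<and> max a b < \<mu> (opp r))"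
    using generic_iff[OF \<mu> g r] z by simp
  then show o1: "1 \<le> opp r" and one: "opp r \<noteq> r" using qp by auto
  have sum: "\<mu> r + \<mu> (opp r) = a + b" using R f(6)[OF r] f(7) by blast
  show o2: "1 \<le> \<mu> (opp r)" using R sum by auto
  have ev: "partner r \<mu> r = Suc (\<mu> r)" "partner r \<mu> (opp r) = \<mu> (opp r) - 1"
    "i \<noteq> r \<Longrightarrow> i \<noteq> opp r \<Longrightarrow> partner r \<mu> i = \<mu> i" for i
    using one by (auto simp: partner_def)
  show "grow \<mu> r = grow (partner r \<mu>) (opp r)"
    using o2 one by (auto simp: partner_def fun_eq_iff)
  show "zc (partner r \<mu>) (opp r) = int a + int b - int p - int q - zc \<mu> r"
    using ev(2) o2 sum R r unfolding zc_def by auto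
  have 1: "1 \<le> q" using pos by simp
  have low: "max a b \<le> partner r \<mu> q"
  proof (cases "opp r = q")
    case True
    then show ?thesis using R ev(2) qp r by auto
  next
    case False
    then show ?thesis using f(5) ev(1) ev(3)[of q] by (cases "q = r") auto
  qed
  have sums: "partner r \<mu> i + partner r \<mu> (p + q - i + 1) = a + b" if i: "1 \<le> i" "i \<le> q" for i
  proof -
    have oi: "p + q - i + 1 = opp i" using i by simp
    consider "i = r" | "i = opp r" | "i \<noteq> r" "i \<noteq> opp r" by blast
    then show ?thesis
    proof cases
      case 1
      then show ?thesis unfolding oi using ev(1,2) sum o2 by simp
    next
      case 2
      then have "opp i = r" using R r i qp by auto
      then show ?thesis unfolding oi using 2 ev(1,2) sum o2 by simp
    next
      case 3
      then have "opp i \<noteq> r" "opp i \<noteq> opp r" using i R r qp by auto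
      then show ?thesis unfolding oi using 3 ev(3) f(6)[OF i] by simp
    qed
  qed
  have mono: "partner r \<mu> (Suc i) \<le> partner r \<mu> i" if i: "1 \<le> i" "i < q" for i
  proof -
    have base: "\<mu> (Suc i) \<le> \<mu> i" using partn_antimono[OF f(1) i(1)] by simp
    consider "r \<le> q" | "p < r" "r \<le> p + q" using R by blast
    then show ?thesis
    proof cases
      case 1
      then have "opp r > q" using qp by simp
      then have "partner r \<mu> j = grow \<mu> r j" if "j \<le> q" for j using that by (auto simp: partner_def)
      then show ?thesis using partn_antimono[OF g i(1), of "Suc i"] i by simp
    next
      case 2
      have nr: "i \<noteq> r" "Suc i \<noteq> r" using i 2 qp by auto
      show ?thesis
      proof (cases "i = opp r")
        case True
        \<comment> \<open>A box may leave row i because one may enter the complementary row r: the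
          complement of this inequality is the strict decrease from row i to row i+1.\<close>
        have "\<mu> r < \<mu> (r - 1)" using 2 pos by (intro grow_above[OF g]) auto
        moreover have "\<mu> (r - 1) + \<mu> (Suc i) = a + b"
        proof -
          have o: "p < r - 1" "r - 1 \<le> p + q" "opp (r - 1) = Suc i" using True i 2 by auto
          show ?thesis using f(7)[OF o(1,2)] unfolding o(3) .
        qed
        moreover have "\<mu> i = \<mu> (opp r)" using True by simp
        ultimately have "\<mu> (Suc i) < \<mu> i" using sum by linarith
        moreover have "partner r \<mu> i = \<mu> i - 1" using ev(2) True by simp
        moreover have "partner r \<mu> (Suc i) = \<mu> (Suc i)" using ev(3) nr True by simp
        ultimately show ?thesis by linarith
      next
        case False
        then show ?thesis using nr ev(2) ev(3)[of i] ev(3)[of "Suc i"] base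
          by (cases "Suc i = opp r") auto
      qed
    qed
  qed
  have out: "partner r \<mu> i = \<mu> i" if "i = 0 \<or> p + q < i \<or> (q < i \<and> i \<le> p)" for i
    using that R r qp by (intro ev(3)) auto
  show "partner r \<mu> \<in> P0"
    unfolding P0_iff[OF qp 1]
    using low sums mono out f(2,3,4) by auto
qed

text \<open>Rows other than r cannot grow, hence by the complement rule none but
  \<open>opp r\<close> can shrink. So \<nu> differs from \<mu> in these two rows only, and row r
  must have gained the one box allowed.\<close>

lemma partner_unique:
  assumes \<mu>: "\<mu> \<in> P0" and r: "1 \<le> r" and \<nu>: "\<nu> \<in> P0" "\<nu> \<noteq> \<mu>"
    and sub: "\<And>i. 1 \<le> i \<Longrightarrow> \<nu> i \<le> grow \<mu> r i"
  shows "\<nu> = partner r \<mu>"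
proof -
  note f = P0_facts[OF \<mu>] and f' = P0_facts[OF \<nu>(1)]
  have eq: "\<nu> i = \<mu> i" if i: "1 \<le> i" "i \<noteq> r" "i \<noteq> opp r" for i
  proof -
    consider "i \<le> q" | "q < i" "i \<le> p" | "p < i" "i \<le> p + q" | "p + q < i" by linarith
    then show ?thesis
    proof cases
      case 1
      have "opp i \<noteq> r" "1 \<le> opp i" using i 1 by auto
      then show ?thesis using sub[of i] sub[of "opp i"] i f(6)[OF i(1) 1] f'(6)[OF i(1) 1] by simp
    next
      case 2 then show ?thesis using f(4) f'(4) by simp
    next
      case 3
      have "opp i \<noteq> r" "1 \<le> opp i" using i 3 by auto
      then show ?thesis using sub[of i] sub[of "opp i"] i f(7)[OF 3] f'(7)[OF 3] by simp
    next
      case 4 then show ?thesis using f(3) f'(3) by simp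
    qed
  qed
  have z: "\<nu> 0 = \<mu> 0" using f(2) f'(2) by simp
  consider "r \<le> q" | "q < r" "r \<le> p" | "p < r" "r \<le> p + q" | "p + q < r" by linarith
  then have "(r \<le> q \<or> p < r \<and> r \<le> p + q) \<and> \<nu> r = Suc (\<mu> r)"
  proof cases
    case 1
    then have s: "\<nu> r + \<nu> (opp r) = \<mu> r + \<mu> (opp r)" using f(6) f'(6) r by simp
    have o: "opp r \<noteq> r" "1 \<le> opp r" using 1 qp by auto
    have "\<nu> r \<noteq> \<mu> r"
    proof
      assume e: "\<nu> r = \<mu> r"
      then have "\<nu> i = \<mu> i" for i using eq[of i] z s by (cases "i = 0"; cases "i = r"; cases "i = opp r") auto
      then show False using \<nu>(2) by (simp add: fun_eq_iff)
    qed
    then show ?thesis using 1 s sub[OF r] sub[OF o(2)] o by auto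
  next
    case 2
    have e: "\<nu> r = \<mu> r" using 2 f(4) f'(4) by simp
    have "\<nu> (opp r) = \<mu> (opp r)" using 2 f(4)[of "opp r"] f'(4)[of "opp r"] by auto
    then have "\<nu> i = \<mu> i" for i using eq[of i] z e by (cases "i = 0"; cases "i = r"; cases "i = opp r") auto
    then show ?thesis using \<nu>(2) by (simp add: fun_eq_iff)
  next
    case 3
    then have s: "\<nu> r + \<nu> (opp r) = \<mu> r + \<mu> (opp r)" using f(7) f'(7) by simp
    have o: "opp r \<noteq> r" "1 \<le> opp r" using 3 qp by auto
    have "\<nu> r \<noteq> \<mu> r"
    proof
      assume e: "\<nu> r = \<mu> r"
      then have "\<nu> i = \<mu> i" for i using eq[of i] z s by (cases "i = 0"; cases "i = r"; cases "i = opp r") auto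
      then show False using \<nu>(2) by (simp add: fun_eq_iff)
    qed
    then show ?thesis using 3 s sub[OF r] sub[OF o(2)] o by auto
  next
    case 4
    have e: "\<nu> r = \<mu> r" using 4 f(3) f'(3) by simp
    have "\<nu> (opp r) = \<mu> (opp r)" using 4 z by simp
    then have "\<nu> i = \<mu> i" for i using eq[of i] z e by (cases "i = 0"; cases "i = r"; cases "i = opp r") auto
    then show ?thesis using \<nu>(2) by (simp add: fun_eq_iff)
  qed
  then have R: "r \<le> q \<or> p < r \<and> r \<le> p + q" and s: "\<nu> r = Suc (\<mu> r)" by auto
  have one: "opp r \<noteq> r" using R qp by auto
  have "\<nu> r + \<nu> (opp r) = \<mu> r + \<mu> (opp r)" using R r f(6,7) f'(6,7) by auto
  then have "\<nu> (opp r) = \<mu> (opp r) - 1" using s by simp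
  then show ?thesis using eq z s one
    by (auto simp: fun_eq_iff partner_def) (metis One_nat_def Suc_leI neq0_conv)
qed

end

section \<open>Tableaux, their contents and the moves\<close>

locale boundary_tableaux = boundary_data +
  fixes k :: nat and lam :: partn
  assumes k1: "1 \<le> k" and lam: "lam \<in> \<P> a b p q k"
    and nonzero: "T \<in> tableaux a b p q k lam \<Longrightarrow> shifted_content a b p q T 1 \<noteq> 0"
begin

abbreviation \<T> :: "tableau set" where "\<T> \<equiv> tableaux a b p q k lam"
abbreviation c :: "tableau \<Rightarrow> nat \<Rightarrow> complex" where "c \<equiv> shifted_content a b p q"
abbreviation h :: complex where "h \<equiv> half_shift a b p q"

lemma tableau_facts:
  assumes "T \<in> \<T>"
  shows "length T = Suc k" "T ! k = lam" "T ! 0 \<in> P0" "i < k \<Longrightarrow> is_partn (T ! i)"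
    "i < k \<Longrightarrow> \<exists>r\<ge>1. T ! Suc i = grow (T ! i) r" "i \<le> k \<Longrightarrow> is_partn (T ! i)"
proof -
  show 1: "length T = Suc k" "T ! k = lam" "T ! 0 \<in> P0" using assms by (auto simp: tableaux_def)
  have a: "adds_box (T ! i) (T ! Suc i)" if "i < k" for i using assms that by (auto simp: tableaux_def)
  then show "i < k \<Longrightarrow> is_partn (T ! i)" "i < k \<Longrightarrow> \<exists>r\<ge>1. T ! Suc i = grow (T ! i) r"
    by (auto simp: adds_box_iff)
  show "i \<le> k \<Longrightarrow> is_partn (T ! i)"
    using a[of i] a[of "i - 1"] 1 k1 by (cases "i < k") (auto simp: adds_box_iff)
qed

lemma tableauI:
  assumes "length T = Suc k" "T ! k = lam" "T ! 0 \<in> P0"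
    and step: "\<And>i. i < k \<Longrightarrow> is_partn (T ! i) \<and> is_partn (T ! Suc i) \<and> (\<exists>r\<ge>1. T ! Suc i = grow (T ! i) r)"
  shows "T \<in> \<T>"
proof -
  have a: "adds_box (T ! i) (T ! Suc i)" if "i < k" for i using step[OF that] by (auto simp: adds_box_iff)
  have "T ! i \<in> \<P> a b p q i" if "i \<le> k" for i
    using that
  proof (induction i)
    case (Suc i)
    then show ?case using a[of i] by auto
  qed (use assms in auto)
  then show ?thesis using assms a by (auto simp: tableaux_def)
qed

text \<open>Indexed by the partition that receives the box: the box of step i+1, with content
  c_T(i+1), lies in \<open>row T i\<close>.\<close>

definition row :: "tableau \<Rightarrow> nat \<Rightarrow> nat" where
  "row T i = fst (added_box (T ! i) (T ! Suc i))"

lemma row: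
  assumes "T \<in> \<T>" "i < k"
  shows "1 \<le> row T i" "T ! Suc i = grow (T ! i) (row T i)" "is_partn (grow (T ! i) (row T i))"
    "c T (Suc i) = of_int (zc (T ! i) (row T i)) - h"
proof -
  obtain r where r: "1 \<le> r" "T ! Suc i = grow (T ! i) r" using tableau_facts(5)[OF assms] by blast
  then have e: "row T i = r" by (simp add: row_def added_box_grow)
  show "1 \<le> row T i" "T ! Suc i = grow (T ! i) (row T i)" using r e by auto
  then show "is_partn (grow (T ! i) (row T i))" using tableau_facts(6)[OF assms(1), of "Suc i"] assms by simp
  have "added_box (T ! i) (T ! Suc i) = (r, Suc ((T ! i) r))" using r by (simp add: added_box_grow)
  then show "c T (Suc i) = of_int (zc (T ! i) (row T i)) - h"
    by (simp add: e shifted_content_def content_def zc_def)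
qed

lemma content_of_step:
  assumes "1 \<le> r" "T ! Suc i = grow (T ! i) r"
  shows "c T (Suc i) = of_int (zc (T ! i) r) - h"
  using assms by (simp add: shifted_content_def content_def zc_def added_box_grow)

lemma near_of_int: "near (of_int u - h) (of_int v - h) \<longleftrightarrow> v = u + 1 \<or> v = u - 1"
proof -
  have "near (of_int u - h) (of_int v - h) \<longleftrightarrow> (of_int u :: complex) = of_int (v + 1) \<or> (of_int u :: complex) = of_int (v - 1)"
    by (auto simp: near_def algebra_simps)
  also have "\<dots> \<longleftrightarrow> v = u + 1 \<or> v = u - 1" unfolding of_int_eq_iff by auto
  finally show ?thesis .
qed

lemma consecutive:
  assumes T: "T \<in> \<T>" and i: "Suc i < k"
  shows "c T (Suc (Suc i)) \<noteq> c T (Suc i)"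
    and "near (c T (Suc i)) (c T (Suc (Suc i))) \<or>
      row T (Suc i) \<noteq> row T i \<and> is_partn (grow (T ! i) (row T (Suc i)))"
proof -
  note r = row[OF T, of i] and r' = row[OF T, of "Suc i"]
  have \<mu>: "is_partn (T ! i)" "is_partn (grow (T ! i) (row T i))"
    "is_partn (grow (grow (T ! i) (row T i)) (row T (Suc i)))"
    using tableau_facts(6)[OF T, of i] r r' i by auto
  note st = two_steps[OF \<mu> r(1) r'(1)]
  show "c T (Suc (Suc i)) \<noteq> c T (Suc i)" using st(1) r r' i by simp
  show "near (c T (Suc i)) (c T (Suc (Suc i))) \<or>
      row T (Suc i) \<noteq> row T i \<and> is_partn (grow (T ! i) (row T (Suc i)))"
    using st(4) r r' i by (auto simp: near_of_int)
qed

lemma third_content: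
  assumes T: "T \<in> \<T>" and i: "Suc (Suc i) < k"
  shows "c T (Suc (Suc (Suc i))) \<noteq> c T (Suc i)"
proof -
  note r = row[OF T, of i] and r' = row[OF T, of "Suc i"] and r'' = row[OF T, of "Suc (Suc i)"]
  have "zc (grow (grow (T ! i) (row T i)) (row T (Suc i))) (row T (Suc (Suc i))) \<noteq> zc (T ! i) (row T i)"
    using tableau_facts(6)[OF T, of i] r r' r'' i by (intro three_steps) auto
  then show ?thesis using r r' r'' i by simp
qed

text \<open>Both tableaux end in \<open>lam\<close>. Going backwards, the box removed at each step
  is the last one on its diagonal, and so is determined by its content.\<close>

lemma tableau_eqI:
  assumes T: "T \<in> \<T>" and U: "U \<in> \<T>" and c: "\<And>j. 1 \<le> j \<Longrightarrow> j \<le> k \<Longrightarrow> c T j = c U j"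
  shows "T = U"
proof (rule nth_equalityI)
  show "length T = length U" using tableau_facts(1) T U by simp
  have "T ! i = U ! i" if "i \<le> k" for i
    using that
  proof (induction i rule: inc_induct)
    case base
    then show ?case using tableau_facts(2) T U by simp
  next
    case (step i)
    note r = row[OF T step(2)] and r' = row[OF U step(2)]
    let ?r = "row T i" and ?r' = "row U i"
    have e: "grow (T ! i) ?r = grow (U ! i) ?r'"
      unfolding r(2)[symmetric] r'(2)[symmetric] by (rule step)
    have "zc (T ! i) ?r = zc (U ! i) ?r'" using c[of "Suc i"] r r' step by simp
    \<comment> \<open>A removed box has content one less than the next free position of its row,
      which moves the comparison to the common larger partition.\<close>
    moreover have "zc (grow (T ! i) ?r) ?r = zc (T ! i) ?r + 1" "zc (grow (U ! i) ?r') ?r' = zc (U ! i) ?r' + 1"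
      by (auto simp: zc_def)
    ultimately have "zc (grow (T ! i) ?r) ?r = zc (grow (T ! i) ?r) ?r'" using e by metis
    then have "?r = ?r'" using zc_inj r r' by blast
    then have "(T ! i) l = (U ! i) l" for l using fun_cong[OF e, of l] by (cases "l = ?r") auto
    then show ?case by (simp add: fun_eq_iff)
  qed
  then show "T ! i = U ! i" if "i < length T" for i using that tableau_facts(1)[OF T] by simp
qed

lemma grow_grow_commute: "r \<noteq> r' \<Longrightarrow> grow (grow \<mu> r) r' = grow (grow \<mu> r') r"
  by (auto simp: fun_eq_iff)

lemma switch1_near:
  "near (c T (Suc i)) (c T (Suc (Suc i))) \<Longrightarrow> switch1 a b p q (Suc i) T = None"
  by (simp add: switch1_def near_def)

lemma switch1_adj:
  assumes T: "T \<in> \<T>" and i: "Suc i < k" and n: "\<not> near (c T (Suc i)) (c T (Suc (Suc i)))"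
  defines "U \<equiv> T[Suc i := grow (T ! i) (row T (Suc i))]"
  shows "switch1 a b p q (Suc i) T = Some U" "U \<in> \<T>"
    "\<And>j. j \<le> k \<Longrightarrow> c U j = c T (transpose (Suc i) (Suc (Suc i)) j)"
proof -
  show "switch1 a b p q (Suc i) T = Some U"
    using n by (simp add: switch1_def near_def U_def row_def Let_def)
  note r = row[OF T, of i] and r' = row[OF T, of "Suc i"]
  let ?r = "row T i" and ?r' = "row T (Suc i)"
  have ne: "?r' \<noteq> ?r" and pg: "is_partn (grow (T ! i) ?r')" using consecutive(2)[OF T i] n by auto
  have len: "length T = Suc k" using tableau_facts T by blast
  have nth: "U ! j = (if j = Suc i then grow (T ! i) ?r' else T ! j)" for j
    using len i by (simp add: U_def nth_list_update)
  have up: "T ! Suc (Suc i) = grow (grow (T ! i) ?r') ?r"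
    using r(2) r'(2) i grow_grow_commute[OF ne] by (simp add: fun_upd_def)
  show U: "U \<in> \<T>"
  proof (rule tableauI)
    show "length U = Suc k" "U ! k = lam" "U ! 0 \<in> P0"
      using tableau_facts(1-3)[OF T] i by (auto simp: nth) (simp add: U_def)
    fix j assume j: "j < k"
    consider "j = i" | "j = Suc i" | "j \<noteq> i" "j \<noteq> Suc i" by blast
    then show "is_partn (U ! j) \<and> is_partn (U ! Suc j) \<and> (\<exists>r\<ge>1. U ! Suc j = grow (U ! j) r)"
    proof cases
      case 1
      then show ?thesis using tableau_facts(6)[OF T, of i] pg r'(1) i by (auto simp: nth)
    next
      case 2
      then show ?thesis using tableau_facts(6)[OF T, of "Suc (Suc i)"] pg up r(1) i
        by (auto simp: nth)
    next
      case 3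
      then show ?thesis using tableau_facts(5,6)[OF T] j by (auto simp: nth)
    qed
  qed
  fix j assume j: "j \<le> k"
  have ci: "c U (Suc i) = c T (Suc (Suc i))"
    using content_of_step[of ?r' U i] r'(1,4) r(2) i ne by (auto simp: nth zc_def)
  have cj: "c U (Suc (Suc i)) = c T (Suc i)"
    using content_of_step[of ?r U "Suc i"] r(1,4) i ne up by (auto simp: nth zc_def)
  consider "j = 0" | "j = Suc i" | "j = Suc (Suc i)" | j' where "j = Suc j'" "j' \<noteq> i" "j' \<noteq> Suc i"
    by (cases j) auto
  then show "c U j = c T (transpose (Suc i) (Suc (Suc i)) j)"
  proof cases
    case 1
    then show ?thesis by (simp add: transpose_def shifted_content_def nth)
  next
    case 4
    then show ?thesis by (simp add: transpose_def shifted_content_def nth)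
  qed (use ci cj in simp_all)
qed

end

definition lower_boxes :: "nat \<Rightarrow> partn \<Rightarrow> box set" where
  "lower_boxes p \<mu> = {B \<in> boxes \<mu>. p + 1 \<le> fst B}"

lemma lower_boxes_grow:
  assumes "p < r" "lower_boxes p \<nu> = lower_boxes p (grow \<mu> r)"
  shows "lower_boxes p \<nu> = insert (r, Suc (\<mu> r)) (lower_boxes p \<mu>)"
    "(r, Suc (\<mu> r)) \<notin> lower_boxes p \<mu>"
  unfolding assms(2) using assms(1) by (auto simp: lower_boxes_def boxes_def split: if_splits)

context boundary_tableaux
begin

text \<open>A further box below row p raises content 0 by twice the shifted content of that box. The
  upper rows do not enter, so the starting partition of U may differ there from the grown
  one.\<close>

lemma content_zero_grow:
  assumes r: "p < r" and l: "lower_boxes p (U ! 0) = lower_boxes p (grow (T ! 0) r)"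
    and fin: "is_partn (T ! 0)"
  shows "c U 0 = c T 0 - 2 * h + 2 * of_int (zc (T ! 0) r)"
proof -
  have f: "finite (lower_boxes p (T ! 0))"
    using finite_boxes[OF fin] by (simp add: lower_boxes_def)
  have e: "c V 0 = of_nat (a * b * q) - (of_nat (card (lower_boxes p (V ! 0))) + 1/2) * (2 * h)
     + 2 * (\<Sum>B\<in>lower_boxes p (V ! 0). of_int (content B))" for V
    by (simp add: shifted_content_def Let_def lower_boxes_def)
  show ?thesis
    unfolding e lower_boxes_grow(1)[OF r l] using lower_boxes_grow(2)[OF r l] f
    by (simp add: content_def zc_def algebra_simps)
qed

lemma switch1_exceptional:
  "exceptional a b p q (c T 1) \<Longrightarrow> switch1 a b p q 0 T = None"
  by (simp add: switch1_def)

lemma content_one: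
  assumes "T \<in> \<T>"
  shows "c T 1 = of_int (zc (T ! 0) (row T 0)) - h"
  using row(4)[OF assms, of 0] k1 by simp

lemma exceptional_generic:
  assumes "T \<in> \<T>"
  shows "exceptional a b p q (c T 1) \<longleftrightarrow> \<not> generic (zc (T ! 0) (row T 0))"
  unfolding content_one[OF assms] exceptional_iff generic_def by blast

lemma switch1_zero:
  assumes T: "T \<in> \<T>" and n: "\<not> exceptional a b p q (c T 1)"
  defines "U \<equiv> T[0 := partner (row T 0) (T ! 0)]"
  shows "switch1 a b p q 0 T = Some U" "U \<in> \<T>" "c U 0 = c T 0 + 2 * c T 1" "c U 1 = - c T 1"
    "2 \<le> j \<Longrightarrow> c U j = c T j" "row U 0 = opp (row T 0)"
proof -
  let ?r = "row T 0" and ?\<mu> = "T ! 0"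
  have k0: "0 < k" using k1 by simp
  note r = row[OF T k0]
  note f = tableau_facts[OF T]
  have g: "generic (zc ?\<mu> ?r)" using exceptional_generic[OF T] n by blast
  note pt = partner[OF f(3) r(3,1) g]
  have len: "0 < length T" using f by simp
  have nth: "U ! j = (if j = 0 then partner ?r ?\<mu> else T ! j)" for j
    using len by (simp add: U_def nth_list_update)
  have T1: "T ! 1 = grow ?\<mu> ?r" using r by simp
  have the: "(THE \<nu>. \<nu> \<in> P0 \<and> boxes \<nu> \<subseteq> boxes (T ! 1) \<and> \<nu> \<noteq> ?\<mu>) = partner ?r ?\<mu>"
  proof (rule the_equality)
    have "partner ?r ?\<mu> i \<le> (T ! 1) i" for i
      unfolding T1 pt(2) by simp
    moreover have "partner ?r ?\<mu> \<noteq> ?\<mu>"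
      using pt(4) by (auto simp: partner_def fun_eq_iff split: if_splits)
    ultimately show "partner ?r ?\<mu> \<in> P0 \<and> boxes (partner ?r ?\<mu>) \<subseteq> boxes (T ! 1) \<and> partner ?r ?\<mu> \<noteq> ?\<mu>"
      using pt(1) unfolding boxes_subset_iff by blast
  next
    fix \<nu> assume "\<nu> \<in> P0 \<and> boxes \<nu> \<subseteq> boxes (T ! 1) \<and> \<nu> \<noteq> ?\<mu>"
    then show "\<nu> = partner ?r ?\<mu>"
      unfolding boxes_subset_iff T1 using partner_unique[OF f(3) r(1)] by blast
  qed
  show "switch1 a b p q 0 T = Some U"
    using n the by (simp add: switch1_def U_def)
  have U1: "U ! Suc 0 = grow (U ! 0) (opp ?r)" using pt(2) T1 by (simp add: nth)
  show U: "U \<in> \<T>"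
  proof (rule tableauI)
    show "length U = Suc k" "U ! k = lam" "U ! 0 \<in> P0"
      using f(1,2) pt(1) k0 by (auto simp: nth) (simp add: U_def)
    fix j assume j: "j < k"
    show "is_partn (U ! j) \<and> is_partn (U ! Suc j) \<and> (\<exists>r\<ge>1. U ! Suc j = grow (U ! j) r)"
    proof (cases j)
      case 0
      have "is_partn (U ! 0)" using P0_facts(1)[OF pt(1)] by (simp add: nth)
      moreover have "is_partn (U ! Suc 0)" using f(6)[of 1] k1 by (simp add: nth)
      ultimately show ?thesis using 0 U1 pt(3) by blast
    next
      case (Suc j')
      then show ?thesis using f(5,6) j by (auto simp: nth)
    qed
  qed
  show "row U 0 = opp ?r" using U1 pt(3) by (simp add: row_def added_box_grow)
  have two_h: "of_int (int a + int b - int p - int q) = 2 * h"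
    by (simp add: half_shift_def)
  show c1: "c U 1 = - c T 1"
  proof -
    have "c U 1 = of_int (zc (U ! 0) (opp ?r)) - h"
      using content_of_step[OF pt(3), of U 0] U1 by simp
    also have "zc (U ! 0) (opp ?r) = int a + int b - int p - int q - zc ?\<mu> ?r"
      using pt(6) by (simp add: nth)
    also have "of_int (int a + int b - int p - int q - zc ?\<mu> ?r) - h = 2 * h - of_int (zc ?\<mu> ?r) - h"
      unfolding two_h[symmetric] by simp
    finally show ?thesis using content_one[OF T] by simp
  qed
  show "2 \<le> j \<Longrightarrow> c U j = c T j"
    by (simp add: shifted_content_def nth)
  have R: "?r \<le> q \<and> p < opp ?r \<or> p < ?r \<and> ?r \<le> p + q \<and> opp ?r \<le> q"
    using generic_iff[OF f(3) r(3,1)] g r(1) by auto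
  show "c U 0 = c T 0 + 2 * c T 1"
  \<comment> \<open>Of the two rows r and \<open>opp r\<close> exactly one lies below row p.
    Replacing the starting partition takes a box out of that row in the first case and puts one into
    it in the second; the formula is the same since the two contents are opposite.\<close>
  proof (cases "?r \<le> q")
    case True
    then have o: "p < opp ?r" using R qp by auto
    have "lower_boxes p (T ! 0) = lower_boxes p (grow (U ! 0) (opp ?r))"
      unfolding nth using True o qp pt(2)[symmetric]
      by (auto simp: lower_boxes_def boxes_def)
    from content_zero_grow[OF o this] tableau_facts(6)[OF U, of 0]
    have "c T 0 = c U 0 - 2 * h + 2 * of_int (zc (U ! 0) (opp ?r))" by simp
    moreover have "of_int (zc (U ! 0) (opp ?r)) = c U 1 + h"
      using content_of_step[OF pt(3), of U 0] U1 by simp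
    ultimately show ?thesis using c1 by simp
  next
    case False
    then have r: "p < ?r" "opp ?r \<le> q" using R by auto
    have "lower_boxes p (U ! 0) = lower_boxes p (grow (T ! 0) ?r)"
      unfolding nth using r qp pt(2)
      by (auto simp: lower_boxes_def boxes_def)
    from content_zero_grow[OF r(1) this] tableau_facts(6)[OF T, of 0]
    have "c U 0 = c T 0 - 2 * h + 2 * of_int (zc (T ! 0) ?r)" by simp
    then show ?thesis using content_one[OF T] by simp
  qed
qed

end

context boundary_tableaux
begin

text \<open>Each exceptional content is listed with a condition on \<mu> that its box requires. The
  conditions for a+b and -p-q contradict each other, as do those for a-q and b-p.\<close>

lemma nongeneric_cases:
  assumes \<mu>: "\<mu> \<in> P0" and g: "is_partn (grow \<mu> r)" and r: "1 \<le> r" and n: "\<not> generic (zc \<mu> r)"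
  shows "zc \<mu> r = int a + int b \<and> \<mu> 1 = a + b \<or> zc \<mu> r = int a - int q \<and> a < \<mu> q \<or>
    zc \<mu> r = int b - int p \<and> \<mu> q = a \<or> zc \<mu> r = - int p - int q \<and> 0 < \<mu> (p + q)"
  using \<mu> g r
proof (cases rule: addable_cases)
  case join
  show ?thesis
  proof (cases "a < b")
    case True
    then have "q = p" using join(5) qp by (cases "q = p") auto
    then show ?thesis using join True by (auto simp: zc_def)
  next
    case False
    then show ?thesis using join qp by (auto simp: zc_def max_def min_def)
  qed
qed (use n generic_iff[OF \<mu> g r] in \<open>auto simp: zc_def\<close>)

text \<open>If the contents were not adjacent, both boxes could be added to the starting partition,
  with contents summing to a+b-p-q. The first is exceptional, since otherwise s_0 T would have two
  equal consecutive contents. Then so is the second, and \<open>nongeneric_cases\<close> excludes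
  such a pair.\<close>

lemma opposite_near:
  assumes T: "T \<in> \<T>" and k: "2 \<le> k" and s: "c T 1 + c T 2 = 0"
  shows "near (c T 1) (c T 2)"
proof (rule ccontr)
  assume n: "\<not> near (c T 1) (c T 2)"
  have k': "0 < k" "Suc 0 < k" using k by auto
  note f = tableau_facts[OF T]
  note r = row[OF T k'(1)] and r' = row[OF T k'(2)]
  let ?\<mu> = "T ! 0" and ?r = "row T 0" and ?r' = "row T 1"
  have e: "exceptional a b p q (c T 1)"
  proof (rule ccontr)
    assume ne: "\<not> exceptional a b p q (c T 1)"
    let ?U = "T[0 := partner (row T 0) (T ! 0)]"
    note U = switch1_zero[OF T ne]
    have "c T 2 = - c T 1" using s by (simp add: eq_neg_iff_add_eq_0 add.commute)
    then have "c ?U 1 = c ?U 2" using U(4) U(5)[of 2] by simp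
    then show False using consecutive(1)[OF U(2) k'(2)] by (simp add: numeral_2_eq_2)
  qed
  then have g1: "\<not> generic (zc ?\<mu> ?r)" using exceptional_generic[OF T] by blast
  have rr: "?r' \<noteq> ?r" "is_partn (grow ?\<mu> ?r')"
    using consecutive(2)[OF T k'(2)] n by (auto simp: numeral_2_eq_2)
  have z': "zc (T ! 1) ?r' = zc ?\<mu> ?r'" using r(2) rr(1) by (simp add: zc_def)
  have c2: "c T 2 = of_int (zc ?\<mu> ?r') - h" using r'(4) z' by (simp add: numeral_2_eq_2)
  have two_h: "2 * h = of_int (int a + int b - int p - int q)" by (simp add: half_shift_def)
  have "of_int (zc ?\<mu> ?r + zc ?\<mu> ?r') = (2 * h :: complex)"
  proof -
    have "of_int (zc ?\<mu> ?r) = c T 1 + h" "of_int (zc ?\<mu> ?r') = c T 2 + h"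
      using content_one[OF T] c2 by simp_all
    then have "of_int (zc ?\<mu> ?r + zc ?\<mu> ?r') = (c T 1 + c T 2) + 2 * h" by simp
    then show ?thesis unfolding s by simp
  qed
  then have sum: "zc ?\<mu> ?r + zc ?\<mu> ?r' = int a + int b - int p - int q"
    unfolding two_h of_int_eq_iff .
  then have g2: "\<not> generic (zc ?\<mu> ?r')" using g1 by (auto simp: generic_def)
  have ne: "zc ?\<mu> ?r \<noteq> zc ?\<mu> ?r'"
    using zc_inj[of ?\<mu> ?r ?r'] f(6)[of 0] r(1) r'(1) rr(1) by auto
  have ends: "?\<mu> 1 + ?\<mu> (p + q) = a + b" using P0_facts(6)[OF f(3), of 1] pos by simp
  from nongeneric_cases[OF f(3) r(3,1) g1] nongeneric_cases[OF f(3) rr(2) _ g2] r'(1)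
  show False using sum ne ends pos by auto
qed

text \<open>In T the second box lies directly below the first. In s_0 T the contents are -1 and 0,
  so the same box lies to the right of the first one, in row \<open>opp r\<close>. Hence
  \<open>opp r\<close> = r+1, which forces r = p = q; then rows q and q+1 are equal with sum a+b and
  at least max a b, so a = b.\<close>

lemma zero_second_aux:
  assumes T: "T \<in> \<T>" and k: "2 \<le> k" and c: "c T 1 = 1" "c T 2 = 0"
    and n: "\<not> exceptional a b p q (c T 1)"
  shows "p = q \<and> a = b"
proof -
  have k': "0 < k" "Suc 0 < k" using k by auto
  let ?U = "T[0 := partner (row T 0) (T ! 0)]"
  note U = switch1_zero[OF T n]
  note r = row[OF T k'(1)] and r' = row[OF T k'(2)] and u = row[OF U(2) k'(1)] and u' = row[OF U(2) k'(2)]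
  note f = tableau_facts[OF T] and f' = tableau_facts[OF U(2)]
  have same: "row ?U (Suc 0) = row T (Suc 0)" by (simp add: row_def)
  have zT: "zc (T ! Suc 0) (row T (Suc 0)) = zc (T ! 0) (row T 0) - 1"
  proof -
    have "(of_int (zc (T ! Suc 0) (row T (Suc 0))) :: complex) = of_int (zc (T ! 0) (row T 0) - 1)"
      using c r(4) r'(4) by (simp add: numeral_2_eq_2 algebra_simps)
    then show ?thesis unfolding of_int_eq_iff .
  qed
  have zU: "zc (?U ! Suc 0) (row ?U (Suc 0)) = zc (?U ! 0) (row ?U 0) + 1"
  proof -
    have "c ?U 1 = -1" "c ?U 2 = 0" using U(4) U(5)[of 2] c by auto
    then have "(of_int (zc (?U ! Suc 0) (row ?U (Suc 0))) :: complex) = of_int (zc (?U ! 0) (row ?U 0) + 1)"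
      using u(4) u'(4) by (simp add: numeral_2_eq_2 algebra_simps)
    then show ?thesis unfolding of_int_eq_iff .
  qed
  have r2: "T ! Suc 0 = grow (T ! 0) (row T 0)" and u2: "?U ! Suc 0 = grow (?U ! 0) (row ?U 0)"
    using r(2) u(2) .
  have \<mu>: "is_partn (grow (grow (T ! 0) (row T 0)) (row T (Suc 0)))"
    using r'(3) unfolding r2 .
  have \<nu>: "is_partn (grow (grow (?U ! 0) (row ?U 0)) (row ?U (Suc 0)))"
    using u'(3) unfolding u2 .
  have 1: "row T (Suc 0) = Suc (row T 0) \<and> (T ! 0) (row T (Suc 0)) = (T ! 0) (row T 0)"
    using zT unfolding r2 by (rule two_steps(3)[OF f(6)[OF le0] r(3) \<mu> r(1) r'(1)])
  have "row ?U (Suc 0) = row ?U 0"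
    using zU unfolding u2 by (rule two_steps(2)[OF f'(6)[OF le0] u(3) \<nu> u(1) u'(1)])
  then have 2: "row T (Suc 0) = opp (row T 0)" unfolding same U(6) .
  have "(row T 0 \<le> q \<and> (T ! 0) (row T 0) < a + b) \<or>
      (p < row T 0 \<and> row T 0 \<le> p + q \<and> max a b < (T ! 0) (opp (row T 0)))"
    using generic_iff[OF f(3) r(3,1)] exceptional_generic[OF T] n by blast
  then have e: "p = q" "row T 0 = q" using 1 2 qp by auto
  have "(T ! 0) q + (T ! 0) (opp q) = a + b" using P0_facts(6)[OF f(3), of q] pos by simp
  moreover have "opp q = Suc q" using e by simp
  moreover have "max a b \<le> (T ! 0) q" using P0_facts(5)[OF f(3)] .
  ultimately show ?thesis using 1 e by auto
qed

text \<open>If c_T(1) were not adjacent to c_T(2) = 0, s_1 would bring the content 0 to the front.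
  So c_T(1) is 1 or -1, and s_0 exchanges these two cases.\<close>

lemma zero_second:
  assumes T: "T \<in> \<T>" and k: "2 \<le> k" and c: "c T 2 = 0" and n: "\<not> exceptional a b p q (c T 1)"
  shows "p = q \<and> a = b"
proof -
  have k': "Suc 0 < k" using k by simp
  have near0: "near (c V 1) 0" if V: "V \<in> \<T>" "c V 2 = 0" for V
  proof (rule ccontr)
    assume nn: "\<not> near (c V 1) 0"
    then have "\<not> near (c V (Suc 0)) (c V (Suc (Suc 0)))" using V by (simp add: numeral_2_eq_2)
    from switch1_adj(2)[OF V(1) k' this] switch1_adj(3)[OF V(1) k' this, of 1] k V nonzero
    show False by (auto simp: numeral_2_eq_2)
  qed
  then have "c T 1 = 1 \<or> c T 1 = - 1" using T c by (auto simp: near_def)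
  then show ?thesis
  proof
    assume "c T 1 = 1"
    then show ?thesis using zero_second_aux T k c n by blast
  next
    assume m: "c T 1 = - 1"
    note U = switch1_zero[OF T n]
    let ?U = "T[0 := partner (row T 0) (T ! 0)]"
    have "exceptional a b p q (- c T 1) \<longleftrightarrow> exceptional a b p q (c T 1)"
      using exceptional_exc[OF refl refl, of a b p q] by simp
    then have "\<not> exceptional a b p q (c ?U 1)" using U(4) n by simp
    then show ?thesis using zero_second_aux[OF U(2) k] U(4) U(5)[of 2] m c by simp
  qed
qed

sublocale content_system \<T> k c "switch a b p q"
  "(of_nat (a + p) + of_nat (b + q)) / 2" "(of_nat (a + p) - of_nat (b + q)) / 2"
proof
  note exc = exceptional_exc[OF refl refl, of a b p q]
  show "switch a b p q i None = None" for i by (simp add: switch_def)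
  show "switch a b p q i (Some T) = None" if "1 \<le> i" "near (c T i) (c T (Suc i))" for T i
    using that switch1_near[of T "i - 1"] by (simp add: switch_def)
  show "\<exists>U\<in>\<T>. switch a b p q i (Some T) = Some U \<and> (\<forall>j\<le>k. c U j = c T (transpose i (Suc i) j))"
    if "T \<in> \<T>" "1 \<le> i" "i < k" "\<not> near (c T i) (c T (Suc i))" for T i
    using switch1_adj[OF that(1), of "i - 1"] that by (auto simp: switch_def)
  show "switch a b p q 0 (Some T) = None" if "exc ((of_nat (a + p) + of_nat (b + q)) / 2)
      ((of_nat (a + p) - of_nat (b + q)) / 2) (c T 1)" for T
    using that switch1_exceptional[of T] by (simp add: switch_def exc)
  show "\<exists>U\<in>\<T>. switch a b p q 0 (Some T) = Some U \<and> c U 0 = c T 0 + 2 * c T 1 \<and> c U 1 = - c T 1 \<and>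
      (\<forall>j. 2 \<le> j \<longrightarrow> j \<le> k \<longrightarrow> c U j = c T j)"
    if "T \<in> \<T>" "\<not> exc ((of_nat (a + p) + of_nat (b + q)) / 2)
      ((of_nat (a + p) - of_nat (b + q)) / 2) (c T 1)" for T
    using switch1_zero[OF that(1)] that(2) by (auto simp: switch_def exc)
  show "T = U" if "T \<in> \<T>" "U \<in> \<T>" "\<And>j. 1 \<le> j \<Longrightarrow> j \<le> k \<Longrightarrow> c T j = c U j" for T U
    using tableau_eqI that by blast
  show "c T (Suc i) \<noteq> c T i" if "T \<in> \<T>" "1 \<le> i" "i < k" for T i
    using consecutive(1)[OF that(1), of "i - 1"] that by simp
  show "c T (Suc (Suc i)) \<noteq> c T i" if "T \<in> \<T>" "1 \<le> i" "Suc i < k" for T i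
    using third_content[OF that(1), of "i - 1"] that by simp
  show "c T 1 \<noteq> 0" if "T \<in> \<T>" for T using nonzero that by blast
  show "near (c T 1) (c T 2)" if "T \<in> \<T>" "2 \<le> k" "c T 1 + c T 2 = 0" for T
    using opposite_near that by blast
  show "(of_nat (a + p) + of_nat (b + q)) / 2 * ((of_nat (a + p) - of_nat (b + q)) / 2) = (0 :: complex)"
    if "T \<in> \<T>" "2 \<le> k" "c T 2 = 0" "switch a b p q 0 (Some T) \<noteq> None" for T
  proof -
    have "\<not> exceptional a b p q (c T 1)"
      using that(4) switch1_exceptional[of T] by (auto simp: switch_def)
    then show ?thesis using zero_second[OF that(1-3)] by simp
  qed
  show "1 \<le> k" by (rule k1)
qed

section \<open>Connectedness of the tableaux under the moves\<close>

definition links :: "(tableau \<times> tableau) set" where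
  "links = {(T, U). T \<in> \<T> \<and> (\<exists>i<k. switch a b p q i (Some T) = Some U)}"

lemma links_closed: "(T, U) \<in> links \<Longrightarrow> U \<in> \<T>"
  using s_state[of "Some T"] by (auto simp: links_def) (metis Some_state)

lemma links_star_closed: "(T, U) \<in> links\<^sup>* \<Longrightarrow> T \<in> \<T> \<Longrightarrow> U \<in> \<T>"
  by (induction rule: rtrancl_induct) (auto intro: links_closed)

lemma sym_links: "sym links"
proof (rule symI)
  fix T U assume TU: "(T, U) \<in> links"
  then obtain i where i: "T \<in> \<T>" "i < k" "switch a b p q i (Some T) = Some U" by (auto simp: links_def)
  then have "switch a b p q i (Some U) = Some T" using s_invol[of "Some T" i] by simp
  then show "(U, T) \<in> links" using links_closed[OF TU] i by (auto simp: links_def)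
qed

lemma links_adj:
  assumes "T \<in> \<T>" "Suc i < k" "\<not> near (c T (Suc i)) (c T (Suc (Suc i)))"
  shows "(T, T[Suc i := grow (T ! i) (row T (Suc i))]) \<in> links"
  using switch1_adj(1)[OF assms] assms by (auto simp: links_def switch_def)

lemma untouched_row:
  assumes T: "T \<in> \<T>" and n: "m \<le> n" "n \<le> k" and r: "\<And>j. m \<le> j \<Longrightarrow> j < n \<Longrightarrow> row T j \<noteq> r"
  shows "(T ! n) r = (T ! m) r"
  using n r
proof (induction n rule: dec_induct)
  case (step n)
  then show ?case using row(2)[OF T, of n] by fastforce
qed simp

lemma tableau_mono:
  assumes T: "T \<in> \<T>" and n: "m \<le> n" "n \<le> k"
  shows "(T ! m) r \<le> (T ! n) r"
  using n
proof (induction n rule: dec_induct)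
  case (step n)
  then show ?case using row(2)[OF T, of n] by (auto intro: le_SucI)
qed simp

text \<open>The box of row \<open>r\<close> can be swapped down, because no box added in between is adjacent to it.\<close>

lemma move_down:
  assumes "T \<in> \<T>" "m \<le> l" "l < k" "row T l = r" "\<And>j. m \<le> j \<Longrightarrow> j < l \<Longrightarrow> row T j \<noteq> r"
    and "is_partn (grow (T ! m) r)"
  shows "\<exists>U. (T, U) \<in> links\<^sup>* \<and> (\<forall>j\<le>m. U ! j = T ! j) \<and> U ! Suc m = grow (T ! m) r"
  using assms
proof (induction "l - m" arbitrary: T l)
  case 0
  then show ?case using row(2)[of T m] by (intro exI[of _ T]) auto
next
  case (Suc d)
  then obtain i where i: "l = Suc i" "m \<le> i" by (cases l) auto
  note T = \<open>T \<in> \<T>\<close>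
  have r1: "1 \<le> r" using row(1)[OF T, of l] Suc.prems by simp
  have ri: "row T i \<noteq> r" using Suc.prems(5)[of i] i by simp
  have len: "length T = Suc k" using tableau_facts(1)[OF T] .
  note ro = row[OF T, of i] row[OF T, of l]
  have "\<not> near (c T (Suc i)) (c T (Suc (Suc i)))"
  proof
    assume nr: "near (c T (Suc i)) (c T (Suc (Suc i)))"
    have \<mu>: "is_partn (T ! i)" "is_partn (grow (T ! i) (row T i))"
      "is_partn (grow (grow (T ! i) (row T i)) r)"
      using tableau_facts(6)[OF T, of i] ro Suc.prems i by auto
    have "zc (grow (T ! i) (row T i)) r = zc (T ! i) (row T i) + 1 \<or>
        zc (grow (T ! i) (row T i)) r = zc (T ! i) (row T i) - 1"
      using nr ro Suc.prems i near_of_int by simp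
    then have a: "r = Suc (row T i)" "(T ! i) r = (T ! i) (row T i)"
      using two_steps(2,3)[OF \<mu> _ r1] ro Suc.prems i ri by auto
    have "(T ! i) r = (T ! m) r" using Suc.prems i by (intro untouched_row[OF T]) auto
    \<comment> \<open>Adjacency would make row r as long as the row above it. But row r has not
      changed since stage m, where it was strictly shorter, and the row above can only have
      grown.\<close>
    moreover have "(T ! m) r < (T ! m) (row T i)"
      using grow_above[OF Suc.prems(6)] a(1) ro Suc.prems i by auto
    moreover have "(T ! m) (row T i) \<le> (T ! i) (row T i)"
      using Suc.prems i by (intro tableau_mono[OF T]) auto
    ultimately show False using a(2) by simp
  qed
  note adj = switch1_adj[OF T _ this] and li = links_adj[OF T _ this]
  define U where "U = T[Suc i := grow (T ! i) (row T (Suc i))]"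
  have nth: "U ! j = (if j = Suc i then grow (T ! i) r else T ! j)" for j
    using len Suc.prems i by (simp add: U_def nth_list_update)
  have U: "U \<in> \<T>" "(T, U) \<in> links" using adj(2) li Suc.prems i by (auto simp: U_def)
  have ui: "row U i = r" using r1 by (simp add: row_def nth added_box_grow)
  have uj: "row U j = row T j" if "j < i" for j using that by (simp add: row_def nth)
  have "\<exists>V. (U, V) \<in> links\<^sup>* \<and> (\<forall>j\<le>m. V ! j = U ! j) \<and> V ! Suc m = grow (U ! m) r"
    using Suc.hyps Suc.prems U ui i uj by (intro Suc.hyps(1)[of i]) (auto simp: nth)
  then show ?case using U(2) i by (auto simp: nth intro: converse_rtrancl_into_rtrancl)
qed

text \<open>Row r has to grow at some later step, as it is longer in \<open>lam\<close>; the first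
  such box is the one to be moved down.\<close>

lemma add_first:
  assumes T: "T \<in> \<T>" and m: "m < k" and g: "is_partn (grow (T ! m) r)" and r: "(T ! m) r < lam r"
  shows "\<exists>U. (T, U) \<in> links\<^sup>* \<and> (\<forall>j\<le>m. U ! j = T ! j) \<and> U ! Suc m = grow (T ! m) r"
proof -
  define P where "P l \<longleftrightarrow> m \<le> l \<and> l < k \<and> row T l = r" for l
  have "\<exists>l. P l"
    using untouched_row[OF T, of m k r] m r tableau_facts(2)[OF T] by (force simp: P_def)
  then have "P (LEAST l. P l)" by (rule LeastI_ex)
  moreover have "row T j \<noteq> r" if "m \<le> j" "j < (LEAST l. P l)" for j
    using not_less_Least[OF that(2)] that \<open>P (LEAST l. P l)\<close> by (auto simp: P_def)
  ultimately show ?thesis using move_down[OF T _ _ _ _ g] by (auto simp: P_def)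
qed

text \<open>Induction on the length of the common beginning, downwards from k:
  \<open>add_first\<close> makes T agree with U in one more partition.\<close>

lemma links_same_start:
  assumes "m \<le> k" "T \<in> \<T>" "U \<in> \<T>" "\<And>j. j \<le> m \<Longrightarrow> T ! j = U ! j"
  shows "(T, U) \<in> links\<^sup>*"
  using assms
proof (induction m arbitrary: T rule: inc_induct)
  case base
  then have "T = U" using tableau_facts(1)[of T] tableau_facts(1)[of U] by (intro nth_equalityI) auto
  then show ?case by simp
next
  case (step m)
  note u = row[OF step(5), of m]
  have e: "T ! m = U ! m" using step by simp
  have l: "(U ! Suc m) (row U m) \<le> lam (row U m)"
    using tableau_mono[OF step(5), of "Suc m" k] step(2) tableau_facts(2)[OF step(5)] by auto
  obtain V where V: "(T, V) \<in> links\<^sup>*" "\<forall>j\<le>m. V ! j = T ! j" "V ! Suc m = grow (T ! m) (row U m)"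
    using add_first[OF step(4) step(2), of "row U m"] u step(2) l e by auto
  have "(V, U) \<in> links\<^sup>*"
  proof (rule step.IH)
    show "V \<in> \<T>" using links_star_closed V(1) step(4) by blast
    show "V ! j = U ! j" if "j \<le> Suc m" for j
      using that V(2,3) step.prems(3) u(2) step(2) e by (cases "j = Suc m") auto
  qed (use step in auto)
  then show ?case using V(1) by simp
qed

text \<open>A sum of absolute differences, each written with two truncated subtractions. The first q
  rows suffice because they determine a starting partition.\<close>

definition gap :: "tableau \<Rightarrow> tableau \<Rightarrow> nat" where
  "gap T U = (\<Sum>i = 1..q. ((T ! 0) i - (U ! 0) i) + ((U ! 0) i - (T ! 0) i))"

lemma gap_sym: "gap T U = gap U T"
  by (simp add: gap_def add.commute)

text \<open>Bring a box of row r to the first step, then apply s_0: this lengthens row r of the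
  starting partition. Choosing the least deficient row guarantees that the row above leaves space,
  and its length below a+b makes the box generic.\<close>

lemma links_reduce:
  assumes T: "T \<in> \<T>" and U: "U \<in> \<T>" and i: "1 \<le> i" "i \<le> q" "(T ! 0) i < (U ! 0) i"
  shows "\<exists>V. (T, V) \<in> links\<^sup>* \<and> gap V U < gap T U"
proof -
  define P where "P i \<longleftrightarrow> 1 \<le> i \<and> i \<le> q \<and> (T ! 0) i < (U ! 0) i" for i
  define r where "r = (LEAST i. P i)"
  have Pr: "P r" unfolding r_def using i by (intro LeastI[of P i]) (auto simp: P_def)
  then have r: "1 \<le> r" "r \<le> q" "(T ! 0) r < (U ! 0) r" by (auto simp: P_def)
  note f = tableau_facts[OF T] and f' = tableau_facts[OF U]
  have pT: "is_partn (T ! 0)" and pU: "is_partn (U ! 0)" using f(6)[of 0] f'(6)[of 0] by auto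
  have g: "is_partn (grow (T ! 0) r)"
    unfolding grow_partn_iff[OF pT r(1)]
  proof (cases "r = 1")
    case False
    have "\<not> P (r - 1)" using not_less_Least[of "r - 1" P] False r(1) by (simp add: r_def)
    then have "(U ! 0) (r - 1) \<le> (T ! 0) (r - 1)" using False r by (auto simp: P_def)
    moreover have "(U ! 0) r \<le> (U ! 0) (r - 1)" using False r by (intro partn_antimono[OF pU]) auto
    ultimately show "r = 1 \<or> (T ! 0) r < (T ! 0) (r - 1)" using r(3) by simp
  qed simp
  have "(U ! 0) r \<le> lam r" using tableau_mono[OF U, of 0 k] f'(2) by auto
  then have "(T ! 0) r < lam r" using r by simp
  then obtain V where V: "(T, V) \<in> links\<^sup>*" "V ! 0 = T ! 0" "V ! Suc 0 = grow (T ! 0) r"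
    using add_first[OF T _ g] k1 by auto
  have VT: "V \<in> \<T>" using links_star_closed V(1) T by blast
  have rV: "row V 0 = r" using V r(1) by (simp add: row_def added_box_grow)
  have "(T ! 0) r < a + b" using r(3) P0_facts(6)[OF f'(3) r(1,2)] by simp
  then have "generic (zc (T ! 0) r)" using generic_iff[OF f(3) g r(1)] r(2) by blast
  then have ne: "\<not> exceptional a b p q (c V 1)" using exceptional_generic[OF VT] rV V(2) by simp
  define W where "W = V[0 := partner (row V 0) (V ! 0)]"
  note W = switch1_zero[OF VT ne, folded W_def]
  have "(V, W) \<in> links" using W(1) VT k1 by (auto simp: links_def switch_def intro!: exI[of _ 0])
  then have TW: "(T, W) \<in> links\<^sup>*" using V(1) by simp
  have W0: "W ! 0 = partner r (T ! 0)" using rV V(2) tableau_facts(1)[OF VT] by (simp add: W_def)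
  have "(W ! 0) j = (if j = r then Suc ((T ! 0) r) else (T ! 0) j)" if "j \<le> q" for j
    using that r qp unfolding W0 partner_def by auto
  then have "gap W U < gap T U"
    unfolding gap_def using r by (intro sum_strict_mono_ex1) auto
  then show ?thesis using TW by blast
qed

lemma links_connected: "T \<in> \<T> \<Longrightarrow> U \<in> \<T> \<Longrightarrow> (T, U) \<in> links\<^sup>*"
proof (induction "gap T U" arbitrary: T U rule: less_induct)
  case less
  note f = tableau_facts[OF less.prems(1)] and f' = tableau_facts[OF less.prems(2)]
  have sym: "sym (links\<^sup>*)" using sym_links by (rule sym_rtrancl)
  consider i where "1 \<le> i" "i \<le> q" "(T ! 0) i < (U ! 0) i"
    | i where "1 \<le> i" "i \<le> q" "(U ! 0) i < (T ! 0) i"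
    | "\<And>i. 1 \<le> i \<Longrightarrow> i \<le> q \<Longrightarrow> (T ! 0) i = (U ! 0) i" by (meson nat_neq_iff)
  then show ?case
  proof cases
    case 1
    then obtain V where V: "(T, V) \<in> links\<^sup>*" "gap V U < gap T U"
      using links_reduce less.prems by blast
    then have "(V, U) \<in> links\<^sup>*" using less links_star_closed by blast
    then show ?thesis using V(1) by simp
  next
    case 2
    then obtain V where V: "(U, V) \<in> links\<^sup>*" "gap V T < gap U T"
      using links_reduce less.prems by blast
    then have "(V, T) \<in> links\<^sup>*" using less.hyps[of V T] less.prems links_star_closed gap_sym by metis
    then show ?thesis using V(1) sym by (metis symD rtrancl_trans)
  next
    case 3
    have "(T ! 0) i = (U ! 0) i" for i
    proof -
      consider "i = 0" | "1 \<le> i" "i \<le> q" | "q < i" "i \<le> p" | "p < i" "i \<le> p + q" | "p + q < i" by linarith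
      then show ?thesis
      proof cases
        case 4
        then have "opp i \<le> q" "1 \<le> opp i" by auto
        then show ?thesis using 3 P0_facts(7)[OF f(3) 4] P0_facts(7)[OF f'(3) 4] by simp
      qed (use 3 P0_facts(2-4)[OF f(3)] P0_facts(2-4)[OF f'(3)] in simp_all)
    qed
    then have "T ! 0 = U ! 0" by (simp add: fun_eq_iff)
    then show ?thesis using less.prems by (intro links_same_start[of 0]) auto
  qed
qed

lemma tableaux_nonempty: "\<T> \<noteq> {}"
proof -
  have "\<exists>T. length T = Suc n \<and> T ! n = \<mu> \<and> T ! 0 \<in> P0 \<and> (\<forall>i<n. adds_box (T ! i) (T ! Suc i))"
    if "\<mu> \<in> \<P> a b p q n" for n \<mu>
    using that
  proof (induction n arbitrary: \<mu>)
    case 0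
    then show ?case by (intro exI[of _ "[\<mu>]"]) simp
  next
    case (Suc n)
    then obtain \<nu> where \<nu>: "\<nu> \<in> \<P> a b p q n" "adds_box \<nu> \<mu>" by auto
    then obtain T where T: "length T = Suc n" "T ! n = \<nu>" "T ! 0 \<in> P0"
      "\<forall>i<n. adds_box (T ! i) (T ! Suc i)" using Suc.IH by blast
    then show ?case using \<nu>(2)
      by (intro exI[of _ "T @ [\<mu>]"]) (auto simp: nth_append less_Suc_eq)
  qed
  then obtain T where "length T = Suc k" "T ! k = lam" "T ! 0 \<in> P0"
    "\<forall>i<k. adds_box (T ! i) (T ! Suc i)" using lam by blast
  then have "T \<in> \<T>" by (intro tableauI) (auto simp: adds_box_iff)
  then show ?thesis by blast
qed

end

section \<open>The two-boundary Hecke algebra\<close>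

locale boundary_hecke = boundary_generators k \<tau> x z + scalar_map \<iota>
  for k and \<tau> :: "nat \<Rightarrow> 'r::ring_1" and x z and \<iota> :: "complex \<Rightarrow> 'r" +
  fixes a b p q :: nat
  assumes x_quadratic: "(x - of_nat a) * (x + of_nat p) = 0"
    and y_quadratic: "(z 1 - x - of_nat b) * (z 1 - x + of_nat q) = 0"
begin

definition gen_map :: "gen \<Rightarrow> 'r" where
  "gen_map g = (case g of Gt w \<Rightarrow> t w | Gx i \<Rightarrow> aff x i | Gy i \<Rightarrow> aff y i | Gz i \<Rightarrow> z i)"

abbreviation ev :: "falg \<Rightarrow> 'r" where "ev \<equiv> eval gen_map"

lemma ev_gens [simp]:
  "ev (tg w) = t w" "ev (xg i) = aff x i" "ev (yg i) = aff y i" "ev (zg i) = z i" "ev (fconst u) = \<iota> u"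
  by (simp_all add: gen_elem_def eval_gen gen_map_def fconst_def eval_const)

lemma ev_ops [simp]:
  "ev (f + h) = ev f + ev h" "ev (f - h) = ev f - ev h" "ev (f * h) = ev f * ev h"
  "ev 0 = 0" "ev 1 = 1" "ev (of_nat n) = of_nat n" "ev (sum F A) = (\<Sum>i\<in>A. ev (F i))"
  by (simp_all add: eval_add eval_diff eval_mult eval_zero eval_one eval_of_nat eval_sum)

lemma t_adj_Suc [simp]: "1 \<le> i \<Longrightarrow> i < k \<Longrightarrow> t (transpose i (Suc i)) = \<tau> i"
  using t_adj[of i] by simp

text \<open>The Hecke recursion reduces \<open>x_{j+1} - t_j x_j t_j\<close> to t_j, so each m_{l,i}
  becomes a conjugate of a simple reflection.\<close>

lemma ev_m2:
  assumes "1 \<le> l" "l < i" "i \<le> k"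
  shows "ev (m2 l i) = t (transpose l i)"
proof -
  obtain j where j: "i = Suc j" "1 \<le> j" "j < k" using assms by (cases i) auto
  have d: "aff x (Suc j) - \<tau> j * aff x j * \<tau> j = \<tau> j" using aff_diff j by blast
  show ?thesis
  proof (cases "l = j")
    case True
    then show ?thesis using j d by (simp add: m2_def)
  next
    case False
    then have l: "l < j" using assms j by simp
    have e: "transpose l (Suc j) = transpose l j \<circ> adj j \<circ> transpose l j"
      using l by (auto simp: fun_eq_iff transpose_def)
    have p: "adj j permutes {1..k}" "transpose l j permutes {1..k}"
      using assms j l by (auto intro!: permutes_swap_id)
    have "t (transpose l (Suc j)) = t (transpose l j) * \<tau> j * t (transpose l j)"
      unfolding e using p j by (simp only: t_compose permutes_compose t_adj)
    then show ?thesis using False j d by (simp add: m2_def Let_def)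
  qed
qed

lemma ev_m1: "i \<le> k \<Longrightarrow> ev (m1 i) = msum i"
  unfolding m1_def msum_def ev_ops by (intro sum.cong) (auto intro!: ev_m2)

lemma tau_conj:
  assumes "1 \<le> i" "Suc i < k"
  shows "\<tau> i * \<tau> (Suc i) * \<tau> i * \<tau> (Suc i) * \<tau> i = \<tau> (Suc i)"
proof -
  have "\<tau> i * \<tau> (Suc i) * \<tau> i * \<tau> (Suc i) * \<tau> i = \<tau> (Suc i) * \<tau> i * (\<tau> (Suc i) * \<tau> (Suc i)) * \<tau> i"
    using braid[OF assms] by (simp add: mult.assoc)
  then show ?thesis using assms square[of i] square[of "Suc i"] by (simp add: mult.assoc)
qed

lemma ev_G_rel: "(l, r) \<in> G_rels k \<Longrightarrow> ev l = ev r"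
proof (induction l r rule: G_rels.induct)
  case (z_def i)
  then show ?case using z_decomp[of i] by (simp add: ev_m1)
next
  case (t_mult w w')
  then show ?case using t_compose[of w w'] by simp
next
  case t_one
  then show ?case using t_id by simp
next
  case (xx i j)
  then show ?case using xs_comm[of i j] by (simp add: comm_def)
next
  case (yy i j)
  then show ?case using ys_comm[of i j] by (simp add: comm_def)
next
  case (zz i j)
  then show ?case using z_comm[of i j] by (simp add: comm_def)
next
  case (tx i j)
  then show ?case using aff_comm_other[of x i j, OF x_comm] by (simp add: comm_def)
next
  case (ty i j)
  then show ?case using aff_comm_other[of y i j, OF y_comm] by (simp add: comm_def)
next
  case (tz i j)
  then show ?case using z_other[of i j] by (simp add: comm_def)
next
  case (zsum_x j i)
  then show ?case using zsum_aff[OF comm_zsum_x, of i j] by (simp add: comm_def)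
next
  case (zsum_y j i)
  then show ?case using zsum_aff[OF comm_zsum_y, of i j] by (simp add: comm_def)
next
  case (t_xsum i)
  then show ?case using aff_comm_sum[of i x] by (simp add: comm_def)
next
  case (t_ysum i)
  then show ?case using aff_comm_sum[of i y] by (simp add: comm_def)
next
  case (conj_x i)
  then show ?case using aff_diff[of i x] aff_diff[of "Suc i" x] tau_conj[of i] by simp
next
  case (conj_y i)
  then show ?case using aff_diff[of i y] aff_diff[of "Suc i" y] tau_conj[of i] by simp
next
  case (xy i)
  then show ?case using aff_diff[of i x] aff_diff[of i y] by simp
qed

lemma ev_H_rel: "(l, r) \<in> H_rels a b p q k \<Longrightarrow> ev l = ev r"
proof (induction l r rule: H_rels.induct)
  case (hecke_x i)
  then show ?case using aff_hecke[of i x] by simp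
next
  case (hecke_y i)
  then show ?case using aff_hecke[of i y] by simp
next
  case quad_x
  then show ?case using x_quadratic by simp
next
  case quad_y
  then show ?case using y_quadratic by simp
qed

text \<open>Applied to the set of operators that preserve the span of the tableaux, to conclude that
  the whole algebra preserves it.\<close>

lemma ev_closed:
  assumes "\<And>u v. u \<in> S \<Longrightarrow> v \<in> S \<Longrightarrow> u * v \<in> S" "\<And>u v. u \<in> S \<Longrightarrow> v \<in> S \<Longrightarrow> u + v \<in> S"
    "\<And>u v. u \<in> S \<Longrightarrow> v \<in> S \<Longrightarrow> u - v \<in> S" "\<And>u. \<iota> u \<in> S"
    "\<And>i. 1 \<le> i \<Longrightarrow> i < k \<Longrightarrow> \<tau> i \<in> S" "x \<in> S" "\<And>i. i \<le> k \<Longrightarrow> z i \<in> S" "1 \<le> k"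
    and f: "f \<in> fcarrier k"
  shows "ev f \<in> S"
proof -
  have one: "1 \<in> S" using assms(4)[of 1] by (simp add: scalar_one)
  have zero: "0 \<in> S" using assms(4)[of 0] by (simp add: scalar_zero)
  have af: "aff u i \<in> S" if "u \<in> S" "1 \<le> i" "i \<le> k" for u i
    using that(2,3)
  proof (induction i rule: nat_induct_at_least)
    case base
    then show ?case using that by simp
  next
    case (Suc i)
    then show ?case using assms(1,2,5) by (simp add: aff_step)
  qed
  have "gen_map g \<in> S" if "g \<in> gens k" for g
    using that assms af rho_closed[OF one assms(1) assms(5)] by (auto simp: gens_def gen_map_def)
  then have prods: "prod_list (map gen_map us) \<in> S" if "set us \<subseteq> gens k" for us
    using that by (induction us) (auto simp: one assms(1))
  have sums: "sum F A \<in> S" if "\<And>i. i \<in> A \<Longrightarrow> F i \<in> S" for F :: "gen fword \<Rightarrow> 'r" and A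
    using that by (induction A rule: infinite_finite_induct) (auto simp: zero assms(2))
  show ?thesis
    unfolding eval_def
  proof (rule sums)
    fix u assume "u \<in> Poly_Mapping.keys f"
    then have "set (letters u) \<subseteq> gens k" using f by (auto simp: fcarrier_def)
    then show "\<iota> (Poly_Mapping.lookup f u) * prod_list (map gen_map (letters u)) \<in> S"
      by (intro assms(1,4) prods)
  qed
qed

end

lemma quadratic_factor:
  fixes u :: "'r::ring_1"
  shows "(u - of_nat m) * (u + of_nat n) = u * u - (of_nat m - of_nat n) * u - of_nat (m * n)"
  by (simp add: algebra_simps mult_of_nat_commute[of n u])

section \<open>The reduced relations inside the quotient algebra\<close>

locale hecke_quotient =
  fixes a b p q k :: nat
  assumes k_pos: "1 \<le> k"
begin

abbreviation H where "H \<equiv> H_ext a b p q k"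
abbreviation proj where "proj \<equiv> to_H a b p q k"

lemma proj_add: "f \<in> fcarrier k \<Longrightarrow> g \<in> fcarrier k \<Longrightarrow> proj (f + g) = proj f \<oplus>\<^bsub>H\<^esub> proj g"
  using ring_hom_add[OF to_H_hom[OF k_pos, of a b p q], of f g] by simp

lemma proj_mult: "f \<in> fcarrier k \<Longrightarrow> g \<in> fcarrier k \<Longrightarrow> proj (f * g) = proj f \<otimes>\<^bsub>H\<^esub> proj g"
  using ring_hom_mult[OF to_H_hom[OF k_pos, of a b p q], of f g] by simp

lemma proj_one: "proj 1 = \<one>\<^bsub>H\<^esub>"
  using ring_hom_one[OF to_H_hom[OF k_pos, of a b p q]] by simp

lemma proj_carrier: "f \<in> fcarrier k \<Longrightarrow> proj f \<in> carrier H"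
  by (simp add: H_carrier)

text \<open>Membership in the carrier is part of the relation, so that chains of congruences carry
  their own side conditions.\<close>

definition eqv :: "falg \<Rightarrow> falg \<Rightarrow> bool" (infix "\<approx>" 50) where
  "f \<approx> g \<longleftrightarrow> f \<in> fcarrier k \<and> g \<in> fcarrier k \<and> proj f = proj g"

lemma eqv_refl: "f \<in> fcarrier k \<Longrightarrow> f \<approx> f"
  by (simp add: eqv_def)

lemma eqv_sym: "f \<approx> g \<Longrightarrow> g \<approx> f"
  by (simp add: eqv_def)

lemma eqv_trans [trans]: "f \<approx> g \<Longrightarrow> g \<approx> e \<Longrightarrow> f \<approx> e"
  by (simp add: eqv_def)

lemma eqv_eq_trans [trans]: "f \<approx> g \<Longrightarrow> g = e \<Longrightarrow> f \<approx> e" "f = g \<Longrightarrow> g \<approx> e \<Longrightarrow> f \<approx> e"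
  by simp_all

lemma eqv_add: "f \<approx> g \<Longrightarrow> f' \<approx> g' \<Longrightarrow> f + f' \<approx> g + g'"
  by (simp add: eqv_def proj_add fcarrier_add)

lemma eqv_mult: "f \<approx> g \<Longrightarrow> f' \<approx> g' \<Longrightarrow> f * f' \<approx> g * g'"
  by (simp add: eqv_def proj_mult fcarrier_mult)

lemma eqv_minus: "f \<approx> g \<Longrightarrow> - f \<approx> - g"
  using eqv_mult[OF eqv_refl[of "-1"], of f g] by (simp add: fcarrier_uminus fcarrier_one)

lemma eqv_diff: "f \<approx> g \<Longrightarrow> f' \<approx> g' \<Longrightarrow> f - f' \<approx> g - g'"
  using eqv_add[OF _ eqv_minus, of f g f' g'] by simp

lemma eqv_sum: "(\<And>i. i \<in> A \<Longrightarrow> F i \<approx> G i) \<Longrightarrow> sum F A \<approx> sum G A"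
  by (induction A rule: infinite_finite_induct) (auto intro: eqv_add eqv_refl fcarrier_zero)

lemma eqv_left: "e \<in> fcarrier k \<Longrightarrow> f \<approx> g \<Longrightarrow> e * f \<approx> e * g"
  by (intro eqv_mult eqv_refl)

lemma eqv_right: "e \<in> fcarrier k \<Longrightarrow> f \<approx> g \<Longrightarrow> f * e \<approx> g * e"
  by (intro eqv_mult eqv_refl)

lemma eqv_G: "(f, g) \<in> G_rels k \<Longrightarrow> f \<approx> g"
  using to_H_G_rel[OF k_pos] G_rels_carrier by (auto simp: eqv_def)

lemma eqv_H: "(f, g) \<in> H_rels a b p q k \<Longrightarrow> f \<approx> g"
  using to_H_H_rel[OF k_pos] H_rels_carrier[OF k_pos] unfolding eqv_def by blast

lemma eqv_perm:
  "w permutes {1..k} \<Longrightarrow> w' permutes {1..k} \<Longrightarrow> tg w * tg w' \<approx> tg (w \<circ> w')"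
  by (intro eqv_G G_rels.t_mult)

lemma eqv_t_square:
  assumes "1 \<le> i" "i < k"
  shows "tg (adj i) * tg (adj i) \<approx> 1"
proof -
  have "tg (adj i) * tg (adj i) \<approx> tg (adj i \<circ> adj i)"
    using assms by (intro eqv_perm adj_permutes)
  also have "adj i \<circ> adj i = id" by simp
  also have "tg id \<approx> 1" by (intro eqv_G G_rels.t_one)
  finally show ?thesis .
qed

lemma eqv_t_far:
  assumes "1 \<le> i" "Suc i < j" "j < k"
  shows "tg (adj i) * tg (adj j) \<approx> tg (adj j) * tg (adj i)"
proof -
  have p: "adj i permutes {1..k}" "adj j permutes {1..k}" using assms by (auto intro!: permutes_swap_id)
  have e: "adj i \<circ> adj j = adj j \<circ> adj i" using assms by (auto simp: fun_eq_iff transpose_def)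
  show ?thesis using eqv_trans[OF eqv_perm[OF p] eqv_sym[OF eqv_perm[OF p(2,1), folded e]]] .
qed

lemma eqv_t_braid:
  assumes "1 \<le> i" "Suc i < k"
  shows "tg (adj i) * tg (adj (Suc i)) * tg (adj i) \<approx> tg (adj (Suc i)) * tg (adj i) * tg (adj (Suc i))"
proof -
  have p: "adj i permutes {1..k}" "adj (Suc i) permutes {1..k}" using assms by (auto intro!: permutes_swap_id)
  have tri: "tg w * tg u * tg v \<approx> tg (w \<circ> u \<circ> v)"
    if "w permutes {1..k}" "u permutes {1..k}" "v permutes {1..k}" for w u v
    using eqv_trans[OF eqv_right[OF fcarrier_t[OF that(3)] eqv_perm[OF that(1,2)]]
        eqv_perm[OF permutes_compose[OF that(2,1)] that(3)]] .
  have e: "adj i \<circ> adj (Suc i) \<circ> adj i = adj (Suc i) \<circ> adj i \<circ> adj (Suc i)"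
    by (auto simp: fun_eq_iff transpose_def)
  show ?thesis using eqv_trans[OF tri[OF p p(1)] eqv_sym[OF tri[OF p(2,1,2), folded e]]] .
qed

lemma affine_conj:
  assumes i: "1 \<le> i" "i < k" and u: "u \<in> fcarrier k" "v \<in> fcarrier k"
    and r: "tg (adj i) * u \<approx> v * tg (adj i) - 1"
  shows "tg (adj i) * u * tg (adj i) + tg (adj i) \<approx> v"
proof -
  let ?s = "tg (adj i)"
  have s: "?s \<in> fcarrier k" using i by (rule fcarrier_adj)
  have "?s * u * ?s + ?s \<approx> (v * ?s - 1) * ?s + ?s"
    using s r by (intro eqv_add eqv_right eqv_refl)
  also have "\<dots> = v * (?s * ?s)" by (simp add: algebra_simps)
  also have "\<dots> \<approx> v * 1" using u eqv_t_square[OF i] by (intro eqv_left)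
  finally show ?thesis by simp
qed

lemma eqv_x_diff:
  assumes i: "1 \<le> i" "i < k"
  shows "xg (Suc i) - tg (adj i) * xg i * tg (adj i) \<approx> tg (adj i)"
proof -
  let ?s = "tg (adj i)"
  have c: "xg i \<in> fcarrier k" "xg (Suc i) \<in> fcarrier k" "?s \<in> fcarrier k"
    using i by (auto intro!: fcarrier_intros)
  have "?s * xg i * ?s + ?s \<approx> xg (Suc i)"
    using affine_conj[OF i c(1,2)] eqv_H[OF H_rels.hecke_x[OF i]] by simp
  then have "xg (Suc i) - ?s * xg i * ?s \<approx> ?s * xg i * ?s + ?s - ?s * xg i * ?s"
    by (rule eqv_diff[OF eqv_sym eqv_refl]) (intro fcarrier_mult c)
  then show ?thesis by simp
qed

lemma eqv_m2:
  assumes l: "1 \<le> l" "l < i" "i \<le> k"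
  shows "m2 l i \<approx> tg (transpose l i)"
proof -
  obtain j where j: "i = Suc j" "1 \<le> j" "j < k" using assms by (cases i) auto
  note d = eqv_x_diff[OF j(2,3)]
  show ?thesis
  proof (cases "l = j")
    case True
    then show ?thesis using j d by (simp add: m2_def)
  next
    case False
    then have lj: "l < j" using l j by simp
    have p: "adj j permutes {1..k}" "transpose l j permutes {1..k}"
      using l j lj by (auto intro!: permutes_swap_id)
    have c: "tg (transpose l j) \<in> fcarrier k" using p by (intro fcarrier_t)
    have e: "transpose l j \<circ> adj j \<circ> transpose l j = transpose l i"
      using lj j by (auto simp: fun_eq_iff transpose_def)
    have "m2 l i = tg (transpose l j) * (xg (Suc j) - tg (adj j) * xg j * tg (adj j)) * tg (transpose l j)"
      using False j by (simp add: m2_def Let_def)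
    also have "\<dots> \<approx> tg (transpose l j) * tg (adj j) * tg (transpose l j)"
      using c d by (intro eqv_left eqv_right)
    also have "\<dots> \<approx> tg (transpose l j \<circ> adj j) * tg (transpose l j)"
      using c eqv_perm[OF p(2,1)] by (intro eqv_right)
    also have "\<dots> \<approx> tg (transpose l j \<circ> adj j \<circ> transpose l j)"
      using p by (intro eqv_perm permutes_compose)
    finally show ?thesis unfolding e .
  qed
qed

lemma eqv_m1: "i \<le> k \<Longrightarrow> m1 i \<approx> (\<Sum>l = 1..<i. tg (transpose l i))"
  unfolding m1_def by (intro eqv_sum eqv_m2) auto

text \<open>Conjugation by s_i sends the transposition (l i) to (l i+1). The sum for i+1 has one
  more summand, s_i itself, whose square yields the constant.\<close>

lemma eqv_m1_hecke:
  assumes i: "1 \<le> i" "i < k"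
  shows "tg (adj i) * m1 i \<approx> m1 (Suc i) * tg (adj i) - 1"
proof -
  let ?s = "tg (adj i)"
  have s: "?s \<in> fcarrier k" using i by (rule fcarrier_adj)
  have swap: "?s * tg (transpose l i) \<approx> tg (transpose l (Suc i)) * ?s" if l: "l \<in> {1..<i}" for l
  proof -
    have p: "adj i permutes {1..k}" "transpose l i permutes {1..k}" "transpose l (Suc i) permutes {1..k}"
      using l i by (auto intro!: permutes_swap_id)
    have e: "adj i \<circ> transpose l i = transpose l (Suc i) \<circ> adj i"
      using l by (auto simp: fun_eq_iff transpose_def)
    show ?thesis
      using eqv_trans[OF eqv_perm[OF p(1,2)] eqv_sym[OF eqv_perm[OF p(3,1), folded e]]] .
  qed
  have last: "tg (transpose i (Suc i)) = ?s" by simp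
  have "?s * m1 i \<approx> ?s * (\<Sum>l = 1..<i. tg (transpose l i))"
    using s i by (intro eqv_left eqv_m1) auto
  also have "\<dots> = (\<Sum>l = 1..<i. ?s * tg (transpose l i))" by (simp add: sum_distrib_left)
  also have "\<dots> \<approx> (\<Sum>l = 1..<i. tg (transpose l (Suc i)) * ?s)" by (intro eqv_sum swap)
  also have "\<dots> = (\<Sum>l = 1..<Suc i. tg (transpose l (Suc i))) * ?s - ?s * ?s"
    using i by (simp add: sum_distrib_right distrib_right)
  also have "\<dots> \<approx> m1 (Suc i) * ?s - 1"
    using s i by (intro eqv_diff eqv_right eqv_sym[OF eqv_m1] eqv_t_square) auto
  finally show ?thesis .
qed

lemma eqv_z: "1 \<le> i \<Longrightarrow> i \<le> k \<Longrightarrow> zg i \<approx> xg i + yg i - m1 i"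
  by (intro eqv_G G_rels.z_def)

text \<open>The constants are -1 from x, -1 from y and +1 from - m, together -1.\<close>

lemma eqv_z_hecke:
  assumes i: "1 \<le> i" "i < k"
  shows "tg (adj i) * zg i \<approx> zg (Suc i) * tg (adj i) - 1"
proof -
  let ?s = "tg (adj i)"
  have s: "?s \<in> fcarrier k" using i by (rule fcarrier_adj)
  have "?s * zg i \<approx> ?s * (xg i + yg i - m1 i)" using s i by (intro eqv_left eqv_z) auto
  also have "\<dots> = ?s * xg i + ?s * yg i - ?s * m1 i" by (simp add: algebra_simps)
  also have "\<dots> \<approx> (xg (Suc i) * ?s - 1) + (yg (Suc i) * ?s - 1) - (m1 (Suc i) * ?s - 1)"
    using eqv_H[OF H_rels.hecke_x[OF i]] eqv_H[OF H_rels.hecke_y[OF i]] eqv_m1_hecke[OF i]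
    by (intro eqv_add eqv_diff) auto
  also have "\<dots> = (xg (Suc i) + yg (Suc i) - m1 (Suc i)) * ?s - 1" by (simp add: algebra_simps)
  also have "\<dots> \<approx> zg (Suc i) * ?s - 1"
    using s i by (intro eqv_diff eqv_right eqv_sym[OF eqv_z] eqv_refl fcarrier_one) auto
  finally show ?thesis .
qed

lemma eqv_t_x: "2 \<le> i \<Longrightarrow> i < k \<Longrightarrow> tg (adj i) * xg 1 \<approx> xg 1 * tg (adj i)"
  by (intro eqv_G G_rels.tx) auto

lemma eqv_x_x2:
  assumes "2 \<le> k"
  shows "xg 1 * (tg (adj 1) * xg 1 * tg (adj 1) + tg (adj 1))
    \<approx> (tg (adj 1) * xg 1 * tg (adj 1) + tg (adj 1)) * xg 1"
proof -
  have k: "(1::nat) < k" using assms by simp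
  have c: "xg 1 \<in> fcarrier k" "xg (Suc 1) \<in> fcarrier k" using assms by (auto intro!: fcarrier_intros)
  have x2: "tg (adj 1) * xg 1 * tg (adj 1) + tg (adj 1) \<approx> xg (Suc 1)"
    using affine_conj[OF order_refl k c] eqv_H[OF H_rels.hecke_x[OF order_refl k]] by simp
  have "xg 1 * (tg (adj 1) * xg 1 * tg (adj 1) + tg (adj 1)) \<approx> xg 1 * xg (Suc 1)"
    using c x2 by (intro eqv_left)
  also have "\<dots> \<approx> xg (Suc 1) * xg 1" using assms by (intro eqv_G G_rels.xx) auto
  also have "\<dots> \<approx> (tg (adj 1) * xg 1 * tg (adj 1) + tg (adj 1)) * xg 1"
    using c eqv_sym[OF x2] by (intro eqv_right)
  finally show ?thesis .
qed

lemma eqv_x_quadratic: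
  "xg 1 * xg 1 - (of_nat a - of_nat p) * xg 1 - of_nat (a * p) \<approx> 0"
  using eqv_H[OF H_rels.quad_x] unfolding quadratic_factor .

text \<open>The quadratic relation of y_1 minus that of x_1, with y_1 replaced by z_1 - x_1, which
  is legitimate because m_1 = 0.\<close>

lemma eqv_y_quadratic:
  "zg 1 * zg 1 - zg 1 * xg 1 - xg 1 * zg 1 + (of_nat a - of_nat p) * xg 1 + of_nat (a * p)
    - (of_nat b - of_nat q) * (zg 1 - xg 1) - of_nat (b * q) \<approx> 0"
proof -
  have c: "xg 1 \<in> fcarrier k" "yg 1 \<in> fcarrier k" "zg 1 \<in> fcarrier k"
    using k_pos by (auto intro!: fcarrier_intros)
  have "zg 1 - xg 1 \<approx> xg 1 + yg 1 - m1 1 - xg 1"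
    using c k_pos by (intro eqv_diff eqv_z eqv_refl) auto
  then have y: "zg 1 - xg 1 \<approx> yg 1" by (simp add: m1_def)
  have "zg 1 * zg 1 - zg 1 * xg 1 - xg 1 * zg 1 + (of_nat a - of_nat p) * xg 1 + of_nat (a * p)
      - (of_nat b - of_nat q) * (zg 1 - xg 1) - of_nat (b * q)
    = (zg 1 - xg 1 - of_nat b) * (zg 1 - xg 1 + of_nat q)
      - (xg 1 * xg 1 - (of_nat a - of_nat p) * xg 1 - of_nat (a * p))"
    unfolding quadratic_factor by (simp add: algebra_simps)
  also have "\<dots> \<approx> (yg 1 - of_nat b) * (yg 1 + of_nat q) - 0"
    using y eqv_x_quadratic by (intro eqv_diff eqv_mult eqv_add eqv_refl fcarrier_of_nat)
  also have "\<dots> \<approx> 0 - 0"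
    using eqv_H[OF H_rels.quad_y] by (intro eqv_diff eqv_refl fcarrier_zero)
  finally show ?thesis by simp
qed

end

section \<open>The module spanned by tableaux\<close>

context seminormal
begin

definition x_quad :: "tableau lop" where
  "x_quad = X * X - (of_nat a - of_nat p) * X - of_nat (a * p)"

definition y_quad :: "tableau lop" where
  "y_quad = Z 1 * Z 1 - Z 1 * X - X * Z 1 + (of_nat a - of_nat p) * X + of_nat (a * p)
    - (of_nat b - of_nat q) * (Z 1 - X) - of_nat (b * q)"

definition X2 :: "tableau lop" where "X2 = tau 1 * X * tau 1 + tau 1"

text \<open>Only the relations that constrain the coefficients are listed. Those of the z_i with
  each other, of z_j with distant t_i, and of x_1 with z_0 + z_1 and with z_j for j \<ge> 2 are
  built into the way the moves act on contents.\<close>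

definition relations :: "tableau \<Rightarrow> bool" where
  "relations T \<longleftrightarrow>
    (\<forall>i. 1 \<le> i \<longrightarrow> i < k \<longrightarrow> app (tau i * Z i - (Z (Suc i) * tau i - 1)) (basis_vec T) = 0) \<and>
    app y_quad (basis_vec T) = 0 \<and>
    (\<forall>i j. 1 \<le> i \<longrightarrow> Suc i < j \<longrightarrow> j < k \<longrightarrow> app (tau i * tau j - tau j * tau i) (basis_vec T) = 0) \<and>
    (\<forall>i. 2 \<le> i \<longrightarrow> i < k \<longrightarrow> app (tau i * X - X * tau i) (basis_vec T) = 0) \<and>
    (\<forall>i. 1 \<le> i \<longrightarrow> i < k \<longrightarrow> app (tau i * tau i - 1) (basis_vec T) = 0) \<and>
    app x_quad (basis_vec T) = 0 \<and>
    (\<forall>i. 1 \<le> i \<longrightarrow> Suc i < k \<longrightarrow>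
      app (tau i * tau (Suc i) * tau i - tau (Suc i) * tau i * tau (Suc i)) (basis_vec T) = 0) \<and>
    (2 \<le> k \<longrightarrow> app (X * X2 - X2 * X) (basis_vec T) = 0)"

definition diagonal :: "tableau \<Rightarrow> bool" where
  "diagonal T \<longleftrightarrow>
    (\<forall>i. 1 \<le> i \<longrightarrow> i < k \<longrightarrow> t i T T = 1 / (c T (Suc i) - c T i)) \<and>
    x T T = ((of_nat a - of_nat p) * c T 1 + (c T 1)\<^sup>2 + \<sigma> * \<delta>) / (2 * c T 1)"

definition off_diagonal :: "tableau \<Rightarrow> bool" where
  "off_diagonal T \<longleftrightarrow> (let S = Some T in
    (\<forall>i j. 1 \<le> i \<longrightarrow> Suc i < j \<longrightarrow> j < k \<longrightarrow> eT i (s j S) * eT j S = eT i S * eT j (s i S)) \<and>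
    (\<forall>i. 2 \<le> i \<longrightarrow> i < k \<longrightarrow> eT i (s 0 S) * eX S = eT i S * eX (s i S)) \<and>
    (\<forall>i. 1 \<le> i \<longrightarrow> i < k \<longrightarrow> eT i S * eT i (s i S) = 1 - (t i T T)\<^sup>2) \<and>
    eX S * eX (s 0 S) = - (1 / (2 * c T 1)\<^sup>2) * (c T 1 + \<sigma>) * (c T 1 - \<delta>) * (c T 1 - \<sigma>) * (c T 1 + \<delta>) \<and>
    (\<forall>i. 1 \<le> i \<longrightarrow> Suc i < k \<longrightarrow>
      eT i S * eT (Suc i) (s i S) * eT i (s (Suc i) (s i S))
      = eT (Suc i) S * eT i (s (Suc i) S) * eT (Suc i) (s i (s (Suc i) S))) \<and>
    (2 \<le> k \<longrightarrow>
      eX (s 1 S) * eX (s 1 (s 0 (s 1 S))) * eT 1 S * eT 1 (s 0 (s 1 S))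
      = eX S * eX (s 1 (s 0 S)) * eT 1 (s 0 S) * eT 1 (s 0 (s 1 (s 0 S)))))"

lemma vscale_basis_eq_0: "vscale u (basis_vec T) = 0 \<longleftrightarrow> u = 0"
  by (simp add: basis_vec_neq_0)

lemma opt_vec_eq_0: "opt_vec S = (0 :: tableau \<Rightarrow>\<^sub>0 complex) \<longleftrightarrow> S = None"
  by (cases S) (simp_all add: basis_vec_neq_0)

lemma vscale_opt_eq_0: "vscale (u - v) (opt_vec S) = (0 :: tableau \<Rightarrow>\<^sub>0 complex) \<longleftrightarrow> S = None \<or> u = v"
  by (simp add: opt_vec_eq_0 disj_commute)

lemma relations_diagonal:
  assumes T: "T \<in> \<Lambda>" and R: "relations T"
  shows "diagonal T"
  unfolding diagonal_def
proof (intro conjI allI impI)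
  fix i assume i: "1 \<le> i" "i < k"
  have "app (tau i * Z i - (Z (Suc i) * tau i - 1)) (basis_vec T) = 0"
    using R i unfolding relations_def by blast
  then have "t i T T * (c T i - c T (Suc i)) + 1 = 0"
    unfolding tau_Z_hecke[OF T i] vscale_basis_eq_0 .
  then have "t i T T * (c T (Suc i) - c T i) = 1" by (simp add: algebra_simps)
  then show "t i T T = 1 / (c T (Suc i) - c T i)"
    using content_neq[OF T i] by (simp add: eq_divide_eq)
next
  have "app y_quad (basis_vec T) = 0" using R unfolding relations_def by blast
  then have "- 2 * c T 1 * x T T + ((of_nat a - of_nat p) * c T 1 + (c T 1)\<^sup>2 + \<sigma> * \<delta>) = 0"
    unfolding y_quad_def Y_quadratic[OF T] vscale_basis_eq_0 .
  then have "x T T * (2 * c T 1) = (of_nat a - of_nat p) * c T 1 + (c T 1)\<^sup>2 + \<sigma> * \<delta>"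
    by (simp add: algebra_simps eq_neg_iff_add_eq_0)
  then show "x T T = ((of_nat a - of_nat p) * c T 1 + (c T 1)\<^sup>2 + \<sigma> * \<delta>) / (2 * c T 1)"
    using content_nonzero[OF T] by (simp add: eq_divide_eq)
qed

text \<open>The equivalence is proved for all tableaux together, since the expansion of the
  four-term relation at T uses quadratic relations at other tableaux of its orbit. These come from
  either side, by \<open>quads\<close>.\<close>

lemma relations_iff:
  assumes diag: "\<And>T. T \<in> \<Lambda> \<Longrightarrow> diagonal T"
  shows "(\<forall>T\<in>\<Lambda>. relations T) \<longleftrightarrow> (\<forall>T\<in>\<Lambda>. off_diagonal T)"
proof -
  interpret D: seminormal_tx \<Lambda> k c s \<sigma> \<delta> a b p q t x
    by unfold_locales (use diag in \<open>simp_all add: diagonal_def\<close>)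
  let ?S = "\<lambda>T. Some T"
  have quads: "(relations T \<or> off_diagonal T) \<Longrightarrow>
      (\<forall>i. 1 \<le> i \<longrightarrow> i < k \<longrightarrow> eT i (?S T) * eT i (s i (?S T)) = 1 - (t i T T)\<^sup>2) \<and>
      eX (?S T) * eX (s 0 (?S T)) = D.rho4 (c T 1)" if T: "T \<in> \<Lambda>" for T
  proof (elim disjE)
    assume R: "relations T"
    have "eT i (?S T) * eT i (s i (?S T)) = 1 - (t i T T)\<^sup>2" if i: "1 \<le> i" "i < k" for i
    proof -
      have "app (tau i * tau i - 1) (basis_vec T) = 0" using R i unfolding relations_def by blast
      then have "(t i T T)\<^sup>2 + eT i (?S T) * eT i (s i (?S T)) - 1 = 0"
        unfolding D.tau_square[OF T i] vscale_basis_eq_0 .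
      then show ?thesis by (simp add: algebra_simps)
    qed
    moreover have "app x_quad (basis_vec T) = 0" using R unfolding relations_def by blast
    then have "eX (?S T) * eX (s 0 (?S T)) - D.rho4 (c T 1) = 0"
      unfolding x_quad_def D.X_quadratic[OF T] vscale_basis_eq_0 .
    ultimately show ?thesis by simp
  next
    assume "off_diagonal T"
    then show ?thesis unfolding off_diagonal_def Let_def D.rho4_def by blast
  qed
  have "relations T \<longleftrightarrow> off_diagonal T"
    if T: "T \<in> \<Lambda>" and Q: "\<And>U. U \<in> \<Lambda> \<Longrightarrow>
      (\<forall>i. 1 \<le> i \<longrightarrow> i < k \<longrightarrow> eT i (?S U) * eT i (s i (?S U)) = 1 - (t i U U)\<^sup>2) \<and>
      eX (?S U) * eX (s 0 (?S U)) = D.rho4 (c U 1)" for T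
  proof -
    have S: "?S T \<in> states" using T by simp
    have r1: "app (tau i * Z i - (Z (Suc i) * tau i - 1)) (basis_vec T) = 0" if i: "1 \<le> i" "i < k" for i
    proof -
      have "t i T T * (c T (Suc i) - c T i) = 1"
        using D.t_diag[OF T i] content_neq[OF T i] by simp
      moreover have "t i T T * (c T i - c T (Suc i)) = - (t i T T * (c T (Suc i) - c T i))"
        by (simp add: algebra_simps)
      ultimately have "t i T T * (c T i - c T (Suc i)) + 1 = 0" by simp
      then show ?thesis unfolding tau_Z_hecke[OF T i] by simp
    qed
    have r2: "app y_quad (basis_vec T) = 0"
    proof -
      have "- 2 * c T 1 * x T T + ((of_nat a - of_nat p) * c T 1 + (c T 1)\<^sup>2 + \<sigma> * \<delta>) = 0"
        using D.x_diag[OF T] content_nonzero[OF T] by simp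
      then show ?thesis unfolding y_quad_def Y_quadratic[OF T] by simp
    qed
    have r4: "app (tau i * tau i - 1) (basis_vec T) = 0" if i: "1 \<le> i" "i < k" for i
      unfolding D.tau_square[OF T i] using Q[OF T] i by simp
    have r5: "app x_quad (basis_vec T) = 0"
      unfolding x_quad_def D.X_quadratic[OF T] using Q[OF T] by simp
    \<comment> \<open>In this and the following equivalences the common endpoint may be missing.
      Then both products contain a coefficient leading to \<open>None\<close>, and the equation
      reads 0 = 0.\<close>
    have r3: "app (tau i * tau j - tau j * tau i) (basis_vec T) = 0 \<longleftrightarrow>
        eT i (s j (?S T)) * eT j (?S T) = eT i (?S T) * eT j (s i (?S T))"
      if i: "1 \<le> i" "Suc i < j" "j < k" for i j
      using s_far[OF S i] unfolding D.tau_far[OF T i] vscale_opt_eq_0 by auto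
    have r3x: "app (tau i * X - X * tau i) (basis_vec T) = 0 \<longleftrightarrow>
        eT i (s 0 (?S T)) * eX (?S T) = eT i (?S T) * eX (s i (?S T))"
      if i: "2 \<le> i" "i < k" for i
      using s_far0[OF S i] unfolding D.tau_X_far[OF T i] vscale_opt_eq_0 by auto
    have r6: "app (tau i * tau (Suc i) * tau i - tau (Suc i) * tau i * tau (Suc i)) (basis_vec T) = 0 \<longleftrightarrow>
        eT i (?S T) * eT (Suc i) (s i (?S T)) * eT i (s (Suc i) (s i (?S T)))
        = eT (Suc i) (?S T) * eT i (s (Suc i) (?S T)) * eT (Suc i) (s i (s (Suc i) (?S T)))"
      if i: "1 \<le> i" "Suc i < k" for i
    proof -
      have q: "eT i (?S T) * eT i (s i (?S T)) = 1 - (t i T T)\<^sup>2"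
        "eT (Suc i) (?S T) * eT (Suc i) (s (Suc i) (?S T)) = 1 - (t (Suc i) T T)\<^sup>2"
        using Q[OF T] i by auto
      show ?thesis
        using s_braid[OF S i] unfolding D.tau_braid[OF T i q] vscale_opt_eq_0 by auto
    qed
    have r6x: "app (X * X2 - X2 * X) (basis_vec T) = 0 \<longleftrightarrow>
        eX (s 1 (?S T)) * eX (s 1 (s 0 (s 1 (?S T)))) * eT 1 (?S T) * eT 1 (s 0 (s 1 (?S T)))
        = eX (?S T) * eX (s 1 (s 0 (?S T))) * eT 1 (s 0 (?S T)) * eT 1 (s 0 (s 1 (s 0 (?S T))))"
      if k: "2 \<le> k"
    proof -
      have q1: "eT 1 (?S U) * eT 1 (s 1 (?S U)) = 1 - (t 1 U U)\<^sup>2" if "U \<in> \<Lambda>" for U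
        using Q[OF that] k by auto
      have q2: "eX (?S U) * eX (s 0 (?S U)) = D.rho4 (c U 1)" if "U \<in> \<Lambda>" for U
        using Q[OF that] by blast
      have e: "app (X * X2 - X2 * X) (basis_vec T)
        = vscale (eX (s 1 (?S T)) * eX (s 1 (s 0 (s 1 (?S T)))) * eT 1 (?S T) * eT 1 (s 0 (s 1 (?S T)))
          - eX (?S T) * eX (s 1 (s 0 (?S T))) * eT 1 (s 0 (?S T)) * eT 1 (s 0 (s 1 (s 0 (?S T)))))
          (opt_vec (s 0 (s 1 (s 0 (s 1 (?S T))))))"
        unfolding X2_def by (rule D.X_tau_braid[OF T k q1 q2]) assumption+
      show ?thesis
        using s_braid0[OF S k] unfolding e vscale_opt_eq_0 by auto
    qed
    show ?thesis
      unfolding relations_def off_diagonal_def Let_def D.rho4_def[symmetric]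
      using r1 r2 r3 r3x r4 r5 r6 r6x Q[OF T] by (simp del: One_nat_def app_ops cong: conj_cong)
  qed
  then show ?thesis using quads by blast
qed

lemma lop_eq_if:
  assumes "\<And>T. T \<in> \<Lambda> \<Longrightarrow> app (f - g) (basis_vec T) = 0"
    and "\<And>T. T \<notin> \<Lambda> \<Longrightarrow> app f (basis_vec T) = app g (basis_vec T)"
  shows "f = g"
proof (rule lop_eqI)
  fix T show "app f (basis_vec T) = app g (basis_vec T)"
    using assms(1)[of T] assms(2)[of T] by (cases "T \<in> \<Lambda>") auto
qed

lemma outside:
  assumes "T \<notin> \<Lambda>"
  shows "app (tau i) (basis_vec T) = basis_vec T" "app X (basis_vec T) = vscale (of_nat a) (basis_vec T)"
    "app (Z i) (basis_vec T) = vscale (of_nat a + of_nat b + of_nat i - 1) (basis_vec T)"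
  using assms by (simp_all add: tau_def X_def Z_def app_matrix_op)

lemma boundary_hecke_operators:
  assumes R: "\<And>T. T \<in> \<Lambda> \<Longrightarrow> relations T"
  shows "boundary_hecke k tau X Z scalar_op a b p q"
proof -
  note R' = R[unfolded relations_def]
  note out = outside expand app_vscale
  have sc: "vscale u v - vscale u' v = vscale (u - u') v" for u u' and v :: "tableau \<Rightarrow>\<^sub>0 complex"
    by (simp add: vec.scale_left_diff_distrib)
  show ?thesis
  proof
    show "tau i * tau i = 1" if "1 \<le> i" "i < k" for i
      by (rule lop_eq_if) (use R' that in \<open>auto simp: out simp del: app_ops(4)\<close>)
    show "tau i * tau (Suc i) * tau i = tau (Suc i) * tau i * tau (Suc i)" if "1 \<le> i" "Suc i < k" for i
      by (rule lop_eq_if) (use R' that in \<open>auto simp: out simp del: app_ops(4)\<close>)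
    show "tau i * tau j = tau j * tau i" if "1 \<le> i" "Suc i < j" "j < k" for i j
      by (rule lop_eq_if) (use R' that in \<open>auto simp: out simp del: app_ops(4)\<close>)
    show "comm (tau i) X" if "2 \<le> i" "i < k" for i
      unfolding comm_def by (rule lop_eq_if) (use R' that in \<open>auto simp: out simp del: app_ops(4)\<close>)
    show "comm X (tau 1 * X * tau 1 + tau 1)" if "2 \<le> k"
      unfolding comm_def X2_def[symmetric]
      by (rule lop_eq_if) (use R' that in \<open>auto simp: out X2_def simp del: app_ops(4)\<close>)
    show "comm (Z i) (Z j)" for i j
      by (simp add: comm_def Z_Z_comm)
    show "comm (tau i) (Z j)" if "1 \<le> i" "i < k" "j \<le> k" "j \<noteq> i" "j \<noteq> Suc i" for i j
      unfolding comm_def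
      by (rule lop_eq_if) (use tau_Z_comm that in \<open>auto simp: out\<close>)
    show "tau i * Z i = Z (Suc i) * tau i - 1" if "1 \<le> i" "i < k" for i
    proof (rule lop_eq_if)
      fix T assume T: "T \<notin> \<Lambda>"
      have "vscale (of_nat a + of_nat b + of_nat (Suc i) - 1) (basis_vec T) - basis_vec T
          = vscale (of_nat a + of_nat b + of_nat (Suc i) - 1 - 1) (basis_vec T)"
        by (simp add: vec.scale_left_diff_distrib)
      then show "app (tau i * Z i) (basis_vec T) = app (Z (Suc i) * tau i - 1) (basis_vec T)"
        using T by (simp add: out)
    qed (use R' that in blast)
    show "comm (Z 0 + Z 1) X"
      unfolding comm_def
      by (rule lop_eq_if) (use X_Z01_comm in \<open>auto simp: out algebra_simps\<close>)
    show "comm (Z j) X" if "2 \<le> j" "j \<le> k" for j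
      unfolding comm_def
      by (rule lop_eq_if) (use X_Z_comm that in \<open>auto simp: out algebra_simps\<close>)
    show "(X - of_nat a) * (X + of_nat p) = 0"
      unfolding quadratic_factor
      by (rule lop_eq_if)
        (use R' in \<open>auto simp: out x_quad_def vec.scale_left_diff_distrib[symmetric] algebra_simps\<close>)
    \<comment> \<open>\<open>y_quad\<close> is the difference of the two quadratic relations, so
      adding \<open>x_quad\<close> restores the one for y_1.\<close>
    have "(Z 1 - X - of_nat b) * (Z 1 - X + of_nat q) = y_quad + x_quad"
      unfolding quadratic_factor y_quad_def x_quad_def by (simp add: algebra_simps)
    also have "\<dots> = 0"
    proof (rule lop_eqI)
      fix T
      show "app (y_quad + x_quad) (basis_vec T) = app 0 (basis_vec T)"
      proof (cases "T \<in> \<Lambda>")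
        case True
        then show ?thesis using R' by simp
      next
        case False
        then show ?thesis
          by (simp add: y_quad_def x_quad_def out algebra_simps flip: vec.scale_left_diff_distrib
              vec.scale_left_distrib)
      qed
    qed
    finally show "(Z 1 - X - of_nat b) * (Z 1 - X + of_nat q) = 0" .
  qed
qed

end

lemma fconst_central: "fconst u * f = f * fconst u"
proof (induction f rule: poly_mapping_add_induct)
  case (add f v d)
  then show ?case
    by (simp add: fconst_def distrib_left distrib_right mult_single mult.commute)
qed simp

section \<open>The span of the tableaux and its operators\<close>

locale seminormal_tableaux = boundary_tableaux +
  fixes t :: "nat \<Rightarrow> tableau \<Rightarrow> tableau \<Rightarrow> complex" and x :: "tableau \<Rightarrow> tableau \<Rightarrow> complex"

sublocale seminormal_tableaux \<subseteq> seminormal \<T> k c "switch a b p q"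
  "(of_nat (a + p) + of_nat (b + q)) / 2" "(of_nat (a + p) - of_nat (b + q)) / 2" a b p q t x
  by unfold_locales auto

sublocale seminormal_tableaux \<subseteq> hecke_quotient a b p q k
  by unfold_locales (rule k1)

context seminormal_tableaux
begin

abbreviation s where "s \<equiv> switch a b p q"
abbreviation V :: "(tableau \<Rightarrow>\<^sub>0 complex) set" where "V \<equiv> Hspace a b p q k lam"

definition acts_by :: "(falg set set \<Rightarrow> (tableau \<Rightarrow>\<^sub>0 complex) \<Rightarrow> (tableau \<Rightarrow>\<^sub>0 complex)) \<Rightarrow> bool" where
  "acts_by act \<longleftrightarrow> (\<forall>T \<in> \<T>.
     (\<forall>i \<in> {0..k}. act (w_elem a b p q k i) (basis_vec T) = vscale (c T i) (basis_vec T)) \<and>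
     (\<forall>i \<in> {1..k-1}. act (t_elem a b p q k i) (basis_vec T) =
        vscale (t i T T) (basis_vec T)
        + vscale (entry (t i) (Some T) (s i (Some T))) (opt_vec (s i (Some T)))) \<and>
     act (x_elem a b p q k 1) (basis_vec T) =
        vscale (x T T) (basis_vec T)
        + vscale (entry x (Some T) (s 0 (Some T))) (opt_vec (s 0 (Some T))))"

lemma V_iff: "v \<in> V \<longleftrightarrow> Poly_Mapping.keys v \<subseteq> \<T>"
  by (simp add: Hspace_def span_basis_vec)

lemma V_basis: "T \<in> \<T> \<Longrightarrow> basis_vec T \<in> V"
  by (simp add: V_iff basis_vec_def)

lemma V_opt: "S \<in> states \<Longrightarrow> opt_vec S \<in> V"
  using V_basis by (cases S) (auto simp: V_iff[of 0])

lemma V_subspace: "vec.subspace V"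
  unfolding Hspace_def by (rule vec.subspace_span)

lemmas V_closed = vec.subspace_add[OF V_subspace] vec.subspace_diff[OF V_subspace]
  vec.subspace_scale[OF V_subspace] vec.subspace_0[OF V_subspace]

lemma V_induct [consumes 1, case_names zero step]:
  assumes "v \<in> V" "P 0" "\<And>T u v. T \<in> \<T> \<Longrightarrow> v \<in> V \<Longrightarrow> P v \<Longrightarrow> P (vscale u (basis_vec T) + v)"
  shows "P v"
proof -
  have "v \<in> V \<and> P v"
    using assms(1) unfolding Hspace_def
  proof (induction rule: vec.span_induct_alt)
    case base
    then show ?case using assms(2) vec.span_zero by blast
  next
    case (step u w v)
    then obtain T where "T \<in> \<T>" "w = basis_vec T" by blast
    then show ?case using step assms(3)[of T v u] V_closed(1,3) V_basis
      unfolding Hspace_def[symmetric] by blast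
  qed
  then show ?thesis ..
qed

lemma Suc_state:
  assumes "T \<in> \<T>" "i < k"
  shows "s i (Some T) \<in> states"
  using s_state[of "Some T" i] assms by simp

lemma operators_V:
  assumes "v \<in> V"
  shows "1 \<le> i \<Longrightarrow> i < k \<Longrightarrow> app (tau i) v \<in> V" "app X v \<in> V" "app (Z j) v \<in> V"
proof -
  have step: "app L v \<in> V" if "\<And>T. T \<in> \<T> \<Longrightarrow> app L (basis_vec T) \<in> V" for L
    using assms by (induction rule: V_induct) (auto simp: expand intro!: V_closed that)
  show "app (tau i) v \<in> V" if "1 \<le> i" "i < k"
  proof (rule step)
    fix T assume T: "T \<in> \<T>"
    then show "app (tau i) (basis_vec T) \<in> V"
      using tau_act[of "Some T" i] V_opt[OF Suc_state[OF T that(2)]] V_basis[OF T]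
      by (simp add: V_closed)
  qed
  show "app X v \<in> V"
  proof (rule step)
    fix T assume T: "T \<in> \<T>"
    then show "app X (basis_vec T) \<in> V"
      using X_act[of "Some T"] V_opt[OF Suc_state[OF T, of 0]] V_basis[OF T] k1
      by (simp add: V_closed)
  qed
  show "app (Z j) v \<in> V"
    by (rule step) (auto simp: Z_def app_matrix_op intro!: V_closed V_basis)
qed

section \<open>From a module structure to the relations\<close>

context
  fixes act
  assumes module: "algebra_module H (\<lambda>u. proj (fconst u)) V act" and acts: "acts_by act"
begin

text \<open>That \<open>L\<close> preserves \<open>V\<close> is recorded too, because it is needed
  to compose representations.\<close>

definition rep :: "falg \<Rightarrow> tableau lop \<Rightarrow> bool" where
  "rep f L \<longleftrightarrow> f \<in> fcarrier k \<and> (\<forall>v \<in> V. act (proj f) v = app L v \<and> app L v \<in> V)"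

lemma act_add_left: "f \<in> fcarrier k \<Longrightarrow> g \<in> fcarrier k \<Longrightarrow> v \<in> V \<Longrightarrow>
    act (proj (f + g)) v = act (proj f) v + act (proj g) v"
  using module by (simp add: algebra_module_def proj_add proj_carrier)

lemma act_mult: "f \<in> fcarrier k \<Longrightarrow> g \<in> fcarrier k \<Longrightarrow> v \<in> V \<Longrightarrow>
    act (proj (f * g)) v = act (proj f) (act (proj g) v)"
  using module by (simp add: algebra_module_def proj_mult proj_carrier)

lemma act_const: "v \<in> V \<Longrightarrow> act (proj (fconst u)) v = vscale u v"
  using module by (simp add: algebra_module_def)

lemma act_add: "f \<in> fcarrier k \<Longrightarrow> u \<in> V \<Longrightarrow> v \<in> V \<Longrightarrow> act (proj f) (u + v) = act (proj f) u + act (proj f) v"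
  using module by (simp add: algebra_module_def proj_carrier)

lemma act_closed: "f \<in> fcarrier k \<Longrightarrow> v \<in> V \<Longrightarrow> act (proj f) v \<in> V"
  using module by (simp add: algebra_module_def proj_carrier)

text \<open>Scalars act through \<open>fconst\<close>, and \<open>fconst u\<close> commutes with
  every element of the free algebra.\<close>

lemma act_vscale:
  assumes "f \<in> fcarrier k" "v \<in> V"
  shows "act (proj f) (vscale u v) = vscale u (act (proj f) v)"
proof -
  have "act (proj f) (vscale u v) = act (proj (f * fconst u)) v"
    using assms by (simp add: act_mult act_const fcarrier_const)
  also have "\<dots> = act (proj (fconst u * f)) v" by (simp add: fconst_central)
  also have "\<dots> = vscale u (act (proj f) v)"
    using assms by (simp add: act_mult act_const fcarrier_const act_closed)
  finally show ?thesis .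
qed

lemma repI:
  assumes f: "f \<in> fcarrier k" and b: "\<And>T. T \<in> \<T> \<Longrightarrow> act (proj f) (basis_vec T) = app L (basis_vec T)"
  shows "rep f L"
proof -
  have eq: "act (proj f) v = app L v" if "v \<in> V" for v
    using that
  proof (induction rule: V_induct)
    case zero
    have "act (proj f) (vscale 0 0) = vscale 0 (act (proj f) 0)"
      using f V_closed(4) by (rule act_vscale)
    then show ?case by simp
  next
    case (step T u v)
    then show ?case using f b by (simp add: act_add act_vscale V_closed V_basis expand)
  qed
  show ?thesis unfolding rep_def using f eq act_closed[OF f] by metis
qed

lemma rep_mult: "rep f L \<Longrightarrow> rep g M \<Longrightarrow> rep (f * g) (L * M)"
  by (auto simp: rep_def act_mult fcarrier_mult)

lemma rep_add: "rep f L \<Longrightarrow> rep g M \<Longrightarrow> rep (f + g) (L + M)"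
  by (auto simp: rep_def act_add_left fcarrier_add V_closed)

lemma rep_diff:
  assumes "rep f L" "rep g M"
  shows "rep (f - g) (L - M)"
  unfolding rep_def
proof (intro conjI ballI)
  show c: "f - g \<in> fcarrier k" using assms by (auto simp: rep_def fcarrier_diff)
  fix v assume v: "v \<in> V"
  have "act (proj f) v = act (proj (f - g)) v + act (proj g) v"
    using act_add_left[of "f - g" g v] c assms v by (simp add: rep_def)
  then show "act (proj (f - g)) v = app (L - M) v"
    using assms v by (simp add: rep_def)
  show "app (L - M) v \<in> V" using assms v by (simp add: rep_def V_closed)
qed

lemma rep_one: "rep 1 1"
  using module by (auto simp: rep_def proj_one algebra_module_def fcarrier_one)

lemma rep_zero: "rep 0 0"
  using rep_diff[OF rep_one rep_one] by simp

lemma rep_of_nat: "rep (of_nat n) (of_nat n)"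
  by (induction n) (auto simp: rep_zero intro: rep_add rep_one)

lemma rep_t: "1 \<le> i \<Longrightarrow> i < k \<Longrightarrow> rep (tg (adj i)) (tau i)"
proof (rule repI)
  fix T assume "1 \<le> i" "i < k" "T \<in> \<T>"
  then show "act (proj (tg (adj i))) (basis_vec T) = app (tau i) (basis_vec T)"
    using acts by (auto simp: acts_by_def t_elem_def tau_def app_matrix_op)
qed (rule fcarrier_adj)

lemma rep_t_Suc: "1 \<le> i \<Longrightarrow> i < k \<Longrightarrow> rep (tg (transpose i (Suc i))) (tau i)"
  using rep_t[of i] by simp

lemma rep_x: "rep (xg 1) X"
proof (rule repI)
  fix T assume "T \<in> \<T>"
  then show "act (proj (xg 1)) (basis_vec T) = app X (basis_vec T)"
    using acts by (simp add: acts_by_def x_elem_def X_def app_matrix_op)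
qed (use k1 in \<open>auto intro: fcarrier_x\<close>)

lemmas rep_x_Suc = rep_x[unfolded One_nat_def]

lemma rep_z:
  assumes "i \<le> k"
  shows "rep (zg i) (Z i)"
proof (rule repI)
  show z: "zg i \<in> fcarrier k" using assms by (rule fcarrier_z)
  fix T assume T: "T \<in> \<T>"
  have "act (proj (zg i - fconst (half_shift a b p q) + fconst (half_shift a b p q))) (basis_vec T)
      = act (w_elem a b p q k i) (basis_vec T) + vscale (half_shift a b p q) (basis_vec T)"
    using act_add_left[of "zg i - fconst (half_shift a b p q)" "fconst (half_shift a b p q)"] z T
    by (simp add: w_elem_def fcarrier_diff fcarrier_const V_basis act_const del: diff_add_cancel)
  then show "act (proj (zg i)) (basis_vec T) = app (Z i) (basis_vec T)"
    using acts T assms by (simp add: acts_by_def Z_def app_matrix_op vec.scale_left_distrib)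
qed

lemma rep_eqv:
  assumes "f \<approx> g" "rep f L" "rep g M" "T \<in> \<T>"
  shows "app (L - M) (basis_vec T) = 0"
  using assms V_basis[OF assms(4)] by (simp add: rep_def eqv_def)

lemmas rep_intros = rep_mult rep_add rep_diff rep_one rep_zero rep_of_nat rep_x_Suc

lemma module_relations:
  assumes T: "T \<in> \<T>"
  shows "relations T"
  unfolding relations_def
proof (intro conjI allI impI)
  show "app (tau i * Z i - (Z (Suc i) * tau i - 1)) (basis_vec T) = 0" if "1 \<le> i" "i < k" for i
    using eqv_z_hecke[OF that] by (rule rep_eqv) (use that T in \<open>auto intro!: rep_intros rep_t_Suc rep_z\<close>)
  have "app (y_quad - 0) (basis_vec T) = 0"
    unfolding y_quad_def using eqv_y_quadratic
    by (rule rep_eqv) (use T k1 in \<open>auto intro!: rep_intros rep_z\<close>)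
  then show "app y_quad (basis_vec T) = 0" by simp
  have "app (x_quad - 0) (basis_vec T) = 0"
    unfolding x_quad_def using eqv_x_quadratic
    by (rule rep_eqv) (use T in \<open>auto intro!: rep_intros\<close>)
  then show "app x_quad (basis_vec T) = 0" by simp
  show "app (tau i * tau j - tau j * tau i) (basis_vec T) = 0" if "1 \<le> i" "Suc i < j" "j < k" for i j
    using eqv_t_far[OF that] by (rule rep_eqv) (use that T in \<open>auto intro!: rep_intros rep_t_Suc\<close>)
  show "app (tau i * X - X * tau i) (basis_vec T) = 0" if "2 \<le> i" "i < k" for i
    using eqv_t_x[OF that] by (rule rep_eqv) (use that T in \<open>auto intro!: rep_mult rep_x_Suc rep_t_Suc\<close>)
  show "app (tau i * tau i - 1) (basis_vec T) = 0" if "1 \<le> i" "i < k" for i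
    using eqv_t_square[OF that] by (rule rep_eqv) (use that T in \<open>auto intro!: rep_intros rep_t_Suc\<close>)
  show "app (tau i * tau (Suc i) * tau i - tau (Suc i) * tau i * tau (Suc i)) (basis_vec T) = 0"
    if "1 \<le> i" "Suc i < k" for i
    using eqv_t_braid[OF that] by (rule rep_eqv) (use that T in \<open>auto intro!: rep_mult rep_t_Suc\<close>)
  show "app (X * X2 - X2 * X) (basis_vec T) = 0" if "2 \<le> k"
    unfolding X2_def using eqv_x_x2[OF that]
    by (rule rep_eqv) (use that T in \<open>auto intro!: rep_mult rep_add rep_x_Suc rep_t_Suc\<close>)
qed

end

text \<open>A basis vector in W spreads along the links, whose coefficients are nonzero, and makes W
  everything. If W contains no basis vector, a nonzero element has at least two tableaux in its
  support, and some z_j separates them; this yields a nonzero element of W with smaller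
  support.\<close>

lemma invariant_subspace:
  assumes t_nz: "\<And>T i. T \<in> \<T> \<Longrightarrow> 1 \<le> i \<Longrightarrow> i < k \<Longrightarrow> s i (Some T) \<noteq> None \<Longrightarrow> eT i (Some T) \<noteq> 0"
    and x_nz: "\<And>T. T \<in> \<T> \<Longrightarrow> s 0 (Some T) \<noteq> None \<Longrightarrow> eX (Some T) \<noteq> 0"
    and W: "vec.subspace W" "W \<subseteq> V"
    and tau_W: "\<And>i v. 1 \<le> i \<Longrightarrow> i < k \<Longrightarrow> v \<in> W \<Longrightarrow> app (tau i) v \<in> W"
    and X_W: "\<And>v. v \<in> W \<Longrightarrow> app X v \<in> W" and Z_W: "\<And>i v. i \<le> k \<Longrightarrow> v \<in> W \<Longrightarrow> app (Z i) v \<in> W"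
  shows "W = {0} \<or> W = V"
proof (rule disjCI)
  assume "W \<noteq> V"
  note W_closed = vec.subspace_add[OF W(1)] vec.subspace_diff[OF W(1)]
    vec.subspace_scale[OF W(1)] vec.subspace_0[OF W(1)]
  have all: "W = V" if T: "T \<in> \<T>" "basis_vec T \<in> W" for T
  proof -
    have link: "basis_vec U' \<in> W" if UU: "(U, U') \<in> links" "basis_vec U \<in> W" for U U'
    proof -
      obtain i where i: "U \<in> \<T>" "i < k" "s i (Some U) = Some U'" using UU by (auto simp: links_def)
      have S: "Some U \<in> states" using i by simp
      have "\<exists>e. e \<noteq> 0 \<and> vscale e (basis_vec U') \<in> W"
      proof (cases "i = 0")
        case True
        have "app X (basis_vec U) - vscale (dX (Some U)) (basis_vec U) \<in> W"
          by (rule W_closed(2)[OF X_W W_closed(3)]) (rule UU)+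
        then have "vscale (eX (Some U)) (basis_vec U') \<in> W" using X_act[OF S] i True by simp
        moreover have "eX (Some U) \<noteq> 0" using x_nz i True by simp
        ultimately show ?thesis by blast
      next
        case False
        then have "app (tau i) (basis_vec U) - vscale (dT i (Some U)) (basis_vec U) \<in> W"
          using i by (intro W_closed(2)[OF tau_W W_closed(3)] UU) auto
        then have "vscale (eT i (Some U)) (basis_vec U') \<in> W" using tau_act[OF S, of i] i by simp
        moreover have "eT i (Some U) \<noteq> 0" using t_nz[of U i] i False by simp
        ultimately show ?thesis by blast
      qed
      then obtain e where e: "e \<noteq> 0" "vscale e (basis_vec U') \<in> W" by blast
      then have "vscale (1 / e) (vscale e (basis_vec U')) \<in> W" using W_closed by blast
      then show ?thesis using e by simp
    qed
    have "basis_vec U \<in> W" if "(T, U) \<in> links\<^sup>*" for U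
      using that by (induction rule: rtrancl_induct) (auto intro: T link)
    then have "basis_vec ` \<T> \<subseteq> W" using links_connected[OF T(1)] by blast
    then have "V \<subseteq> W" unfolding Hspace_def using W(1) by (rule vec.span_minimal)
    then show ?thesis using W(2) by blast
  qed
  have "v = 0" if "v \<in> W" for v
    using that
  proof (induction "card (Poly_Mapping.keys v)" arbitrary: v rule: less_induct)
    case less
    show ?case
    proof (rule ccontr)
      assume "v \<noteq> 0"
      then obtain T where T: "T \<in> Poly_Mapping.keys v" by (metis keys_eq_empty ex_in_conv)
      have kv: "Poly_Mapping.keys v \<subseteq> \<T>" using less.prems W(2) V_iff by blast
      show False
      proof (cases "Poly_Mapping.keys v = {T}")
        case True
        define e where "e = Poly_Mapping.lookup v T"
        have e: "e \<noteq> 0" using T by (simp add: e_def in_keys_iff)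
        have "v = vscale e (basis_vec T)"
        proof (rule poly_mapping_eqI)
          fix U show "Poly_Mapping.lookup v U = Poly_Mapping.lookup (vscale e (basis_vec T)) U"
          proof (cases "U = T")
            case False
            then have "U \<notin> Poly_Mapping.keys v" using True by simp
            then show ?thesis using False
              by (simp add: lookup_vscale basis_vec_def lookup_single in_keys_iff)
          qed (simp add: e_def lookup_vscale basis_vec_def)
        qed
        then have "vscale (1 / e) v = basis_vec T" using e by simp
        then have "basis_vec T \<in> W" using W_closed(3)[OF less.prems, of "1 / e"] by simp
        then show False using all[of T] T kv \<open>W \<noteq> V\<close> by blast
      next
        case False
        then obtain U where U: "U \<in> Poly_Mapping.keys v" "U \<noteq> T" using T by blast
        then obtain j where j: "1 \<le> j" "j \<le> k" "c U j \<noteq> c T j"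
          using content_inj[of U T] T kv by blast
        \<comment> \<open>Subtracting the eigenvalue of z_j at T removes T from the support, while U
          stays because j distinguishes the two.\<close>
        define u where "u = app (Z j) v - vscale (c T j + half_shift a b p q) v"
        have uW: "u \<in> W" unfolding u_def
          by (rule W_closed(2)[OF Z_W[OF j(2)] W_closed(3)]) (rule less.prems)+
        have Zv: "Poly_Mapping.lookup (app (Z j) v) Y = (c Y j + half_shift a b p q) * Poly_Mapping.lookup v Y"
          if Y: "Y \<in> \<T>" for Y
        proof -
          have "v \<in> V" using less.prems W(2) by blast
          then show ?thesis
          proof (induction rule: V_induct)
            case (step A e w)
            have "app (Z j) (basis_vec A) = vscale (c A j + half_shift a b p q) (basis_vec A)"
              using step(1) by (simp add: Z_def app_matrix_op)
            moreover have "Poly_Mapping.lookup (basis_vec A) Y = (if A = Y then 1 else 0)"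
              by (simp add: basis_vec_def lookup_single when_def)
            ultimately show ?case using step(3)
              by (simp add: expand lookup_add lookup_vscale algebra_simps)
          qed simp
        qed
        have lu: "Poly_Mapping.lookup u Y = (c Y j - c T j) * Poly_Mapping.lookup v Y" if "Y \<in> \<T>" for Y
          using Zv[OF that] by (simp add: u_def lookup_minus lookup_vscale lookup_add algebra_simps)
        have ku: "Poly_Mapping.keys u \<subseteq> \<T>" using uW W(2) V_iff by blast
        then have "Poly_Mapping.keys u \<subseteq> Poly_Mapping.keys v - {T}"
          using lu by (auto simp: in_keys_iff)
        then have "card (Poly_Mapping.keys u) < card (Poly_Mapping.keys v)"
          using T by (intro psubset_card_mono) auto
        then have "u = 0" using less.hyps uW by blast
        moreover have "Poly_Mapping.lookup u U \<noteq> 0"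
          using lu[of U] U j kv by (auto simp: in_keys_iff)
        ultimately show False by simp
      qed
    qed
  qed
  then show "W = {0}" using W_closed(4) by blast
qed

lemma exists_module:
  assumes R: "\<And>T. T \<in> \<T> \<Longrightarrow> relations T"
    and t_nz: "\<And>T i. T \<in> \<T> \<Longrightarrow> 1 \<le> i \<Longrightarrow> i < k \<Longrightarrow> s i (Some T) \<noteq> None \<Longrightarrow> eT i (Some T) \<noteq> 0"
    and x_nz: "\<And>T. T \<in> \<T> \<Longrightarrow> s 0 (Some T) \<noteq> None \<Longrightarrow> eX (Some T) \<noteq> 0"
  shows "\<exists>act. simple_algebra_module H (\<lambda>u. proj (fconst u)) V act \<and> acts_by act"
proof -
  interpret B: boundary_hecke k tau X Z scalar_op a b p q
    using R by (rule boundary_hecke_operators)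
  \<comment> \<open>An element of the quotient acts through an arbitrary representative;
    \<open>to_H_kernel\<close> shows that the choice does not matter.\<close>
  define act where "act g = app (B.ev (SOME f. f \<in> fcarrier k \<and> proj f = g))" for g
  have act: "act (proj f) = app (B.ev f)" if f: "f \<in> fcarrier k" for f
  proof -
    have "\<exists>f'. f' \<in> fcarrier k \<and> proj f' = proj f" using f by blast
    then have "(SOME f'. f' \<in> fcarrier k \<and> proj f' = proj f) \<in> fcarrier k \<and>
        proj (SOME f'. f' \<in> fcarrier k \<and> proj f' = proj f) = proj f"
      by (rule someI_ex)
    then have "B.ev (SOME f'. f' \<in> fcarrier k \<and> proj f' = proj f) = B.ev f"
      using to_H_kernel[OF k1 B.ev_ops(1) B.ev_ops(3) B.ev_G_rel B.ev_H_rel] f by blast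
    then show ?thesis by (simp add: act_def)
  qed
  have ev_V: "app (B.ev f) v \<in> V" if "f \<in> fcarrier k" "v \<in> V" for f v
  proof -
    have "B.ev f \<in> {L. \<forall>v\<in>V. app L v \<in> V}"
      using that(1) k1 by (intro B.ev_closed) (auto intro!: V_closed operators_V)
    then show ?thesis using that(2) by blast
  qed
  have mod: "algebra_module H (\<lambda>u. proj (fconst u)) V act"
    unfolding algebra_module_def
  proof (intro conjI ballI allI)
    show "vec.subspace V" by (rule V_subspace)
    show "act g v \<in> V" if "g \<in> carrier H" "v \<in> V" for g v
      using that ev_V by (auto simp: H_carrier act)
    show "act g (u + v) = act g u + act g v" if "g \<in> carrier H" for g u v
      using that by (auto simp: H_carrier act app_add)
    show "act (g \<oplus>\<^bsub>H\<^esub> g') v = act g v + act g' v" if "g \<in> carrier H" "g' \<in> carrier H" for g g' v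
      using that by (auto simp: H_carrier act fcarrier_add simp flip: proj_add)
    show "act (g \<otimes>\<^bsub>H\<^esub> g') v = act g (act g' v)" if "g \<in> carrier H" "g' \<in> carrier H" for g g' v
      using that by (auto simp: H_carrier act fcarrier_mult simp flip: proj_mult)
    show "act \<one>\<^bsub>H\<^esub> v = v" for v
      by (simp add: act fcarrier_one flip: proj_one)
    show "act (proj (fconst u)) v = vscale u v" for u v
      by (simp add: act fcarrier_const)
  qed
  have acts: "acts_by act"
    unfolding acts_by_def
  proof (intro ballI conjI)
    fix T assume T: "T \<in> \<T>"
    show "act (w_elem a b p q k i) (basis_vec T) = vscale (c T i) (basis_vec T)" if "i \<in> {0..k}" for i
      using that T by (simp add: w_elem_def act fcarrier_diff fcarrier_z fcarrier_const Z_def app_matrix_op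
          vec.scale_left_distrib)
    show "act (t_elem a b p q k i) (basis_vec T) = vscale (t i T T) (basis_vec T)
        + vscale (entry (t i) (Some T) (s i (Some T))) (opt_vec (s i (Some T)))" if "i \<in> {1..k-1}" for i
    proof -
      have "1 \<le> i" "i < k" using that by auto
      then have "act (proj (tg (adj i))) = app (tau i)"
        using act[OF fcarrier_adj[of i k]] by simp
      then show ?thesis using T by (simp add: t_elem_def tau_def app_matrix_op)
    qed
    show "act (x_elem a b p q k 1) (basis_vec T) = vscale (x T T) (basis_vec T)
        + vscale (entry x (Some T) (s 0 (Some T))) (opt_vec (s 0 (Some T)))"
    proof -
      have "act (proj (xg 1)) = app X" using act[OF fcarrier_x[of 1 k]] k1 by simp
      then show ?thesis using T by (simp add: x_elem_def X_def app_matrix_op)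
    qed
  qed
  obtain T where "T \<in> \<T>" using tableaux_nonempty by blast
  then have "basis_vec T \<in> V" "basis_vec T \<noteq> 0" by (auto simp: V_basis basis_vec_neq_0)
  then have "V \<noteq> {0}" by auto
  moreover have "W = {0} \<or> W = V"
    if W: "vec.subspace W" "W \<subseteq> V" "\<And>g v. g \<in> carrier H \<Longrightarrow> v \<in> W \<Longrightarrow> act g v \<in> W" for W
  proof (rule invariant_subspace[OF t_nz x_nz W(1,2)])
    have inv: "app (B.ev f) v \<in> W" if "f \<in> fcarrier k" "v \<in> W" for f v
      using W(3)[of "proj f" v] that by (simp add: proj_carrier act)
    show "app (tau i) v \<in> W" if "1 \<le> i" "i < k" "v \<in> W" for i v
      using inv[OF fcarrier_adj[of i k], of v] that by simp
    show "app X v \<in> W" if "v \<in> W" for v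
      using inv[OF fcarrier_x[of 1 k], of v] that k1 by simp
    show "app (Z i) v \<in> W" if "i \<le> k" "v \<in> W" for i v
      using inv[OF fcarrier_z[of i k], of v] that by simp
  qed
  ultimately have "simple_algebra_module H (\<lambda>u. proj (fconst u)) V act"
    using mod unfolding simple_algebra_module_def by blast
  then show ?thesis using acts by blast
qed

lemma index_range: "i \<in> {1..k-1} \<longleftrightarrow> 1 \<le> i \<and> i < k"
  using k1 by auto

text \<open>Exchanging i and j exchanges the two sides of the equation, and for i = j both sides are
  the same product. So the ordered pairs at distance at least 2 carry the whole content.\<close>

lemma commutation_iff:
  "(\<forall>i j. 1 \<le> i \<longrightarrow> Suc i < j \<longrightarrow> j < k \<longrightarrow> eT i (s j S) * eT j S = eT i S * eT j (s i S)) \<longleftrightarrow>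
   (\<forall>i \<in> {1..k-1}. \<forall>j \<in> {1..k-1}. j \<noteq> i + 1 \<and> i \<noteq> j + 1 \<longrightarrow>
      entry (t i) (s j S) (s i (s j S)) * entry (t j) S (s j S)
      = entry (t i) S (s i S) * entry (t j) (s i S) (s j (s i S)))" (is "?L \<longleftrightarrow> ?R")
proof
  assume L: ?L
  have "eT i (s j S) * eT j S = eT i S * eT j (s i S)"
    if ij: "1 \<le> i" "i < k" "1 \<le> j" "j < k" "j \<noteq> i + 1" "i \<noteq> j + 1" for i j
  proof -
    consider "Suc i < j" | "Suc j < i" | "i = j" using ij(5,6) by arith
    then show ?thesis
    proof cases
      case 1 then show ?thesis using L ij by blast
    next
      case 2
      then have "eT j (s i S) * eT i S = eT j S * eT i (s j S)" using L ij by blast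
      then show ?thesis by (simp add: mult.commute)
    qed (simp add: mult.commute)
  qed
  then show ?R unfolding eT_def[symmetric] Ball_def index_range by blast
next
  assume R: ?R
  show ?L
  proof (intro allI impI)
    fix i j assume "1 \<le> i" "Suc i < j" "j < k"
    then have "i \<in> {1..k-1}" "j \<in> {1..k-1}" "j \<noteq> i + 1 \<and> i \<noteq> j + 1" by auto
    then show "eT i (s j S) * eT j S = eT i S * eT j (s i S)"
      using R unfolding eT_def by blast
  qed
qed

lemma braid_iff:
  assumes "S \<in> states"
  shows "(\<forall>i. 1 \<le> i \<longrightarrow> Suc i < k \<longrightarrow>
      eT i S * eT (Suc i) (s i S) * eT i (s (Suc i) (s i S))
      = eT (Suc i) S * eT i (s (Suc i) S) * eT (Suc i) (s i (s (Suc i) S))) \<longleftrightarrow>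
   (\<forall>i \<in> {1..k-1}. i + 1 \<in> {1..k-1} \<longrightarrow>
      entry (t i) S (s i S) * entry (t (i+1)) (s i S) (s (i+1) (s i S))
        * entry (t i) (s (i+1) (s i S)) (s i (s (i+1) (s i S)))
      = entry (t (i+1)) S (s (i+1) S) * entry (t i) (s (i+1) S) (s i (s (i+1) S))
        * entry (t (i+1)) (s i (s (i+1) S)) (s i (s (i+1) (s i S))))"
  using s_braid[OF assms] unfolding eT_def Ball_def index_range by auto

end

theorem proposition5p2:
  fixes a b p q k :: nat
    and lam :: partn
    and t :: "nat \<Rightarrow> tableau \<Rightarrow> tableau \<Rightarrow> complex"
    and x :: "tableau \<Rightarrow> tableau \<Rightarrow> complex"
    and c :: "tableau \<Rightarrow> nat \<Rightarrow> complex"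
    and s :: "nat \<Rightarrow> tableau option \<Rightarrow> tableau option"
    and \<sigma> \<delta> :: complex
  defines "c \<equiv> shifted_content a b p q"
    and "s \<equiv> switch a b p q"
    and "\<sigma> \<equiv> (of_nat (a + p) + of_nat (b + q)) / 2"
    and "\<delta> \<equiv> (of_nat (a + p) - of_nat (b + q)) / 2"
  assumes "k \<ge> 1" and "a > 0" and "b > 0" and "p > 0" and "q > 0" and "q \<le> p"
    and "lam \<in> \<P> a b p q k"
    \<comment> \<open>the denominators in (2) and (5) do not vanish\<close>
    and "\<forall>T \<in> tableaux a b p q k lam. c T 1 \<noteq> 0"
    and "\<forall>T \<in> tableaux a b p q k lam. \<forall>i \<in> {1..k-1}.
           entry (t i) (Some T) (s i (Some T)) = 0 \<longleftrightarrow> c T i = c T (i+1) + 1 \<or> c T i = c T (i+1) - 1"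
    and "\<forall>T \<in> tableaux a b p q k lam.
           entry x (Some T) (s 0 (Some T)) = 0 \<longleftrightarrow> exceptional a b p q (c T 1)"
  shows
    "(\<exists>act.
        simple_algebra_module (H_ext a b p q k) (\<lambda>z. to_H a b p q k (fconst z)) (Hspace a b p q k lam) act \<and>
        (\<forall>T \<in> tableaux a b p q k lam.
           (\<forall>i \<in> {0..k}. act (w_elem a b p q k i) (basis_vec T) = vscale (c T i) (basis_vec T)) \<and>
           (\<forall>i \<in> {1..k-1}. act (t_elem a b p q k i) (basis_vec T) =
              vscale (t i T T) (basis_vec T)
              + vscale (entry (t i) (Some T) (s i (Some T))) (opt_vec (s i (Some T)))) \<and>
           act (x_elem a b p q k 1) (basis_vec T) =
              vscale (x T T) (basis_vec T)
              + vscale (entry x (Some T) (s 0 (Some T))) (opt_vec (s 0 (Some T)))))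
     \<longleftrightarrow>
     (\<forall>T \<in> tableaux a b p q k lam. let S = Some T in
        \<comment> \<open>(1)\<close>
        (\<forall>i \<in> {1..k-1}. t i T T = 1 / (c T (i+1) - c T i)) \<and>
        \<comment> \<open>(2)\<close>
        x T T = ((of_nat a - of_nat p) * c T 1 + (c T 1)\<^sup>2 + \<sigma> * \<delta>) / (2 * c T 1) \<and>
        \<comment> \<open>(3)\<close>
        (\<forall>i \<in> {1..k-1}. \<forall>j \<in> {1..k-1}. j \<noteq> i + 1 \<and> i \<noteq> j + 1 \<longrightarrow>
           entry (t i) (s j S) (s i (s j S)) * entry (t j) S (s j S)
           = entry (t i) S (s i S) * entry (t j) (s i S) (s j (s i S))) \<and>
        (\<forall>i \<in> {1..k-1}. i > 1 \<longrightarrow>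
           entry (t i) (s 0 S) (s i (s 0 S)) * entry x S (s 0 S)
           = entry (t i) S (s i S) * entry x (s i S) (s 0 (s i S))) \<and>
        \<comment> \<open>(4)\<close>
        (\<forall>i \<in> {1..k-1}. entry (t i) S (s i S) * entry (t i) (s i S) S = 1 - (t i T T)\<^sup>2) \<and>
        \<comment> \<open>(5)\<close>
        entry x S (s 0 S) * entry x (s 0 S) S
          = - (1 / (2 * c T 1)\<^sup>2) * (c T 1 + \<sigma>) * (c T 1 - \<delta>) * (c T 1 - \<sigma>) * (c T 1 + \<delta>) \<and>
        \<comment> \<open>(6)\<close>
        (\<forall>i \<in> {1..k-1}. i + 1 \<in> {1..k-1} \<longrightarrow>
           entry (t i) S (s i S) * entry (t (i+1)) (s i S) (s (i+1) (s i S))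
             * entry (t i) (s (i+1) (s i S)) (s i (s (i+1) (s i S)))
           = entry (t (i+1)) S (s (i+1) S) * entry (t i) (s (i+1) S) (s i (s (i+1) S))
             * entry (t (i+1)) (s i (s (i+1) S)) (s i (s (i+1) (s i S)))) \<and>
        (2 \<le> k \<longrightarrow>
           entry x (s 1 S) (s 0 (s 1 S)) * entry x (s 1 (s 0 (s 1 S))) (s 0 (s 1 (s 0 (s 1 S))))
             * entry (t 1) S (s 1 S) * entry (t 1) (s 0 (s 1 S)) (s 1 (s 0 (s 1 S)))
           = entry x S (s 0 S) * entry x (s 1 (s 0 S)) (s 0 (s 1 (s 0 S)))
             * entry (t 1) (s 0 S) (s 1 (s 0 S))
             * entry (t 1) (s 0 (s 1 (s 0 S))) (s 1 (s 0 (s 1 (s 0 S))))))"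
proof -
  interpret N: seminormal_tableaux a b p q k lam t x
    using assms by unfold_locales (auto simp: c_def)
  have rng: "i \<in> {1..k-1} \<longleftrightarrow> 1 \<le> i \<and> i < k" for i using \<open>k \<ge> 1\<close> by auto
  \<comment> \<open>By hypothesis a coefficient vanishes only at contents where the move is
    undefined, so every link can be used in the argument for simplicity.\<close>
  have t_nz: "N.eT i (Some T) \<noteq> 0"
    if T: "T \<in> tableaux a b p q k lam" "1 \<le> i" "i < k" "switch a b p q i (Some T) \<noteq> None" for T i
  proof
    assume "N.eT i (Some T) = 0"
    then have "near (c T i) (c T (i + 1))"
      using assms(13) T(1-3) rng by (auto simp: N.eT_def s_def near_def)
    then show False using N.s_near[OF T(1-3)] T(4) by (simp add: c_def)
  qed
  have x_nz: "N.eX (Some T) \<noteq> 0"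
    if T: "T \<in> tableaux a b p q k lam" "switch a b p q 0 (Some T) \<noteq> None" for T
  proof
    assume "N.eX (Some T) = 0"
    then have "exceptional a b p q (c T 1)"
      using assms(14) T(1) by (simp add: N.eX_def s_def)
    then show False using N.switch1_exceptional[of T] T(2) by (simp add: c_def switch_def)
  qed
  have "(\<exists>act. simple_algebra_module (H_ext a b p q k) (\<lambda>z. to_H a b p q k (fconst z))
        (Hspace a b p q k lam) act \<and> N.acts_by act)
      \<longleftrightarrow> (\<forall>T \<in> tableaux a b p q k lam. N.relations T)"
  proof
    assume "\<exists>act. simple_algebra_module (H_ext a b p q k) (\<lambda>z. to_H a b p q k (fconst z))
        (Hspace a b p q k lam) act \<and> N.acts_by act"
    then obtain act where "algebra_module (H_ext a b p q k) (\<lambda>z. to_H a b p q k (fconst z))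
        (Hspace a b p q k lam) act" "N.acts_by act"
      unfolding simple_algebra_module_def by blast
    then show "\<forall>T \<in> tableaux a b p q k lam. N.relations T" using N.module_relations by blast
  next
    assume "\<forall>T \<in> tableaux a b p q k lam. N.relations T"
    then show "\<exists>act. simple_algebra_module (H_ext a b p q k) (\<lambda>z. to_H a b p q k (fconst z))
        (Hspace a b p q k lam) act \<and> N.acts_by act"
      by (intro N.exists_module t_nz x_nz) auto
  qed
  also have "\<dots> \<longleftrightarrow> (\<forall>T \<in> tableaux a b p q k lam. N.diagonal T \<and> N.off_diagonal T)"
    using N.relations_diagonal N.relations_iff by blast
  finally have simple_iff: "(\<exists>act. simple_algebra_module (H_ext a b p q k) (\<lambda>z. to_H a b p q k (fconst z))
        (Hspace a b p q k lam) act \<and> N.acts_by act)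
      \<longleftrightarrow> (\<forall>T \<in> tableaux a b p q k lam. N.diagonal T \<and> N.off_diagonal T)" .
  show ?thesis
    unfolding c_def s_def \<sigma>_def \<delta>_def N.acts_by_def[symmetric] simple_iff
  proof (intro ball_cong refl, goal_cases)
    case (1 T)
    then have S: "Some T \<in> N.states" by simp
    have conj: "A = A' \<Longrightarrow> B = B' \<Longrightarrow> (A \<and> B) = (A' \<and> B')" for A A' B B' :: bool by simp
    show ?case
      unfolding N.diagonal_def N.off_diagonal_def Let_def conj_assoc
      \<comment> \<open>The clauses correspond one by one; (4) and (5) mention the coefficients from
        s_i T and s_0 T back to T, which \<open>eT_back\<close> and \<open>eX_back\<close> rewrite
        as off-diagonal entries at these tableaux.\<close>
      by (intro conj N.commutation_iff N.braid_iff[OF S])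
        (auto simp: rng Ball_def N.eT_def N.eX_def N.eT_back[OF S] N.eX_back[OF S])
  qed
qed

end
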